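(* Let $\nu$ be a Borel probability measure on $\mathbb{R}^d$ whose support lies in the interior of $[0,1]^d$, and assume that there are $a>0$ and $C\ge1$ with $\nu(Q)\le C2^{-ak}$ for all $Q\in\mathcal D_k$, $k\ge0$. For $k\ge1$ and $\theta\in\mathbb{R}$ put $$\Psi_k(\theta)=k\ln2\;\beta_k\Bigl(1+\frac{\theta}{k\ln2}\Bigr)=\ln\int e^{-\theta X_k}\,d\nu,$$ the cumulant generating function of $-X_k$ under $\nu$. (1) $\Psi_k$ is finite and convex, and for $n\ge1$ $$\Psi_k^{(n)}(0)=\frac{\beta_k^{(n)}(1)}{(k\ln2)^{n-1}}=(-1)^n\kappa_n(X_k),$$ where $\kappa_n(X_k)$ is the $n$-th cumulant of $X_k$ under $\nu$. In particular $\Psi_k'(0)=-h_k(\nu)$ and $\Psi_k''(0)=\operatorname{Var}_\nu(X_k)=\beta_k''(1)/(k\ln2)$. (2) The laws of $X_k$ under $\nu$ converge weakly as $k\to\infty$ if and only if $\Psi_k(\theta)$ converges in $\mathbb{R}$ for every $\theta\in\mathbb{R}$. (3) If the laws of $X_k$ under $\nu$ converge weakly to a probability measure $\varrho$, then $\varrho$ is carried by $J_\nu=[\sigma_-,\sigma_+]$, $\Psi(\theta):=\lim_k\Psi_k(\theta)=\ln\int e^{-\theta y}\,d\varrho(y)$, all cumulants of $X_k$ converge to those of $\varrho$, and both dimensions $h(\nu)$ and $D_0(\nu)$ exist: $$h(\nu)=\int y\,d\varrho(y)=-\Psi'(0),\qquad D_0(\nu)=\Bigl(\int\frac1y\,d\varrho(y)\Bigr)^{-1}=\Bigl(\int_0^\infty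 e^{\Psi(\theta)}\,d\theta\Bigr)^{-1};$$ moreover $\beta_k''(1)/(k\ln2)\to\operatorname{Var}(\varrho)=\Psi''(0)$.
   Context: $\log$ is the logarithm to base 2 and $\ln$ the natural logarithm; $\mathbb{R}^d$ carries the maximum norm. $\mathcal D_k$ is the partition of the root cube $[0,1]^d$ into $2^{dk}$ dyadic cubes of side length $2^{-k}$ (half-open cubes, with the outer boundary faces of $[0,1]^d$ assigned to the adjacent end cubes, so that the partitions are disjoint and nested, $\mathcal D_0=\{[0,1]^d\}$). $Q_k(x)$ is the cube of $\mathcal D_k$ containing $x$; the null set of $x$ with some $\nu(Q_k(x))=0$ is discarded. Local information rates: $X_k(x)=-\frac1k\log\nu(Q_k(x))$. Spectrum: $\beta_k(q)=\frac1k\log\sum_{Q\in\mathcal D_k,\nu(Q)>0}\nu(Q)^q$ for $q\in\mathbb{R}$; $\overline\beta(q)=\limsup_k\beta_k(q)$, finite and convex on $(0,\infty)$; $\sigma_-=-\overline\beta'_+(1)$, $\sigma_+=-\overline\beta'_-(1)$ (one-sided derivatives). Entropy: $h_k(\nu)=-\frac1k\sum_{Q\in\mathcal D_k}\nu(Q)\log\nu(Q)$; $h(\nu)=\lim_kh_k(\nu)$ when the limit exists. Quantization: $\mathfrak e_{N,0}(\nu)=\inf_{1\le\#A\le N}\exp\bigl(\int\ln d(x,A)\,d\nu(x)\bigr)$, infimum over non-empty finite $A\subset\mathbb{R}^d$, $d(x,A)=\inf_{y\in A}\|x-y\|_\infty$; $D_0(\nu)=\lim_{N\to\infty}\frac{\log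 N}{-\log\mathfrak e_{N,0}(\nu)}$ when the limit exists. *)

theory Defs
  imports "HOL-Probability.Probability"
begin

section \<open>Dyadic cubes and local information rates\<close>

text \<open>The last interval of each level is closed, so that the outer faces of the unit cube belong
  to the adjacent end cubes.\<close>

definition dyadic_interval :: "nat \<Rightarrow> nat \<Rightarrow> real set" where
  "dyadic_interval k j =
     (if Suc j = 2 ^ k then {real j / 2 ^ k..1} else {real j / 2 ^ k..<real (Suc j) / 2 ^ k})"

definition dyadic_cubes :: "nat \<Rightarrow> (real ^ 'd) set set" where
  "dyadic_cubes k =
     {{x. \<forall>i. x $ i \<in> dyadic_interval k (m i)} | m :: 'd \<Rightarrow> nat. \<forall>i. m i < 2 ^ k}"

definition dyadic_cube_at :: "nat \<Rightarrow> real ^ 'd \<Rightarrow> (real ^ 'd) set" where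
  "dyadic_cube_at k x = (THE Q. Q \<in> dyadic_cubes k \<and> x \<in> Q)"

definition topological_support :: "'a::topological_space measure \<Rightarrow> 'a set" where
  "topological_support \<nu> = {x. \<forall>U. open U \<and> x \<in> U \<longrightarrow> measure \<nu> U > 0}"

text \<open>On the null set where the cube has measure zero (or \<open>x\<close> lies outside the unit cube) the value
  is immaterial.  Below, the index \<open>k = 0\<close> is also a junk value (division by zero); it only occurs as
  the first term of sequences whose limits are taken.\<close>

definition info_rate :: "(real ^ 'd) measure \<Rightarrow> nat \<Rightarrow> real ^ 'd \<Rightarrow> real" where
  "info_rate \<nu> k x = - (1 / real k) * log 2 (measure \<nu> (dyadic_cube_at k x))"

section \<open>Spectrum and entropy\<close>

definition spectrum :: "(real ^ 'd) measure \<Rightarrow> nat \<Rightarrow> real \<Rightarrow> real" where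
  "spectrum \<nu> k q =
     1 / real k * log 2 (\<Sum>Q\<in>{Q \<in> dyadic_cubes k. measure \<nu> Q > 0}. measure \<nu> Q powr q)"

text \<open>For a probability measure on the unit cube the upper limit is finite for \<open>q > 0\<close>, the only
  range used, so that the conversion to the reals loses nothing.\<close>

definition upper_spectrum :: "(real ^ 'd) measure \<Rightarrow> real \<Rightarrow> real" where
  "upper_spectrum \<nu> q = real_of_ereal (limsup (\<lambda>k. ereal (spectrum \<nu> k q)))"

definition right_deriv :: "(real \<Rightarrow> real) \<Rightarrow> real \<Rightarrow> real" where
  "right_deriv f x = (THE D. (f has_real_derivative D) (at_right x))"

definition left_deriv :: "(real \<Rightarrow> real) \<Rightarrow> real \<Rightarrow> real" where
  "left_deriv f x = (THE D. (f has_real_derivative D) (at_left x))"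

definition sigma_minus :: "(real ^ 'd) measure \<Rightarrow> real" where
  "sigma_minus \<nu> = - right_deriv (upper_spectrum \<nu>) 1"

definition sigma_plus :: "(real ^ 'd) measure \<Rightarrow> real" where
  "sigma_plus \<nu> = - left_deriv (upper_spectrum \<nu>) 1"

definition level_entropy :: "(real ^ 'd) measure \<Rightarrow> nat \<Rightarrow> real" where
  "level_entropy \<nu> k =
     - (1 / real k) * (\<Sum>Q\<in>dyadic_cubes k. measure \<nu> Q * log 2 (measure \<nu> Q))"

definition entropy_dim :: "(real ^ 'd) measure \<Rightarrow> real" where
  "entropy_dim \<nu> = lim (level_entropy \<nu>)"

section \<open>Geometric mean quantization\<close>

definition max_dist :: "real ^ 'd \<Rightarrow> (real ^ 'd) set \<Rightarrow> real" where
  "max_dist x A = (INF y\<in>A. infnorm (x - y))"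

text \<open>For a compactly supported measure satisfying \<open>\<nu>(Q) \<le> C 2\<^sup>-\<^sup>a\<^sup>k\<close> on all dyadic cubes,
  a finite set \<open>A\<close> is null and \<open>ln (max_dist x A)\<close> is integrable, so neither \<open>ln 0 = 0\<close> nor the
  value of the Bochner integral at non-integrable functions plays a role.\<close>

definition quant_error0 :: "(real ^ 'd) measure \<Rightarrow> nat \<Rightarrow> real" where
  "quant_error0 \<nu> N =
     (INF A\<in>{A. finite A \<and> 1 \<le> card A \<and> card A \<le> N}. exp (\<integral>x. ln (max_dist x A) \<partial>\<nu>))"

definition quant_dim0_seq :: "(real ^ 'd) measure \<Rightarrow> nat \<Rightarrow> real" where
  "quant_dim0_seq \<nu> N = log 2 (real N) / - log 2 (quant_error0 \<nu> N)"

definition quant_dim0 :: "(real ^ 'd) measure \<Rightarrow> real" where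
  "quant_dim0 \<nu> = lim (quant_dim0_seq \<nu>)"

section \<open>Cumulants\<close>

definition cgf :: "'a measure \<Rightarrow> ('a \<Rightarrow> real) \<Rightarrow> real \<Rightarrow> real" where
  "cgf M Y t = ln (\<integral>x. exp (t * Y x) \<partial>M)"

definition cumulant :: "'a measure \<Rightarrow> ('a \<Rightarrow> real) \<Rightarrow> nat \<Rightarrow> real" where
  "cumulant M Y n = (deriv ^^ n) (cgf M Y) 0"

definition variance_of :: "'a measure \<Rightarrow> ('a \<Rightarrow> real) \<Rightarrow> real" where
  "variance_of M Y = (\<integral>x. (Y x - (\<integral>z. Y z \<partial>M))\<^sup>2 \<partial>M)"

definition smooth :: "(real \<Rightarrow> real) \<Rightarrow> bool" where
  "smooth f \<longleftrightarrow> (\<forall>n x. (deriv ^^ n) f differentiable (at x))"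

definition Psi :: "(real ^ 'd) measure \<Rightarrow> nat \<Rightarrow> real \<Rightarrow> real" where
  "Psi \<nu> k \<theta> = real k * ln 2 * spectrum \<nu> k (1 + \<theta> / (real k * ln 2))"

definition Psi_lim :: "(real ^ 'd) measure \<Rightarrow> real \<Rightarrow> real" where
  "Psi_lim \<nu> \<theta> = lim (\<lambda>k. Psi \<nu> k \<theta>)"

definition info_law :: "(real ^ 'd) measure \<Rightarrow> nat \<Rightarrow> real measure" where
  "info_law \<nu> k = distr \<nu> borel (info_rate \<nu> k)"

end

theory Submission
  imports Defs "HOL-Real_Asymp.Real_Asymp"
begin

text \<open>Each \<open>X\<^sub>k\<close> takes finitely many values almost surely, so all its cumulants come from differentiating
  \<open>\<theta> \<mapsto> E exp(\<theta> X\<^sub>k)\<close> under the integral.  Convexity of the spectrum together with \<open>\<beta>\<^sub>k(0) \<le> d\<close> gives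
  \<open>E exp(\<theta> X\<^sub>k) \<le> exp(d \<theta>)\<close> for \<open>0 \<le> \<theta> \<le> k ln 2\<close>; hence the laws are tight and weak convergence upgrades to
  convergence of all exponential moments, whose limits determine the limit law.  Chernoff's bound with
  exponents \<open>q\<close> near 1 confines the limit law to the interval between the one-sided derivatives.

  For the quantization dimension put \<open>n = log N\<close>.  Choosing one point in each dyadic cube of mass at least
  about \<open>1/N\<close> bounds \<open>- log d(x, A)\<close> below by the number of levels \<open>k\<close> with \<open>X\<^sub>k(x) \<le> n / k\<close>; conversely the
  \<open>2\<^sup>-\<^sup>k\<close>-neighbourhood of any \<open>N\<close> points meets at most \<open>3\<^sup>d N\<close> cubes of level \<open>k\<close>, so up to logarithmic
  corrections of \<open>n\<close> the same count is an upper bound.  Its mean, the sum of \<open>P(X\<^sub>k \<le> n / k)\<close> over \<open>k\<close>, is a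
  Riemann sum: divided by \<open>n\<close> it tends to the integral of \<open>\<rho>{y \<le> 1/s}\<close> over \<open>s > 0\<close>, which is the
  \<open>\<rho>\<close>-mean of \<open>1/y\<close>.\<close>

section \<open>Convergence of iterated derivatives\<close>

text \<open>The obstacle is that \<open>X_k\<close> has only a level-dependent bound, while weak
  convergence sees only bounded test functions. The tilt \<theta> = k ln 2 (1 - q) turns exponential
  moments into the spectrum, and the chord of the convex \<open>spectrum\<close> from q = 0 to q =
  1, where it vanishes, gives a bound independent of k. The limit law then lives on [0, d], so its
  moments determine it. The decay hypothesis acts through k X_k >= a k - log C. The limit law stays
  above \<open>a\<close>, so 1/y is bounded, and only levels k <= (r + log C) / a contribute to a
  count with budget r, which gives the rescaled sums a common compact support and a dominating
  function. The two quantization bounds use budgets slightly different from n = log N: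
  \<open>\<psi> n\<close> pays for the nearby cubes on about n / a levels, while n minus a logarithm
  pays for collecting the chosen points of all levels. Both are asymptotic to n, so both counts have
  the same limit.\<close>

text \<open>Pointwise convergence of all derivatives up to order \<open>n\<close>; for a constant sequence this just says that
  \<open>f\<close> is \<open>n\<close> times differentiable, so smoothness and convergence of cumulants are handled together.\<close>

primrec deriv_conv :: "nat \<Rightarrow> (nat \<Rightarrow> real \<Rightarrow> real) \<Rightarrow> (real \<Rightarrow> real) \<Rightarrow> bool" where
  "deriv_conv 0 F f \<longleftrightarrow> (\<forall>x. (\<lambda>k. F k x) \<longlonglongrightarrow> f x)"
| "deriv_conv (Suc n) F f \<longleftrightarrow>
     (\<forall>x. (\<lambda>k. F k x) \<longlonglongrightarrow> f x) \<and> (\<forall>k x. F k differentiable (at x)) \<and>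
     (\<forall>x. f differentiable (at x)) \<and> deriv_conv n (\<lambda>k. deriv (F k)) (deriv f)"

lemma deriv_conv_SucD: "deriv_conv (Suc n) F f \<Longrightarrow> deriv_conv n F f"
  by (induction n arbitrary: F f) auto

lemma deriv_conv_funpow:
  "deriv_conv (n + m) F f \<Longrightarrow> deriv_conv m (\<lambda>k. (deriv ^^ n) (F k)) ((deriv ^^ n) f)"
  by (induction n arbitrary: F f) (auto simp: funpow_swap1)

lemma deriv_conv_tendsto:
  "deriv_conv n F f \<Longrightarrow> (\<lambda>k. (deriv ^^ n) (F k) x) \<longlonglongrightarrow> (deriv ^^ n) f x"
  using deriv_conv_funpow[of n 0 F f] by simp

lemma smooth_iff_deriv: "smooth f \<longleftrightarrow> (\<forall>x. f differentiable (at x)) \<and> smooth (deriv f)"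
  unfolding smooth_def
proof safe
  fix x assume *: "\<forall>n x. (deriv ^^ n) f differentiable at x"
  show "f differentiable at x" using *[rule_format, of 0 x] by simp
  fix n show "(deriv ^^ n) (deriv f) differentiable at x"
    using *[rule_format, of "Suc n" x] by (simp add: funpow_swap1)
next
  fix n x
  assume "\<forall>x. f differentiable at x" "\<forall>n x. (deriv ^^ n) (deriv f) differentiable at x"
  then show "(deriv ^^ n) f differentiable at x"
    by (cases n) (auto simp: funpow_swap1)
qed

lemma smooth_iff_deriv_conv: "smooth f \<longleftrightarrow> (\<forall>n. deriv_conv n (\<lambda>_. f) f)"
proof
  assume "smooth f"
  show "\<forall>n. deriv_conv n (\<lambda>_. f) f"
  proof
    fix n show "deriv_conv n (\<lambda>_. f) f"
      using \<open>smooth f\<close>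
    proof (induction n arbitrary: f)
      case (Suc n)
      then show ?case using smooth_iff_deriv[of f] by simp
    qed simp
  qed
next
  assume *: "\<forall>n. deriv_conv n (\<lambda>_. f) f"
  show "smooth f"
    unfolding smooth_def
  proof safe
    fix n x
    have "deriv_conv (n + Suc 0) (\<lambda>_. f) f" using * by blast
    from deriv_conv_funpow[OF this] show "(deriv ^^ n) f differentiable at x" by simp
  qed
qed

lemma deriv_conv_add:
  "deriv_conv n F f \<Longrightarrow> deriv_conv n G g \<Longrightarrow>
     deriv_conv n (\<lambda>k x. F k x + G k x) (\<lambda>x. f x + g x)"
proof (induction n arbitrary: F f G g)
  case 0
  then show ?case by (auto intro: tendsto_add)
next
  case (Suc n)
  have "deriv (\<lambda>x. F k x + G k x) = (\<lambda>x. deriv (F k) x + deriv (G k) x)" for k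
    using Suc.prems by (auto intro!: ext deriv_add simp: field_differentiable_def real_differentiable_def)
  moreover have "deriv (\<lambda>x. f x + g x) = (\<lambda>x. deriv f x + deriv g x)"
    using Suc.prems by (auto intro!: ext deriv_add simp: field_differentiable_def real_differentiable_def)
  ultimately show ?case using Suc by (auto intro: tendsto_add)
qed

lemma deriv_conv_mult:
  "deriv_conv n F f \<Longrightarrow> deriv_conv n G g \<Longrightarrow>
     deriv_conv n (\<lambda>k x. F k x * G k x) (\<lambda>x. f x * g x)"
proof (induction n arbitrary: F f G g)
  case 0
  then show ?case by (auto intro: tendsto_mult)
next
  case (Suc n)
  have 1: "deriv (\<lambda>x. F k x * G k x) = (\<lambda>x. F k x * deriv (G k) x + deriv (F k) x * G k x)" for k
    using Suc.prems by (auto intro!: ext deriv_mult simp: field_differentiable_def real_differentiable_def)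
  have 2: "deriv (\<lambda>x. f x * g x) = (\<lambda>x. f x * deriv g x + deriv f x * g x)"
    using Suc.prems by (auto intro!: ext deriv_mult simp: field_differentiable_def real_differentiable_def)
  show ?case
    using Suc.prems deriv_conv_SucD[OF Suc.prems(1)] deriv_conv_SucD[OF Suc.prems(2)]
    by (auto intro!: tendsto_mult deriv_conv_add Suc.IH simp: 1 2)
qed

lemma deriv_conv_const: "deriv_conv n (\<lambda>_ _. c) (\<lambda>_. c)"
  by (induction n arbitrary: c) auto

text \<open>The derivative -g'/g^2 contains 1/g again, now needed only to one order less, so the
  product rule closes the induction.\<close>

lemma deriv_conv_inverse:
  assumes "deriv_conv n F f" "\<And>k x. F k x \<noteq> 0" "\<And>x. f x \<noteq> 0"
  shows "deriv_conv n (\<lambda>k x. inverse (F k x)) (\<lambda>x. inverse (f x))"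
  using assms
proof (induction n arbitrary: F f)
  case 0
  then show ?case by (auto intro: tendsto_inverse)
next
  case (Suc n)
  have D: "deriv (\<lambda>x. inverse (g x)) = (\<lambda>x. - 1 * (deriv g x * (inverse (g x) * inverse (g x))))"
    if "\<And>x. g differentiable at x" "\<And>x. g x \<noteq> 0" for g :: "real \<Rightarrow> real"
  proof
    fix x
    have "(g has_real_derivative deriv g x) (at x)"
      using that(1) DERIV_deriv_iff_real_differentiable by blast
    then show "deriv (\<lambda>x. inverse (g x)) x = - 1 * (deriv g x * (inverse (g x) * inverse (g x)))"
      using that(2) by (auto intro!: DERIV_imp_deriv derivative_eq_intros)
  qed
  have 1: "deriv_conv n (\<lambda>k x. inverse (F k x)) (\<lambda>x. inverse (f x))"
    using Suc.IH[OF deriv_conv_SucD[OF Suc.prems(1)]] Suc.prems by blast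
  have "deriv_conv n (\<lambda>k x. - 1 * (deriv (F k) x * (inverse (F k x) * inverse (F k x))))
      (\<lambda>x. - 1 * (deriv f x * (inverse (f x) * inverse (f x))))"
    using Suc.prems(1) by (intro deriv_conv_mult deriv_conv_const 1) simp
  moreover have "deriv (\<lambda>x. inverse (F k x)) =
      (\<lambda>x. - 1 * (deriv (F k) x * (inverse (F k x) * inverse (F k x))))" for k
    using Suc.prems by (intro D) auto
  moreover have "deriv (\<lambda>x. inverse (f x)) = (\<lambda>x. - 1 * (deriv f x * (inverse (f x) * inverse (f x))))"
    using Suc.prems by (intro D) auto
  ultimately have "deriv_conv n (\<lambda>k. deriv (\<lambda>x. inverse (F k x))) (deriv (\<lambda>x. inverse (f x)))"
    by simp
  then show ?case using Suc.prems by (auto intro: tendsto_inverse)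
qed

text \<open>One derivative suffices to leave the logarithm: f'/f is handled by the rules for
  products and inverses.\<close>

lemma deriv_conv_ln:
  assumes "deriv_conv n F f" "\<And>k x. F k x > 0" "\<And>x. f x > 0"
  shows "deriv_conv n (\<lambda>k x. ln (F k x)) (\<lambda>x. ln (f x))"
proof (cases n)
  case 0
  then show ?thesis using assms by (auto intro!: tendsto_ln simp: less_imp_neq[symmetric])
next
  case (Suc m)
  have D: "((\<lambda>x. ln (g x)) has_real_derivative deriv g x * inverse (g x)) (at x)"
    if "\<And>x. g differentiable at x" "\<And>x. g x > 0" for g :: "real \<Rightarrow> real" and x
  proof -
    have "(g has_real_derivative deriv g x) (at x)"
      using that(1) DERIV_deriv_iff_real_differentiable by blast
    then show ?thesis
      using that(2) by (auto intro!: derivative_eq_intros simp: divide_inverse)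
  qed
  have D': "deriv (\<lambda>x. ln (g x)) = (\<lambda>x. deriv g x * inverse (g x))"
    if "\<And>x. g differentiable at x" "\<And>x. g x > 0" for g :: "real \<Rightarrow> real"
    using D[OF that] by (auto intro: DERIV_imp_deriv)
  have nz: "F k x \<noteq> 0" "f x \<noteq> 0" for k x using assms(2)[of k x] assms(3)[of x] by auto
  have "deriv_conv m (\<lambda>k x. inverse (F k x)) (\<lambda>x. inverse (f x))"
    using assms(1) Suc nz by (intro deriv_conv_inverse) (auto dest: deriv_conv_SucD simp del: deriv_conv.simps)
  then have "deriv_conv m (\<lambda>k x. deriv (F k) x * inverse (F k x)) (\<lambda>x. deriv f x * inverse (f x))"
    using assms(1) Suc by (intro deriv_conv_mult) auto
  moreover have "deriv (\<lambda>x. ln (F k x)) = (\<lambda>x. deriv (F k) x * inverse (F k x))" for k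
    using assms Suc by (intro D') auto
  moreover have "deriv (\<lambda>x. ln (f x)) = (\<lambda>x. deriv f x * inverse (f x))"
    using assms Suc by (intro D') auto
  ultimately have "deriv_conv m (\<lambda>k. deriv (\<lambda>x. ln (F k x))) (deriv (\<lambda>x. ln (f x)))"
    by simp
  moreover have "(\<lambda>x. ln (g x)) differentiable at x"
    if "\<And>x. g differentiable at x" "\<And>x. g x > 0" for g :: "real \<Rightarrow> real" and x
    using D[OF that] real_differentiable_def by blast
  ultimately show ?thesis
    using assms Suc nz by (auto intro!: tendsto_ln)
qed

text \<open>\<open>Psi\<close> and \<open>spectrum\<close> are affine reparametrisations of one
  cumulant generating function, so the identities between their derivatives come from this chain
  rule. The prefactor \<open>c\<close> is kept general so that it can absorb one \<open>b\<close>
  per derivative.\<close>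

lemma funpow_deriv_affine:
  fixes f :: "real \<Rightarrow> real"
  assumes "smooth f"
  shows "(deriv ^^ n) (\<lambda>x. c * f (b * x + e)) = (\<lambda>x. c * b ^ n * (deriv ^^ n) f (b * x + e))"
  using assms
proof (induction n arbitrary: f c)
  case (Suc n)
  have "deriv (\<lambda>x. c * f (b * x + e)) = (\<lambda>x. (c * b) * deriv f (b * x + e))"
  proof
    fix x
    have "(f has_real_derivative deriv f (b * x + e)) (at (b * x + e))"
      using Suc.prems smooth_iff_deriv DERIV_deriv_iff_real_differentiable by blast
    then have "((\<lambda>x. f (b * x + e)) has_real_derivative deriv f (b * x + e) * b) (at x)"
      by (rule DERIV_chain2) (auto intro!: derivative_eq_intros)
    from DERIV_cmult[OF this, of c]
    show "deriv (\<lambda>x. c * f (b * x + e)) x = (c * b) * deriv f (b * x + e)"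
      by (intro DERIV_imp_deriv) (simp add: mult_ac)
  qed
  moreover have "smooth (deriv f)" using Suc.prems smooth_iff_deriv by blast
  ultimately show ?case
    using Suc.IH[of "deriv f" "c * b"] by (simp add: funpow_swap1 mult_ac)
qed simp

lemma smooth_affine:
  fixes f :: "real \<Rightarrow> real"
  assumes "smooth f"
  shows "smooth (\<lambda>x. c * f (b * x + e))"
  unfolding smooth_def funpow_deriv_affine[OF assms]
proof safe
  fix n x
  have "(deriv ^^ n) f differentiable at (b * x + e)"
    using assms unfolding smooth_def by blast
  then have "((deriv ^^ n) f \<circ> (\<lambda>x. b * x + e)) differentiable at x"
    by (intro differentiable_chain_at) (auto intro!: derivative_intros)
  then show "(\<lambda>x. c * b ^ n * (deriv ^^ n) f (b * x + e)) differentiable at x"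
    by (intro differentiable_mult differentiable_const) (simp add: o_def)
qed

section \<open>Cumulants of bounded random variables\<close>

lemma abs_exp_minus_linear_le: "\<bar>exp u - 1 - u\<bar> \<le> exp \<bar>u\<bar> * u\<^sup>2" for u :: real
  using Taylor_exp_field[of u 1] by (simp add: algebra_simps power2_eq_square)

text \<open>The n-th moment of the unnormalised law tilted by \<open>exp (t * Y)\<close>.
  Differentiation in \<open>t\<close> raises \<open>n\<close> by one, so the family is closed under
  derivatives.\<close>

definition exp_moment :: "'a measure \<Rightarrow> ('a \<Rightarrow> real) \<Rightarrow> nat \<Rightarrow> real \<Rightarrow> real" where
  "exp_moment M Y n t = (\<integral>x. Y x ^ n * exp (t * Y x) \<partial>M)"

locale bounded_rv = prob_space M for M :: "'a measure" +
  fixes Y :: "'a \<Rightarrow> real" and D :: real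
  assumes rv_measurable [measurable]: "Y \<in> borel_measurable M"
    and rv_bounded: "AE x in M. \<bar>Y x\<bar> \<le> D"
begin

abbreviation mom :: "nat \<Rightarrow> real \<Rightarrow> real" where
  "mom \<equiv> exp_moment M Y"

lemma bound_nonneg: "D \<ge> 0"
proof -
  have "AE x in M. 0 \<le> D" using rv_bounded by eventually_elim simp
  then show ?thesis by simp
qed

lemma pow_exp_bounded: "AE x in M. norm (Y x ^ n * exp (t * Y x)) \<le> D ^ n * exp (\<bar>t\<bar> * D)"
  using rv_bounded
proof eventually_elim
  case (elim x)
  have "t * Y x \<le> \<bar>t\<bar> * \<bar>Y x\<bar>" by (metis abs_ge_self abs_mult)
  also have "\<dots> \<le> \<bar>t\<bar> * D" using elim by (intro mult_left_mono) auto
  finally show ?case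
    using elim bound_nonneg by (auto simp: abs_mult power_abs intro!: mult_mono power_mono)
qed

lemma integrable_pow_exp: "integrable M (\<lambda>x. Y x ^ n * exp (t * Y x))"
  using pow_exp_bounded by (intro integrable_const_bound[where B = "D ^ n * exp (\<bar>t\<bar> * D)"]) auto

lemma integrable_exp: "integrable M (\<lambda>x. exp (t * Y x))"
  using integrable_pow_exp[of 0 t] by simp

lemma integrable_pow: "integrable M (\<lambda>x. Y x ^ n)"
  using integrable_pow_exp[of n 0] by simp

text \<open>Differentiation under the integral with an explicit remainder:
  \<open>exp u - 1 - u\<close> is quadratically small, and boundedness of \<open>Y\<close> makes
  this uniform.\<close>

lemma has_derivative_mom: "(mom n has_real_derivative mom (Suc n) t) (at t)"
proof -
  \<comment> \<open>The first two factors bound \<open>Y ^ n * exp (t * Y)\<close>; the last one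
    bounds the exponential remainder divided by h^2 when
    \<open>\<bar>h\<bar> \<le> 1\<close>.\<close>
  define K where "K = D ^ n * exp (\<bar>t\<bar> * D) * (exp D * D\<^sup>2)"
  have bd: "norm ((mom n (t + h) - mom n t) / h - mom (Suc n) t) \<le> \<bar>h\<bar> * K"
    if h: "h \<noteq> 0" "\<bar>h\<bar> \<le> 1" for h
  proof -
    have eq: "Y x ^ n * exp ((t + h) * Y x) - Y x ^ n * exp (t * Y x) - h * (Y x ^ Suc n * exp (t * Y x))
        = Y x ^ n * exp (t * Y x) * (exp (h * Y x) - 1 - h * Y x)" for x
      by (simp add: algebra_simps exp_add)
    have "mom n (t + h) - mom n t - h * mom (Suc n) t =
        (\<integral>x. Y x ^ n * exp ((t + h) * Y x) - Y x ^ n * exp (t * Y x) - h * (Y x ^ Suc n * exp (t * Y x)) \<partial>M)"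
      unfolding exp_moment_def using integrable_pow_exp[of n "t+h"] integrable_pow_exp[of n t] integrable_pow_exp[of "Suc n" t]
      by (simp del: power_Suc)
    also have "\<dots> = (\<integral>x. Y x ^ n * exp (t * Y x) * (exp (h * Y x) - 1 - h * Y x) \<partial>M)"
      by (simp only: eq)
    also have "norm \<dots> \<le> h\<^sup>2 * K"
    proof (rule order_trans[OF integral_norm_bound integral_le_const])
      show "integrable M (\<lambda>x. norm (Y x ^ n * exp (t * Y x) * (exp (h * Y x) - 1 - h * Y x)))"
        using integrable_pow_exp[of n "t+h"] integrable_pow_exp[of n t] integrable_pow_exp[of "Suc n" t]
        by (intro integrable_norm) (simp only: eq[symmetric] Bochner_Integration.integrable_diff integrable_mult_right)
      show "AE x in M. norm (Y x ^ n * exp (t * Y x) * (exp (h * Y x) - 1 - h * Y x)) \<le> h\<^sup>2 * K"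
        using rv_bounded pow_exp_bounded[of n t]
      proof eventually_elim
        case (elim x)
        have "\<bar>h * Y x\<bar> \<le> 1 * D" using elim h by (simp only: abs_mult) (intro mult_mono, auto)
        then have 1: "exp \<bar>h * Y x\<bar> \<le> exp D" by simp
        have 2: "(h * Y x)\<^sup>2 \<le> h\<^sup>2 * D\<^sup>2"
          using elim by (simp add: power_mult_distrib abs_le_square_iff[symmetric] mult_left_mono)
        have "\<bar>exp (h * Y x) - 1 - h * Y x\<bar> \<le> exp D * (h\<^sup>2 * D\<^sup>2)"
          using abs_exp_minus_linear_le[of "h * Y x"] mult_mono[OF 1 2] by simp
        with elim have "norm (Y x ^ n * exp (t * Y x)) * \<bar>exp (h * Y x) - 1 - h * Y x\<bar>
            \<le> (D ^ n * exp (\<bar>t\<bar> * D)) * (exp D * (h\<^sup>2 * D\<^sup>2))"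
          using bound_nonneg by (intro mult_mono) auto
        then show ?case by (simp add: K_def abs_mult mult_ac)
      qed
    qed
    finally have *: "\<bar>mom n (t + h) - mom n t - h * mom (Suc n) t\<bar> \<le> h\<^sup>2 * K" by simp
    have "(mom n (t + h) - mom n t) / h - mom (Suc n) t = (mom n (t + h) - mom n t - h * mom (Suc n) t) / h"
      using h by (simp add: field_simps)
    also have "norm \<dots> = \<bar>mom n (t + h) - mom n t - h * mom (Suc n) t\<bar> / \<bar>h\<bar>" by simp
    also have "\<dots> \<le> h\<^sup>2 * K / \<bar>h\<bar>" using * by (intro divide_right_mono) auto
    also have "\<dots> = \<bar>h\<bar> * K" using h by (simp add: field_simps power2_eq_square)
    finally show ?thesis .
  qed
  have "((\<lambda>h. (mom n (t + h) - mom n t) / h - mom (Suc n) t) \<longlongrightarrow> 0) (at 0)"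
  proof (rule Lim_null_comparison)
    show "\<forall>\<^sub>F h in at 0. norm ((mom n (t + h) - mom n t) / h - mom (Suc n) t) \<le> \<bar>h\<bar> * K"
      unfolding eventually_at using bd by (intro exI[of _ 1]) auto
    show "((\<lambda>h. \<bar>h\<bar> * K) \<longlongrightarrow> 0) (at 0)" by (auto intro!: tendsto_eq_intros)
  qed
  then show ?thesis unfolding DERIV_def using Lim_null by blast
qed

lemma deriv_mom: "deriv (mom n) = mom (Suc n)"
  using has_derivative_mom by (auto intro: DERIV_imp_deriv)

lemma differentiable_mom: "mom n differentiable (at t)"
  using has_derivative_mom real_differentiable_def by blast

lemma funpow_deriv_mom: "(deriv ^^ m) (mom n) = mom (n + m)"
  by (induction m arbitrary: n) (auto simp: funpow_swap1 deriv_mom)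

lemma mom_pos: "mom 0 t > 0"
proof -
  have "exp (- \<bar>t\<bar> * D) \<le> mom 0 t"
    unfolding exp_moment_def
  proof (rule integral_ge_const)
    show "integrable M (\<lambda>x. Y x ^ 0 * exp (t * Y x))" by (rule integrable_pow_exp)
    show "AE x in M. exp (- \<bar>t\<bar> * D) \<le> Y x ^ 0 * exp (t * Y x)"
      using rv_bounded
    proof eventually_elim
      case (elim x)
      have "- (t * Y x) \<le> \<bar>t\<bar> * \<bar>Y x\<bar>" by (metis abs_ge_minus_self abs_mult)
      also have "\<dots> \<le> \<bar>t\<bar> * D" using elim by (intro mult_left_mono) auto
      finally show ?case by simp
    qed
  qed
  then show ?thesis using exp_gt_zero order_less_le_trans by blast
qed

lemma cgf_eq: "cgf M Y = (\<lambda>t. ln (mom 0 t))"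
  by (auto simp: cgf_def exp_moment_def)

lemma deriv_conv_mom_const: "deriv_conv m (\<lambda>_. mom n) (mom n)"
  by (induction m arbitrary: n) (auto simp: deriv_mom differentiable_mom)

lemma smooth_cgf: "smooth (cgf M Y)"
  unfolding smooth_iff_deriv_conv cgf_eq
  using mom_pos deriv_conv_mom_const by (auto intro!: deriv_conv_ln)

lemma has_derivative_cgf: "(cgf M Y has_real_derivative mom 1 t / mom 0 t) (at t)"
  unfolding cgf_eq using has_derivative_mom[of 0 t] mom_pos[of t]
  by (auto intro!: derivative_eq_intros)

lemma has_derivative2_cgf:
  "((\<lambda>t. mom 1 t / mom 0 t) has_real_derivative
     (mom 2 t * mom 0 t - (mom 1 t)\<^sup>2) / (mom 0 t)\<^sup>2) (at t)"
proof -
  have "((\<lambda>t. mom 1 t / mom 0 t) has_real_derivative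
     (mom (Suc 1) t * mom 0 t - mom 1 t * mom (Suc 0) t) / (mom 0 t * mom 0 t)) (at t)"
    using mom_pos[of t] by (intro DERIV_divide has_derivative_mom) auto
  then show ?thesis by (simp add: power2_eq_square numeral_2_eq_2)
qed

text \<open>This is the sign of the second derivative of \<open>cgf\<close>, namely of a variance
  under the tilted law, whose mean is \<open>c\<close>.\<close>

lemma mom_Cauchy_Schwarz: "(mom 1 t)\<^sup>2 \<le> mom 2 t * mom 0 t"
proof -
  define c where "c = mom 1 t / mom 0 t"
  have "0 \<le> (\<integral>x. (Y x - c)\<^sup>2 * exp (t * Y x) \<partial>M)"
    by (intro integral_nonneg_AE) auto
  also have "\<dots> = (\<integral>x. Y x ^ 2 * exp (t * Y x) - 2 * c * (Y x ^ 1 * exp (t * Y x)) + c\<^sup>2 * (Y x ^ 0 * exp (t * Y x)) \<partial>M)"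
    by (intro Bochner_Integration.integral_cong refl) (simp add: algebra_simps power2_eq_square)
  also have "\<dots> = mom 2 t - 2 * c * mom 1 t + c\<^sup>2 * mom 0 t"
    unfolding exp_moment_def
    using integrable_pow_exp[of 0 t] integrable_pow_exp[of 1 t] integrable_pow_exp[of 2 t]
    by (subst Bochner_Integration.integral_add Bochner_Integration.integral_diff;
        simp del: power_0 power_one_right)+
  also have "\<dots> = mom 2 t - (mom 1 t)\<^sup>2 / mom 0 t"
    using mom_pos[of t] by (simp add: c_def power2_eq_square field_simps)
  finally show ?thesis using mom_pos[of t] by (simp add: field_simps)
qed

lemma convex_cgf: "convex_on UNIV (cgf M Y)"
  using has_derivative_cgf has_derivative2_cgf
  by (rule f''_ge0_imp_convex[rotated]) (use mom_Cauchy_Schwarz in auto)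

lemma deriv_cgf: "deriv (cgf M Y) = (\<lambda>t. mom 1 t / mom 0 t)"
  using has_derivative_cgf by (auto intro: DERIV_imp_deriv)

lemma mom_0_0: "mom 0 0 = 1"
  by (simp add: exp_moment_def prob_space)

lemma deriv_cgf_0: "deriv (cgf M Y) 0 = (\<integral>x. Y x \<partial>M)"
  by (simp add: deriv_cgf mom_0_0) (simp add: exp_moment_def)

lemma deriv2_cgf_0: "(deriv ^^ 2) (cgf M Y) 0 = variance_of M Y"
proof -
  have "(deriv ^^ 2) (cgf M Y) 0 = mom 2 0 - (mom 1 0)\<^sup>2"
    using has_derivative2_cgf[of 0]
    by (simp add: numeral_2_eq_2 deriv_cgf mom_0_0 DERIV_imp_deriv)
  also have "\<dots> = variance_of M Y"
    unfolding variance_of_def exp_moment_def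
    using variance_eq[of Y] integrable_pow[of 1] integrable_pow[of 2] by simp
  finally show ?thesis .
qed

end

text \<open>Convergence is assumed for all \<open>n\<close> at once because each derivative replaces
  \<open>n\<close> by \<open>n + 1\<close>; so no limit has to be interchanged with a
  derivative.\<close>

lemma deriv_conv_exp_moment:
  assumes "\<And>k. bounded_rv (M k) (Y k) (D k)" "bounded_rv M' Y' D'"
    and "\<And>n t. (\<lambda>k. exp_moment (M k) (Y k) n t) \<longlonglongrightarrow> exp_moment M' Y' n t"
  shows "deriv_conv m (\<lambda>k. exp_moment (M k) (Y k) n) (exp_moment M' Y' n)"
  by (induction m arbitrary: n)
    (simp_all add: assms bounded_rv.deriv_mom[OF assms(1)] bounded_rv.deriv_mom[OF assms(2)]
      bounded_rv.differentiable_mom[OF assms(1)] bounded_rv.differentiable_mom[OF assms(2)])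

lemma deriv_conv_cgf:
  assumes "\<And>k. bounded_rv (M k) (Y k) (D k)" "bounded_rv M' Y' D'"
    and "\<And>n t. (\<lambda>k. exp_moment (M k) (Y k) n t) \<longlonglongrightarrow> exp_moment M' Y' n t"
  shows "deriv_conv m (\<lambda>k. cgf (M k) (Y k)) (cgf M' Y')"
  using deriv_conv_ln[OF deriv_conv_exp_moment[OF assms]]
    bounded_rv.mom_pos[OF assms(1)] bounded_rv.mom_pos[OF assms(2)]
  by (simp add: bounded_rv.cgf_eq[OF assms(1)] bounded_rv.cgf_eq[OF assms(2)])

text \<open>Derivatives at 0 give equal moments. On a bounded support the Taylor error of a
  characteristic function tends to 0, so equal moments force equal characteristic functions.\<close>

lemma real_distribution_eqI_exp_moments:
  fixes M N :: "real measure"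
  assumes "real_distribution M" "real_distribution N"
    and "bounded_rv M (\<lambda>x. x) D" "bounded_rv N (\<lambda>x. x) D"
    and eq: "\<And>t. (\<integral>x. exp (t * x) \<partial>M) = (\<integral>x. exp (t * x) \<partial>N)"
  shows "M = N"
proof (rule Levy_uniqueness)
  interpret M: bounded_rv M "\<lambda>x. x" D by fact
  interpret N: bounded_rv N "\<lambda>x. x" D by fact
  interpret MR: real_distribution M by fact
  interpret NR: real_distribution N by fact
  have "M.mom 0 = N.mom 0" using eq by (auto simp: exp_moment_def)
  then have "(deriv ^^ n) (M.mom 0) 0 = (deriv ^^ n) (N.mom 0) 0" for n by simp
  then have mom: "(\<integral>x. x ^ n \<partial>M) = (\<integral>x. x ^ n \<partial>N)" for n
    by (simp add: M.funpow_deriv_mom N.funpow_deriv_mom) (simp add: exp_moment_def)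
  show "char M = char N"
  proof
    fix t
    define P where "P n = (\<Sum>k \<le> n. ((\<i> * complex_of_real t) ^ k / fact k) * complex_of_real (\<integral>x. x ^ k \<partial>M))" for n
    \<comment> \<open>Both characteristic functions share the Taylor polynomial \<open>P n\<close>,
      each with an error of at most twice the displayed quotient.\<close>
    have b: "cmod (char M t - char N t) \<le> 4 * ((\<bar>t\<bar> * D) ^ n / fact n)" for n
    proof -
      have abs: "(\<integral>x. \<bar>x\<bar> ^ n \<partial>M) \<le> D ^ n" "(\<integral>x. \<bar>x\<bar> ^ n \<partial>N) \<le> D ^ n"
        using M.integrable_pow[of n] N.integrable_pow[of n] M.rv_bounded N.rv_bounded
        by (auto intro!: M.integral_le_const N.integral_le_const integrable_abs power_mono
              simp: power_abs[symmetric] elim!: eventually_mono) (auto simp: power_abs intro: power_mono)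
      have "cmod (char M t - P n) \<le> 2 * \<bar>t\<bar> ^ n / fact n * D ^ n"
        using MR.char_approx1[of n t] M.integrable_pow abs(1)
        unfolding P_def by (intro order_trans[OF _ mult_left_mono[OF abs(1)]]) auto
      moreover have "cmod (char N t - P n) \<le> 2 * \<bar>t\<bar> ^ n / fact n * D ^ n"
        using NR.char_approx1[of n t] N.integrable_pow abs(2)
        unfolding P_def mom by (intro order_trans[OF _ mult_left_mono[OF abs(2)]]) auto
      moreover have "cmod (char M t - char N t) \<le> cmod (char M t - P n) + cmod (char N t - P n)"
        using norm_triangle_ineq4[of "char M t - P n" "char N t - P n"] by simp
      ultimately show ?thesis by (simp add: power_mult_distrib)
    qed
    have "(\<lambda>n. 4 * ((\<bar>t\<bar> * D) ^ n / fact n)) \<longlonglongrightarrow> 0"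
      using summable_LIMSEQ_zero[OF summable_exp[of "\<bar>t\<bar> * D"]]
      by (intro tendsto_mult_right_zero) (simp add: divide_inverse mult.commute)
    then have "cmod (char M t - char N t) \<le> 0"
      using b by (intro LIMSEQ_le_const) auto
    then show "char M t = char N t" by simp
  qed
qed fact+

section \<open>Weak convergence\<close>

text \<open>Weak convergence controls distribution functions only at continuity points; monotonicity
  leaves countably many exceptions.\<close>

lemma (in real_distribution) exists_isCont_cdf:
  assumes "s < s'"
  shows "\<exists>t. s < t \<and> t < s' \<and> isCont (cdf M) t"
proof -
  have "uncountable ({s<..<s'} - {t. \<not> isCont (cdf M) t})"
    using assms mono_ctble_discont[of "cdf M"] cdf_nondecreasing
    by (intro uncountable_minus_countable) (auto simp: uncountable_open_interval mono_def)
  then have "{s<..<s'} - {t. \<not> isCont (cdf M) t} \<noteq> {}"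
    by (metis countable_empty)
  then show ?thesis by auto
qed

text \<open>Truncation: the clamped \<open>f\<close> is bounded and continuous, and the spare unit
  in the exponent \<theta> + 1 makes the discarded tail of order \<open>exp (- T)\<close> uniformly
  in k. The moment bound is asked for only eventually, since the information rates provide it only
  once k ln 2 exceeds the exponent.\<close>

lemma weak_conv_integral_exp_bound:
  fixes \<mu> :: "nat \<Rightarrow> real measure" and f :: "real \<Rightarrow> real"
  assumes \<mu>: "\<And>k. real_distribution (\<mu> k)" and \<rho>: "real_distribution \<rho>"
    and conv: "weak_conv_m \<mu> \<rho>"
    and nonneg: "\<And>k. AE y in \<mu> k. 0 \<le> y"
    and bounded: "AE y in \<rho>. 0 \<le> y \<and> y \<le> d"
    and f: "continuous_on UNIV f" "\<And>y. 0 \<le> y \<Longrightarrow> \<bar>f y\<bar> \<le> A * exp (\<theta> * y)" and \<theta>: "\<theta> \<ge> 0"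
    and int: "eventually (\<lambda>k. integrable (\<mu> k) (\<lambda>y. exp ((\<theta> + 1) * y)) \<and>
                 (\<integral>y. exp ((\<theta> + 1) * y) \<partial>\<mu> k) \<le> B) sequentially"
  shows "(\<lambda>k. \<integral>y. f y \<partial>\<mu> k) \<longlonglongrightarrow> (\<integral>y. f y \<partial>\<rho>)"
proof (rule LIMSEQ_I)
  fix e :: real assume "e > 0"
  interpret \<rho>: real_distribution \<rho> by fact
  interpret \<mu>: real_distribution "\<mu> k" for k by (rule \<mu>)
  have [measurable]: "f \<in> borel_measurable borel"
    using f(1) by (rule borel_measurable_continuous_onI)
  have A: "A \<ge> 0" using f(2)[of 0] by simp
  have B: "B \<ge> 0"
  proof -
    obtain k where "integrable (\<mu> k) (\<lambda>y. exp ((\<theta> + 1) * y))" "(\<integral>y. exp ((\<theta> + 1) * y) \<partial>\<mu> k) \<le> B"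
      using eventually_happens[OF int] by auto
    moreover have "0 \<le> (\<integral>y. exp ((\<theta> + 1) * y) \<partial>\<mu> k)" by (intro integral_nonneg_AE) auto
    ultimately show ?thesis by linarith
  qed
  have "((\<lambda>T. exp (- T)) \<longlongrightarrow> (0::real)) at_top"
    by (rule filterlim_compose[OF exp_at_bot filterlim_uminus_at_bot_at_top])
  then have "((\<lambda>T. 2 * A * exp (- T) * B) \<longlongrightarrow> 0) at_top"
    by (intro tendsto_mult_left_zero tendsto_mult_right_zero)
  then have "\<forall>\<^sub>F T in at_top. 2 * A * exp (- T) * B < e / 2"
    using \<open>e > 0\<close> by (intro order_tendstoD) auto
  then have "\<forall>\<^sub>F T in at_top. 2 * A * exp (- T) * B < e / 2 \<and> max 0 d \<le> T"
    using eventually_ge_at_top[of "max 0 d"] by eventually_elim simp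
  then obtain T where T: "2 * A * exp (- T) * B < e / 2" "T \<ge> d" "T \<ge> 0"
    using eventually_happens by fastforce
  \<comment> \<open>Since T >= d, clamping changes nothing \<open>\<rho>\<close>-almost everywhere;
    the lower clamp at 0 keeps the argument where the growth bound on \<open>f\<close>
    holds.\<close>
  define g where "g y = f (max 0 (min y T))" for y
  have g_cont: "continuous_on UNIV g"
    unfolding g_def by (rule continuous_on_compose2[OF f(1)]) (auto intro!: continuous_intros)
  have g_bd: "norm (g y) \<le> A * exp (\<theta> * T)" for y
  proof -
    have "\<bar>g y\<bar> \<le> A * exp (\<theta> * max 0 (min y T))"
      unfolding g_def by (rule f(2)) simp
    also have "\<dots> \<le> A * exp (\<theta> * T)"
      using A \<theta> T by (auto intro!: mult_left_mono)
    finally show ?thesis by simp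
  qed
  have [measurable]: "g \<in> borel_measurable borel"
    using g_cont by (rule borel_measurable_continuous_onI)
  have "(\<lambda>k. \<integral>y. g y \<partial>\<mu> k) \<longlonglongrightarrow> (\<integral>y. g y \<partial>\<rho>)"
    using g_cont g_bd conv \<mu> \<rho>
    by (intro weak_conv_imp_integral_bdd_continuous_conv) (auto simp: continuous_on_eq_continuous_at)
  also have "(\<integral>y. g y \<partial>\<rho>) = (\<integral>y. f y \<partial>\<rho>)"
  proof (rule integral_cong_AE)
    show "AE y in \<rho>. g y = f y"
      using bounded by eventually_elim (use T in \<open>auto simp: g_def\<close>)
  qed auto
  finally have "\<forall>\<^sub>F k in sequentially. \<bar>(\<integral>y. g y \<partial>\<mu> k) - (\<integral>y. f y \<partial>\<rho>)\<bar> < e / 2"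
    using \<open>e > 0\<close> by (auto dest!: tendstoD[where e = "e/2"] simp: dist_real_def)
  with int have "\<forall>\<^sub>F k in sequentially. norm ((\<integral>y. f y \<partial>\<mu> k) - (\<integral>y. f y \<partial>\<rho>)) < e"
  proof eventually_elim
    case (elim k)
    have bd: "AE y in \<mu> k. norm (f y) \<le> A * exp ((\<theta> + 1) * y)"
      using nonneg[of k]
    proof eventually_elim
      case (elim y)
      have "\<bar>f y\<bar> \<le> A * exp (\<theta> * y)" using elim by (rule f(2))
      also have "\<dots> \<le> A * exp ((\<theta> + 1) * y)"
        using A elim by (intro mult_left_mono) (auto simp: algebra_simps)
      finally show ?case by simp
    qed
    have intf: "integrable (\<mu> k) f"
      using elim A bd
      by (intro Bochner_Integration.integrable_bound[of "\<mu> k" "\<lambda>y. A * exp ((\<theta> + 1) * y)" f]) auto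
    have intg: "integrable (\<mu> k) g"
      by (rule \<mu>.integrable_const_bound[of _ "A * exp (\<theta> * T)"]) (use g_bd in auto)
    have "\<bar>(\<integral>y. f y \<partial>\<mu> k) - (\<integral>y. g y \<partial>\<mu> k)\<bar> = \<bar>\<integral>y. f y - g y \<partial>\<mu> k\<bar>"
      using intf intg by simp
    also have "\<dots> \<le> (\<integral>y. \<bar>f y - g y\<bar> \<partial>\<mu> k)" by (rule integral_abs_bound)
    also have "\<dots> \<le> (\<integral>y. 2 * A * exp (- T) * exp ((\<theta> + 1) * y) \<partial>\<mu> k)"
    proof (rule integral_mono_AE)
      show "AE y in \<mu> k. \<bar>f y - g y\<bar> \<le> 2 * A * exp (- T) * exp ((\<theta> + 1) * y)"
        using nonneg[of k]
      proof eventually_elim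
        case (elim y)
        show ?case
        proof (cases "y \<le> T")
          case True
          then show ?thesis using elim A by (simp add: g_def)
        next
          case False
          then have "g y = f T" using T by (simp add: g_def)
          then have "\<bar>f y - g y\<bar> \<le> A * exp (\<theta> * y) + A * exp (\<theta> * T)"
            using f(2)[of y] f(2)[of T] elim T by linarith
          also have "\<dots> \<le> 2 * A * exp (\<theta> * y)"
          proof -
            have "A * exp (\<theta> * T) \<le> A * exp (\<theta> * y)"
              using False A \<theta> by (auto intro!: mult_left_mono)
            then show ?thesis by linarith
          qed
          also have "\<dots> \<le> 2 * A * (exp (- T) * exp ((\<theta> + 1) * y))"
            using False A by (intro mult_left_mono) (auto simp: exp_add[symmetric] algebra_simps)
          finally show ?thesis by (simp add: mult_ac)
        qed
      qed
    qed (use intf intg elim in auto)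
    also have "\<dots> = 2 * A * exp (- T) * (\<integral>y. exp ((\<theta> + 1) * y) \<partial>\<mu> k)" by simp
    also have "\<dots> \<le> 2 * A * exp (- T) * B"
      using elim A by (intro mult_left_mono) auto
    finally show ?case using T elim by (simp add: abs_if split: if_splits)
  qed
  then show "\<exists>N. \<forall>k\<ge>N. norm ((\<integral>y. f y \<partial>\<mu> k) - (\<integral>y. f y \<partial>\<rho>)) < e"
    by (simp add: eventually_sequentially)
qed

text \<open>A single term of the exponential series bounds \<open>y ^ n\<close>. This supplies
  \<open>A\<close> and \<theta> for \<open>weak_conv_integral_exp_bound\<close>.\<close>

lemma pow_exp_le:
  fixes y t :: real assumes "0 \<le> y"
  shows "\<bar>y ^ n * exp (t * y)\<bar> \<le> fact n * exp ((\<bar>t\<bar> + 1) * y)"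
proof -
  have "y ^ n / fact n \<le> exp y"
  proof -
    have "(\<Sum>i\<in>{n}. y ^ i /\<^sub>R fact i) \<le> (\<Sum>i. y ^ i /\<^sub>R fact i)"
      using assms by (intro sum_le_suminf summable_exp_generic) auto
    then show ?thesis by (simp add: exp_def divide_inverse mult.commute)
  qed
  then have "y ^ n \<le> fact n * exp y" by (simp add: divide_le_eq mult.commute)
  moreover have "exp (t * y) \<le> exp (\<bar>t\<bar> * y)"
    using assms by (auto intro: mult_right_mono)
  ultimately have "y ^ n * exp (t * y) \<le> (fact n * exp y) * exp (\<bar>t\<bar> * y)"
    using assms by (intro mult_mono) auto
  also have "\<dots> = fact n * exp ((\<bar>t\<bar> + 1) * y)"
    by (simp add: algebra_simps exp_add)
  finally show ?thesis using assms by simp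
qed

text \<open>Vanishing tails pass to the limit at a continuity point chosen between the endpoint and
  a cut \<open>s\<close> outside the interval; cuts at distance 1 / (n + 1) then give the closed
  interval.\<close>

lemma weak_conv_carrier:
  fixes \<mu> :: "nat \<Rightarrow> real measure"
  assumes \<mu>: "\<And>k. real_distribution (\<mu> k)" and \<rho>: "real_distribution \<rho>"
    and conv: "weak_conv_m \<mu> \<rho>"
    and upper: "\<And>t. t > u \<Longrightarrow> (\<lambda>k. measure (\<mu> k) {t<..}) \<longlonglongrightarrow> 0"
    and lower: "\<And>t. t < l \<Longrightarrow> (\<lambda>k. measure (\<mu> k) {..t}) \<longlonglongrightarrow> 0"
  shows "AE y in \<rho>. l \<le> y \<and> y \<le> u"
proof -
  interpret \<rho>: real_distribution \<rho> by fact
  interpret \<mu>: real_distribution "\<mu> k" for k by (rule \<mu>)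
  have cdf: "(\<lambda>k. cdf (\<mu> k) t) \<longlonglongrightarrow> cdf \<rho> t" if "isCont (cdf \<rho>) t" for t
    using conv that by (simp add: weak_conv_m_def weak_conv_def)
  have up: "AE y in \<rho>. y \<le> s" if "s > u" for s
  proof -
    obtain t where t: "u < t" "t < s" "isCont (cdf \<rho>) t" using \<rho>.exists_isCont_cdf[of u s] \<open>s > u\<close> by blast
    have "measure (\<mu> k) {t<..} = 1 - cdf (\<mu> k) t" for k
      using \<mu>.prob_compl[of "{..t}" k] by (simp add: cdf_def Compl_eq_Diff_UNIV[symmetric])
    then have "(\<lambda>k. 1 - cdf (\<mu> k) t) \<longlonglongrightarrow> 0" using upper[OF t(1)] by simp
    from LIMSEQ_unique[OF this tendsto_diff[OF tendsto_const cdf[OF t(3)]]]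
    have "measure \<rho> {..t} = 1" by (simp add: cdf_def)
    then have "AE y in \<rho>. y \<in> {..t}" by (intro \<rho>.AE_prob_1)
    then show ?thesis by eventually_elim (use t in auto)
  qed
  have lo: "AE y in \<rho>. s < y" if "s < l" for s
  proof -
    obtain t where t: "s < t" "t < l" "isCont (cdf \<rho>) t" using \<rho>.exists_isCont_cdf[of s l] \<open>s < l\<close> by blast
    have "(\<lambda>k. cdf (\<mu> k) t) \<longlonglongrightarrow> 0" using lower[OF t(2)] by (simp add: cdf_def)
    from LIMSEQ_unique[OF this cdf[OF t(3)]] have "measure \<rho> {..t} = 0" by (simp add: cdf_def)
    then have "measure \<rho> {t<..} = 1"
      using \<rho>.prob_compl[of "{..t}"] by (simp add: Compl_eq_Diff_UNIV[symmetric])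
    then have "AE y in \<rho>. y \<in> {t<..}" by (intro \<rho>.AE_prob_1)
    then show ?thesis by eventually_elim (use t in auto)
  qed
  have "AE y in \<rho>. \<forall>n::nat. y \<le> u + 1 / Suc n \<and> l - 1 / Suc n < y"
    unfolding AE_all_countable using up lo by (intro allI AE_conjI) auto
  then show ?thesis
  proof eventually_elim
    case (elim y)
    have "y \<le> u + e" "l - e < y" if e: "e > 0" for e
    proof -
      obtain n where "1 / real (Suc n) < e" using nat_approx_posE[OF e] by auto
      then show "y \<le> u + e" "l - e < y" using elim[rule_format, of n] by auto
    qed
    then show ?case by (metis diff_less_eq field_le_epsilon less_eq_real_def)
  qed
qed

text \<open>Index and argument move together, as in X_k <= r / k with k proportional to r.
  Monotonicity traps \<open>u n\<close> between continuity points on either side of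
  \<open>t\<close>, where plain weak convergence applies.\<close>

lemma weak_conv_cdf_moving:
  fixes \<mu> :: "nat \<Rightarrow> real measure"
  assumes \<mu>: "\<And>k. real_distribution (\<mu> k)" and \<rho>: "real_distribution \<rho>"
    and conv: "weak_conv_m \<mu> \<rho>" and cont: "isCont (cdf \<rho>) t"
    and \<kappa>: "filterlim \<kappa> at_top sequentially" and u: "u \<longlonglongrightarrow> t"
  shows "(\<lambda>n. cdf (\<mu> (\<kappa> n)) (u n)) \<longlonglongrightarrow> cdf \<rho> t"
proof -
  interpret \<rho>: real_distribution \<rho> by fact
  interpret \<mu>: real_distribution "\<mu> k" for k by (rule \<mu>)
  have mono: "cdf (\<mu> k) x \<le> cdf (\<mu> k) y" if "x \<le> y" for k x y
    using that by (rule \<mu>.cdf_nondecreasing)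
  have lim: "(\<lambda>n. cdf (\<mu> (\<kappa> n)) v) \<longlonglongrightarrow> cdf \<rho> v" if "isCont (cdf \<rho>) v" for v
    using filterlim_compose[OF _ \<kappa>, of "\<lambda>k. cdf (\<mu> k) v"] conv that
    by (auto simp: weak_conv_m_def weak_conv_def)
  show ?thesis
  proof (rule order_tendstoI)
    fix c assume "c < cdf \<rho> t"
    then have "\<forall>\<^sub>F v in at t. c < cdf \<rho> v"
      using cont by (intro order_tendstoD) (auto simp: isCont_def)
    then obtain l where l: "l < t" "\<And>v. l < v \<Longrightarrow> v < t \<Longrightarrow> c < cdf \<rho> v"
      unfolding eventually_at_split eventually_at_left_field by blast
    obtain v where v: "l < v" "v < t" "isCont (cdf \<rho>) v" using \<rho>.exists_isCont_cdf[OF l(1)] by blast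
    have "\<forall>\<^sub>F n in sequentially. c < cdf (\<mu> (\<kappa> n)) v"
      using l(2)[OF v(1,2)] by (rule order_tendstoD(1)[OF lim[OF v(3)]])
    with order_tendstoD(1)[OF u v(2)] show "\<forall>\<^sub>F n in sequentially. c < cdf (\<mu> (\<kappa> n)) (u n)"
      by eventually_elim (meson mono less_imp_le less_le_trans)
  next
    fix c assume "cdf \<rho> t < c"
    then have "\<forall>\<^sub>F v in at t. cdf \<rho> v < c"
      using cont by (intro order_tendstoD) (auto simp: isCont_def)
    then obtain r where r: "t < r" "\<And>v. t < v \<Longrightarrow> v < r \<Longrightarrow> cdf \<rho> v < c"
      unfolding eventually_at_split eventually_at_right_field by blast
    obtain v where v: "t < v" "v < r" "isCont (cdf \<rho>) v" using \<rho>.exists_isCont_cdf[OF r(1)] by blast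
    have "\<forall>\<^sub>F n in sequentially. cdf (\<mu> (\<kappa> n)) v < c"
      using r(2)[OF v(1,2)] by (rule order_tendstoD(2)[OF lim[OF v(3)]])
    with order_tendstoD(2)[OF u v(1)] show "\<forall>\<^sub>F n in sequentially. cdf (\<mu> (\<kappa> n)) (u n) < c"
      by eventually_elim (meson mono less_imp_le le_less_trans)
  qed
qed

section \<open>Rescaled sums and the mean of the reciprocal\<close>

lemma has_bochner_integral_ceiling_sum:
  fixes G :: "nat \<Rightarrow> real" and r :: real
  assumes r: "r > 0"
  shows "has_bochner_integral lborel (\<lambda>s. indicator {0<..real K / r} s * G (nat \<lceil>r * s\<rceil>))
     ((\<Sum>k=1..K. G k) / r)"
proof (induction K)
  case 0
  then show ?case by (simp add: has_bochner_integral_zero)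
next
  case (Suc K)
  have le: "real K / r \<le> real (Suc K) / r" using r by (intro divide_right_mono) auto
  have "has_bochner_integral lborel (indicator {real K / r<..real (Suc K) / r} :: real \<Rightarrow> real)
      (measure lborel {real K / r<..real (Suc K) / r})"
    using le by (intro has_bochner_integral_real_indicator) auto
  moreover have "measure lborel {real K / r<..real (Suc K) / r} = 1 / r"
    using le by (simp add: diff_divide_distrib[symmetric])
  ultimately have 1: "has_bochner_integral lborel
      (\<lambda>s. G (Suc K) * indicator {real K / r<..real (Suc K) / r} s) (G (Suc K) * (1 / r))"
    by (intro has_bochner_integral_mult_right) simp
  \<comment> \<open>The ceiling of \<open>r * s\<close> equals \<open>k\<close> exactly from
    \<open>(k - 1) / r\<close>, excluded, to \<open>k / r\<close>, included: a cell of length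
    \<open>1 / r\<close>.\<close>
  have eq: "indicator {0<..real (Suc K) / r} s * G (nat \<lceil>r * s\<rceil>) =
      indicator {0<..real K / r} s * G (nat \<lceil>r * s\<rceil>) +
      G (Suc K) * indicator {real K / r<..real (Suc K) / r} s" for s
  proof (cases "s \<in> {real K / r<..real (Suc K) / r}")
    case True
    then have "real K < r * s" "r * s \<le> real (Suc K)"
      using r by (auto simp: pos_divide_less_eq pos_le_divide_eq mult.commute)
    then have "\<lceil>r * s\<rceil> = int (Suc K)" by (intro ceiling_unique) auto
    then have c: "nat \<lceil>r * s\<rceil> = Suc K" by simp
    have "0 \<le> real K / r" using r by simp
    then show ?thesis using True by (auto simp: c indicator_def)
  next
    case False
    then show ?thesis using le by (auto simp: indicator_def)
  qed
  have "(\<Sum>k=1..Suc K. G k) / r = (\<Sum>k=1..K. G k) / r + G (Suc K) * (1 / r)"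
    by (simp add: add_divide_distrib)
  then show ?case
    unfolding eq using has_bochner_integral_add[OF Suc 1] by simp
qed

lemma integral_eq_of_nn_integral_eq:
  assumes "f \<in> borel_measurable M" "g \<in> borel_measurable N"
    and "AE x in M. 0 \<le> f x" "AE x in N. 0 \<le> g x"
    and "(\<integral>\<^sup>+x. ennreal (f x) \<partial>M) = (\<integral>\<^sup>+x. ennreal (g x) \<partial>N)"
  shows "integral\<^sup>L M f = (integral\<^sup>L N g :: real)"
  using assms by (simp add: integral_eq_nn_integral)

context real_distribution
begin

text \<open>Fubini for the region s > 0, y s <= 1: its section at \<open>s\<close> has mass
  \<open>cdf M (1 / s)\<close>, its section at \<open>y > 0\<close> has length
  \<open>1 / y\<close>.\<close>

lemma nn_integral_inverse_eq_cdf: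
  assumes "AE y in M. 0 < y"
  shows "(\<integral>\<^sup>+s. ennreal (indicator {0<..} s * cdf M (1 / s)) \<partial>lborel) = (\<integral>\<^sup>+y. ennreal (1 / y) \<partial>M)"
proof -
  interpret P: pair_sigma_finite M lborel ..
  have "{p \<in> space (M \<Otimes>\<^sub>M lborel). 0 < snd p \<and> fst p * snd p \<le> (1::real)} \<in> sets (M \<Otimes>\<^sub>M lborel)"
    by measurable
  moreover have "{p \<in> space (M \<Otimes>\<^sub>M lborel). 0 < snd p \<and> fst p * snd p \<le> (1::real)} =
      {(y, s). 0 < s \<and> y * s \<le> 1}"
    by (auto simp: space_pair_measure)
  ultimately have meas: "{(y, s). 0 < s \<and> y * s \<le> (1::real)} \<in> sets (M \<Otimes>\<^sub>M lborel)" by simp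
  have "(\<integral>\<^sup>+s. ennreal (indicator {0<..} s * cdf M (1 / s)) \<partial>lborel) =
      (\<integral>\<^sup>+s. \<integral>\<^sup>+y. indicator {(y, s). 0 < s \<and> y * s \<le> 1} (y, s) \<partial>M \<partial>lborel)"
  proof (intro nn_integral_cong)
    fix s :: real
    show "ennreal (indicator {0<..} s * cdf M (1 / s)) = (\<integral>\<^sup>+y. indicator {(y, s). 0 < s \<and> y * s \<le> 1} (y, s) \<partial>M)"
    proof (cases "s > 0")
      case True
      then have "(\<integral>\<^sup>+y. indicator {(y, s). 0 < s \<and> y * s \<le> 1} (y, s) \<partial>M) = (\<integral>\<^sup>+y. indicator {..1 / s} y \<partial>M)"
        by (intro nn_integral_cong) (auto simp: indicator_def field_simps)
      also have "\<dots> = emeasure M {..1 / s}" by simp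
      finally show ?thesis using True by (simp add: cdf_def emeasure_eq_measure)
    qed (simp add: indicator_def)
  qed
  also have "\<dots> = (\<integral>\<^sup>+y. \<integral>\<^sup>+s. indicator {(y, s). 0 < s \<and> y * s \<le> 1} (y, s) \<partial>lborel \<partial>M)"
    using borel_measurable_indicator[OF meas] by (intro P.Fubini') (simp add: split_beta')
  also have "\<dots> = (\<integral>\<^sup>+y. ennreal (1 / y) \<partial>M)"
  proof (rule nn_integral_cong_AE)
    show "AE y in M. (\<integral>\<^sup>+s. indicator {(y, s). 0 < s \<and> y * s \<le> 1} (y, s) \<partial>lborel) = ennreal (1 / y)"
      using assms
    proof eventually_elim
      case (elim y)
      have "(\<integral>\<^sup>+s. indicator {(y, s). 0 < s \<and> y * s \<le> 1} (y, s) \<partial>lborel) = (\<integral>\<^sup>+s. indicator {0<..1 / y} s \<partial>lborel)"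
        using elim by (intro nn_integral_cong) (auto simp: indicator_def field_simps)
      also have "\<dots> = ennreal (1 / y)" using elim by simp
      finally show ?case .
    qed
  qed
  finally show ?thesis .
qed

text \<open>Fubini again, with the integral of \<open>exp (- \<theta> * y)\<close> over \<theta> >=
  0 equal to \<open>1 / y\<close>. It links the formula in terms of \<open>Psi_lim\<close> to the
  reciprocal mean.\<close>

lemma nn_integral_Laplace:
  assumes "AE y in M. 0 < y"
  shows "(\<integral>\<^sup>+\<theta>. (\<integral>\<^sup>+y. ennreal (exp (- \<theta> * y)) \<partial>M) * indicator {0..} \<theta> \<partial>lborel) = (\<integral>\<^sup>+y. ennreal (1 / y) \<partial>M)"
proof -
  interpret P: pair_sigma_finite M lborel ..
  have "(\<integral>\<^sup>+\<theta>. (\<integral>\<^sup>+y. ennreal (exp (- \<theta> * y)) \<partial>M) * indicator {0..} \<theta> \<partial>lborel) =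
      (\<integral>\<^sup>+\<theta>. \<integral>\<^sup>+y. ennreal (exp (- \<theta> * y)) * indicator {0..} \<theta> \<partial>M \<partial>lborel)"
    by (simp add: nn_integral_multc)
  also have "\<dots> = (\<integral>\<^sup>+y. \<integral>\<^sup>+\<theta>. ennreal (exp (- \<theta> * y)) * indicator {0..} \<theta> \<partial>lborel \<partial>M)"
    by (intro P.Fubini') (simp add: split_beta')
  also have "\<dots> = (\<integral>\<^sup>+y. ennreal (1 / y) \<partial>M)"
  proof (rule nn_integral_cong_AE)
    show "AE y in M. (\<integral>\<^sup>+\<theta>. ennreal (exp (- \<theta> * y)) * indicator {0..} \<theta> \<partial>lborel) = ennreal (1 / y)"
      using assms
    proof eventually_elim
      case (elim y)
      have "(\<integral>\<^sup>+\<theta>. ennreal (exp (- \<theta> * y)) * indicator {0..} \<theta> \<partial>lborel) = ennreal (0 - (- exp (- 0 * y) / y))"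
      proof (rule nn_integral_FTC_atLeast)
        show "((\<lambda>\<theta>. - exp (- \<theta> * y) / y) has_real_derivative exp (- \<theta> * y)) (at \<theta>)" for \<theta>
          using elim by (auto intro!: derivative_eq_intros)
        have "filterlim (\<lambda>\<theta>. y * \<theta>) at_top at_top"
          by (rule filterlim_tendsto_pos_mult_at_top[OF tendsto_const elim filterlim_ident])
        then have "filterlim (\<lambda>\<theta>. - \<theta> * y) at_bot at_top"
          by (simp add: filterlim_uminus_at_bot mult.commute)
        then have "((\<lambda>\<theta>. exp (- \<theta> * y)) \<longlongrightarrow> 0) at_top" by (rule filterlim_compose[OF exp_at_bot])
        then show "((\<lambda>\<theta>. - exp (- \<theta> * y) / y) \<longlongrightarrow> 0) at_top"
          using elim tendsto_divide[OF tendsto_minus tendsto_const] by fastforce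
      qed auto
      then show ?case using elim by simp
    qed
  qed
  finally show ?thesis .
qed

end

section \<open>Dyadic cubes\<close>

lemma dyadic_interval_bounds:
  assumes "x \<in> dyadic_interval k j" "j < 2 ^ k"
  shows "real j / 2 ^ k \<le> x" "x \<le> real (Suc j) / 2 ^ k" "Suc j < 2 ^ k \<Longrightarrow> x < real (Suc j) / 2 ^ k"
proof -
  \<comment> \<open>For the closed last interval the right endpoint 1 of the definition agrees with
    the general formula.\<close>
  have "real (Suc j) / 2 ^ k = 1" if "Suc j = 2 ^ k"
    unfolding that by simp
  moreover have "real (Suc j) / 2 ^ k = real j / 2 ^ k + 1 / 2 ^ k" by (simp add: add_divide_distrib)
  ultimately show "real j / 2 ^ k \<le> x" "x \<le> real (Suc j) / 2 ^ k" "Suc j < 2 ^ k \<Longrightarrow> x < real (Suc j) / 2 ^ k"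
    using assms by (auto simp: dyadic_interval_def split: if_splits simp del: of_nat_Suc)
qed

lemma dyadic_interval_unique:
  assumes "x \<in> dyadic_interval k i" "x \<in> dyadic_interval k j" "i < 2 ^ k" "j < 2 ^ k"
  shows "i = j"
proof -
  have "False" if "x \<in> dyadic_interval k i" "x \<in> dyadic_interval k j" "i < j" "j < 2 ^ k" for i j
  proof -
    have "x < real (Suc i) / 2 ^ k"
      using that by (intro dyadic_interval_bounds(3)) auto
    also have "\<dots> \<le> real j / 2 ^ k"
      using that by (intro divide_right_mono) auto
    also have "\<dots> \<le> x" using that by (intro dyadic_interval_bounds(1)) auto
    finally show False by simp
  qed
  then show ?thesis using assms by (metis linorder_neqE_nat)
qed

lemma dyadic_interval_exists:
  assumes "0 \<le> x" "x \<le> 1"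
  shows "\<exists>j<2 ^ k. x \<in> dyadic_interval k j"
proof (cases "x = 1")
  case True
  have "Suc (2 ^ k - 1) = (2::nat) ^ k" by simp
  moreover have "real (2 ^ k - 1) / 2 ^ k \<le> 1" by (simp add: of_nat_diff)
  ultimately show ?thesis
    using True by (intro exI[of _ "2 ^ k - 1"]) (auto simp: dyadic_interval_def)
next
  case False
  define j where "j = nat \<lfloor>x * 2 ^ k\<rfloor>"
  have j: "real j \<le> x * 2 ^ k" "x * 2 ^ k < real j + 1"
    using assms unfolding j_def by (auto simp: floor_le_iff)
  have "x * 2 ^ k < 1 * 2 ^ k"
    using False assms by (intro mult_strict_right_mono) auto
  with j(1) have "real j < real (2 ^ k)" unfolding of_nat_power of_nat_numeral by linarith
  then have "j < 2 ^ k" by (simp only: of_nat_less_iff)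
  moreover have "x \<in> dyadic_interval k j"
    using j assms by (auto simp: dyadic_interval_def field_simps)
  ultimately show ?thesis by blast
qed

lemma dyadic_interval_borel [measurable]: "dyadic_interval k j \<in> sets borel"
  by (simp add: dyadic_interval_def)

definition dyadic_cube :: "nat \<Rightarrow> ('d \<Rightarrow> nat) \<Rightarrow> (real ^ 'd) set" where
  "dyadic_cube k m = {x. \<forall>i. x $ i \<in> dyadic_interval k (m i)}"

lemma dyadic_cubes_eq: "dyadic_cubes k = dyadic_cube k ` {m. \<forall>i. m i < 2 ^ k}"
  by (auto simp: dyadic_cubes_def dyadic_cube_def)

lemma PiE_finite_type: "{m :: 'd::finite \<Rightarrow> nat. \<forall>i. m i \<in> S i} = PiE UNIV S"
  by (auto simp: PiE_def)

lemma finite_dyadic_cubes [simp, intro]: "finite (dyadic_cubes k :: (real ^ 'd) set set)"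
  unfolding dyadic_cubes_eq lessThan_iff[symmetric] PiE_finite_type by (simp add: finite_PiE)

lemma card_dyadic_cubes_le: "card (dyadic_cubes k :: (real ^ 'd) set set) \<le> (2 ^ k) ^ CARD('d)"
proof -
  have "card (dyadic_cubes k :: (real ^ 'd) set set) \<le> card (PiE (UNIV :: 'd set) (\<lambda>_. {..<2 ^ k :: nat}))"
    unfolding dyadic_cubes_eq lessThan_iff[symmetric] PiE_finite_type
    by (intro card_image_le) (simp add: finite_PiE)
  then show ?thesis by (simp add: card_PiE)
qed

lemma dyadic_cubes_borel [measurable]:
  assumes "Q \<in> dyadic_cubes k"
  shows "(Q :: (real ^ 'd) set) \<in> sets borel"
proof -
  obtain m where Q: "Q = dyadic_cube k m" using assms by (auto simp: dyadic_cubes_eq)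
  have "Measurable.pred borel (\<lambda>x :: real ^ 'd. \<forall>i. x $ i \<in> dyadic_interval k (m i))"
    by measurable
  then show ?thesis by (simp add: Q dyadic_cube_def pred_def)
qed

lemma dyadic_cubes_disjoint:
  assumes "Q \<in> dyadic_cubes k" "Q' \<in> dyadic_cubes k" "x \<in> Q" "x \<in> Q'"
  shows "Q = Q'"
proof -
  obtain m m' where m: "Q = dyadic_cube k m" "\<forall>i. m i < 2 ^ k" "Q' = dyadic_cube k m'" "\<forall>i. m' i < 2 ^ k"
    using assms by (auto simp: dyadic_cubes_eq)
  have "m = m'"
    using m assms by (intro ext dyadic_interval_unique[of "x $ i" k for i]) (auto simp: dyadic_cube_def)
  then show ?thesis using m by simp
qed

lemma dyadic_cubes_cover:
  assumes "(x :: real ^ 'd) \<in> cbox 0 1"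
  obtains Q where "Q \<in> dyadic_cubes k" "x \<in> Q"
proof -
  have "\<forall>i. \<exists>j<2 ^ k. x $ i \<in> dyadic_interval k j"
    using assms by (intro allI dyadic_interval_exists) (auto simp: mem_box_cart)
  then obtain m where "\<forall>i. m i < 2 ^ k \<and> x $ i \<in> dyadic_interval k (m i)" by metis
  then show ?thesis using that[of "dyadic_cube k m"] by (auto simp: dyadic_cubes_eq dyadic_cube_def)
qed

lemma dyadic_cube_at_eq:
  assumes "Q \<in> dyadic_cubes k" "x \<in> Q"
  shows "dyadic_cube_at k x = Q"
  unfolding dyadic_cube_at_def
  using assms dyadic_cubes_disjoint by (intro the_equality) blast+

lemma infnorm_le_iff_cart: "infnorm (x :: real ^ 'd) \<le> b \<longleftrightarrow> (\<forall>i. \<bar>x $ i\<bar> \<le> b)"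
proof
  assume "infnorm x \<le> b"
  then show "\<forall>i. \<bar>x $ i\<bar> \<le> b" using component_le_infnorm_cart[of x] order_trans by blast
next
  assume "\<forall>i. \<bar>x $ i\<bar> \<le> b"
  then show "infnorm x \<le> b"
    unfolding infnorm_cart by (intro cSup_least) auto
qed

lemma dyadic_cube_coordinate:
  assumes "x \<in> dyadic_cube k m" "m i < 2 ^ k"
  shows "real (m i) / 2 ^ k \<le> x $ i" "x $ i \<le> real (Suc (m i)) / 2 ^ k"
  using dyadic_interval_bounds(1,2)[of "x $ i" k "m i"] assms
  by (simp_all add: dyadic_cube_def del: of_nat_Suc)

lemma dyadic_cube_diameter:
  assumes "Q \<in> dyadic_cubes k" "x \<in> Q" "y \<in> Q"
  shows "infnorm (x - y :: real ^ 'd) \<le> 1 / 2 ^ k"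
  unfolding infnorm_le_iff_cart
proof
  fix i
  obtain m where m: "Q = dyadic_cube k m" "\<forall>i. m i < 2 ^ k"
    using assms by (auto simp: dyadic_cubes_eq)
  have "real (m i) / 2 ^ k \<le> x $ i" "x $ i \<le> real (Suc (m i)) / 2 ^ k"
    "real (m i) / 2 ^ k \<le> y $ i" "y $ i \<le> real (Suc (m i)) / 2 ^ k"
    using m assms by (simp_all add: dyadic_cube_coordinate del: of_nat_Suc)
  then show "\<bar>(x - y) $ i\<bar> \<le> 1 / 2 ^ k" by (auto simp: add_divide_distrib)
qed

text \<open>The strict inequality matters for the count: it leaves three candidate indices per
  coordinate, where a closed one could leave four.\<close>

definition cubes_near :: "nat \<Rightarrow> real ^ 'd \<Rightarrow> (real ^ 'd) set set" where
  "cubes_near k y = {Q \<in> dyadic_cubes k. \<exists>x\<in>Q. infnorm (x - y) < 1 / 2 ^ k}"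

text \<open>Each index of such a cube differs by at most 1 from the floor of
  \<open>y $ i * 2 ^ k\<close>. Negative candidates are merged by \<open>nat\<close>, which only
  lowers the count.\<close>

lemma card_cubes_near_le: "card (cubes_near k (y :: real ^ 'd)) \<le> 3 ^ CARD('d)"
proof -
  define f where "f i = \<lfloor>y $ i * 2 ^ k\<rfloor>" for i
  define S where "S i = nat ` {f i - 1..f i + 1}" for i
  have card_S: "finite (S i)" "card (S i) \<le> 3" for i
    using card_image_le[of "{f i - 1..f i + 1}" nat] by (auto simp: S_def)
  have "cubes_near k y \<subseteq> dyadic_cube k ` {m. \<forall>i. m i \<in> S i}"
  proof
    fix Q assume "Q \<in> cubes_near k y"
    then obtain m x where m: "Q = dyadic_cube k m" "\<forall>i. m i < 2 ^ k" "x \<in> Q" "infnorm (x - y) < 1 / 2 ^ k"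
      by (auto simp: cubes_near_def dyadic_cubes_eq)
    have "m i \<in> S i" for i
    proof -
      have "real (m i) / 2 ^ k \<le> x $ i" "x $ i \<le> real (Suc (m i)) / 2 ^ k"
        using m by (simp_all add: dyadic_cube_coordinate del: of_nat_Suc)
      then have x: "real (m i) \<le> x $ i * 2 ^ k" "x $ i * 2 ^ k \<le> real (m i) + 1"
        by (auto simp: field_simps)
      have "\<bar>x $ i - y $ i\<bar> < 1 / 2 ^ k"
        using component_le_infnorm_cart[of "x - y" i] m(4) by simp
      then have "\<bar>x $ i - y $ i\<bar> * 2 ^ k < 1" by (simp add: field_simps)
      then have "\<bar>x $ i * 2 ^ k - y $ i * 2 ^ k\<bar> < 1"
        by (simp add: abs_mult left_diff_distrib[symmetric])
      with x have "real (m i) < y $ i * 2 ^ k + 1" "y $ i * 2 ^ k < real (m i) + 2"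
        by linarith+
      then have "int (m i) \<in> {f i - 1..f i + 1}"
        unfolding f_def by (simp, linarith)
      then have "nat (int (m i)) \<in> S i" unfolding S_def by (rule imageI)
      then show ?thesis by simp
    qed
    then show "Q \<in> dyadic_cube k ` {m. \<forall>i. m i \<in> S i}" using m by blast
  qed
  then have "card (cubes_near k y) \<le> card (dyadic_cube k ` (PiE UNIV S) :: (real ^ 'd) set set)"
    unfolding PiE_finite_type using card_S by (intro card_mono finite_imageI finite_PiE) auto
  also have "\<dots> \<le> card (PiE UNIV S)"
    using card_S by (intro card_image_le finite_PiE) auto
  also have "\<dots> = (\<Prod>i\<in>UNIV. card (S i))" by (simp add: card_PiE)
  also have "\<dots> \<le> (\<Prod>i\<in>(UNIV :: 'd set). 3)" using card_S by (intro prod_mono) auto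
  finally show ?thesis by simp
qed

text \<open>The complement of the support is a union of open null sets; Lindelof reduces it to a
  countable union.\<close>

lemma AE_topological_support:
  fixes M :: "'a::second_countable_topology measure"
  assumes "prob_space M" "sets M = sets borel"
  shows "AE x in M. x \<in> topological_support M"
proof -
  interpret prob_space M by fact
  define F where "F = {U :: 'a set. open U \<and> measure M U = 0}"
  obtain F' where F': "F' \<subseteq> F" "countable F'" "\<Union>F' = \<Union>F"
    by (rule Lindelof_openin[of F UNIV]) (auto simp: F_def)
  have "(\<Union>U\<in>F'. U) \<in> null_sets M"
    using F' assms(2)
    by (intro null_sets_UN') (auto simp: F_def null_sets_def emeasure_eq_measure)
  moreover have "{x \<in> space M. x \<notin> topological_support M} \<subseteq> (\<Union>U\<in>F'. U)"
    using F'(3) measure_nonneg[of M] by (force simp: topological_support_def F_def less_le)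
  ultimately show ?thesis by (rule AE_I')
qed

locale dyadic_prob = prob_space \<nu> for \<nu> :: "(real ^ 'd) measure" +
  assumes sets_eq [measurable_cong, simp]: "sets \<nu> = sets borel"
    and AE_unit_cube: "AE x in \<nu>. x \<in> cbox 0 1"
begin

lemma space_eq [simp]: "space \<nu> = UNIV"
  using sets_eq_imp_space_eq[OF sets_eq] by simp

text \<open>An identity at every point, including those outside the unit cube, where the definite
  description defaults to \<open>THE Q. False\<close>. It makes every function of
  \<open>dyadic_cube_at\<close> measurable.\<close>

lemma cube_at_decompose:
  fixes g :: "(real ^ 'd) set \<Rightarrow> real"
  shows "g (dyadic_cube_at k x) = (\<Sum>Q\<in>dyadic_cubes k. g Q * indicator Q x)
     + g (THE Q. False) * indicator (- \<Union>(dyadic_cubes k)) x"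
proof (cases "x \<in> \<Union>(dyadic_cubes k)")
  case True
  then obtain Q where Q: "Q \<in> dyadic_cubes k" "x \<in> Q" by blast
  have "(\<Sum>Q'\<in>dyadic_cubes k. g Q' * indicator Q' x) = (\<Sum>Q'\<in>dyadic_cubes k. if Q' = Q then g Q else 0)"
    using Q dyadic_cubes_disjoint by (intro sum.cong refl) (auto simp: indicator_def)
  also have "\<dots> = g Q" using Q by simp
  finally show ?thesis using True Q by (simp add: dyadic_cube_at_eq)
next
  case False
  then have "(\<lambda>Q. Q \<in> dyadic_cubes k \<and> x \<in> Q) = (\<lambda>Q. False)" by auto
  then have "dyadic_cube_at k x = (THE Q. False)" by (simp add: dyadic_cube_at_def)
  moreover have "(\<Sum>Q\<in>dyadic_cubes k. g Q * indicator Q x) = 0"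
    using False by (intro sum.neutral) auto
  ultimately show ?thesis using False by simp
qed

lemma borel_measurable_cube_at [measurable]:
  fixes g :: "(real ^ 'd) set \<Rightarrow> real"
  shows "(\<lambda>x. g (dyadic_cube_at k x)) \<in> borel_measurable borel"
  unfolding cube_at_decompose
  by (intro borel_measurable_add borel_measurable_sum borel_measurable_times
      borel_measurable_const borel_measurable_indicator)
    (auto intro: borel_comp sets.finite_Union dyadic_cubes_borel)

lemma AE_cube_at: "AE x in \<nu>. dyadic_cube_at k x \<in> dyadic_cubes k \<and> x \<in> dyadic_cube_at k x
    \<and> measure \<nu> (dyadic_cube_at k x) > 0"
proof -
  have "AE x in \<nu>. \<forall>Q\<in>dyadic_cubes k. measure \<nu> Q = 0 \<longrightarrow> x \<notin> Q"
  proof (rule AE_finite_allI)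
    fix Q :: "(real ^ 'd) set" assume Q: "Q \<in> dyadic_cubes k"
    show "AE x in \<nu>. measure \<nu> Q = 0 \<longrightarrow> x \<notin> Q"
    proof (cases "measure \<nu> Q = 0")
      case True
      then have "Q \<in> null_sets \<nu>" using Q by (auto simp: null_sets_def emeasure_eq_measure dyadic_cubes_borel)
      from AE_not_in[OF this] show ?thesis by simp
    qed simp
  qed simp
  with AE_unit_cube show ?thesis
  proof eventually_elim
    case (elim x)
    obtain Q where Q: "Q \<in> dyadic_cubes k" "x \<in> Q"
      using dyadic_cubes_cover[OF elim(1)] by blast
    moreover have "measure \<nu> Q \<noteq> 0" using Q elim(2) by blast
    ultimately show ?case by (simp add: dyadic_cube_at_eq less_le)
  qed
qed

lemma integral_cube_at:
  fixes g :: "(real ^ 'd) set \<Rightarrow> real"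
  shows "integrable \<nu> (\<lambda>x. g (dyadic_cube_at k x))"
    and "(\<integral>x. g (dyadic_cube_at k x) \<partial>\<nu>) = (\<Sum>Q\<in>dyadic_cubes k. measure \<nu> Q * g Q)"
proof -
  have AE: "AE x in \<nu>. g (dyadic_cube_at k x) = (\<Sum>Q\<in>dyadic_cubes k. g Q * indicator Q x)"
    using AE_cube_at[of k]
  proof eventually_elim
    case (elim x)
    then have "x \<in> \<Union>(dyadic_cubes k)" by blast
    then show ?case by (subst cube_at_decompose) simp
  qed
  have int: "integrable \<nu> (\<lambda>x. g Q * indicator Q x)" if "Q \<in> dyadic_cubes k" for Q
    using that by (intro integrable_mult_right)
      (auto intro!: integrable_real_indicator simp: emeasure_eq_measure dyadic_cubes_borel)
  have int': "integrable \<nu> (\<lambda>x. \<Sum>Q\<in>dyadic_cubes k. g Q * indicator Q x)"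
    by (rule Bochner_Integration.integrable_sum) (rule int)
  have meas: "(\<lambda>x. g (dyadic_cube_at k x)) \<in> borel_measurable \<nu>" by measurable
  show "integrable \<nu> (\<lambda>x. g (dyadic_cube_at k x))"
    using integrable_cong_AE[OF meas borel_measurable_integrable[OF int'] AE] int' by simp
  have "(\<integral>x. g (dyadic_cube_at k x) \<partial>\<nu>) = (\<integral>x. (\<Sum>Q\<in>dyadic_cubes k. g Q * indicator Q x) \<partial>\<nu>)"
    using AE by (intro integral_cong_AE meas borel_measurable_integrable int')
  also have "\<dots> = (\<Sum>Q\<in>dyadic_cubes k. \<integral>x. g Q * indicator Q x \<partial>\<nu>)"
    by (intro Bochner_Integration.integral_sum int)
  also have "\<dots> = (\<Sum>Q\<in>dyadic_cubes k. measure \<nu> Q * g Q)"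
    by (intro sum.cong refl) (simp add: mult.commute)
  finally show "(\<integral>x. g (dyadic_cube_at k x) \<partial>\<nu>) = (\<Sum>Q\<in>dyadic_cubes k. measure \<nu> Q * g Q)" .
qed

end

section \<open>Information rates and the spectrum\<close>

context dyadic_prob
begin

lemma prob_UNIV [simp]: "prob UNIV = 1"
  using prob_space by simp

definition rate :: "nat \<Rightarrow> (real ^ 'd) set \<Rightarrow> real" where
  "rate k Q = - (1 / real k) * log 2 (measure \<nu> Q)"

lemma info_rate_eq: "info_rate \<nu> k x = rate k (dyadic_cube_at k x)"
  by (simp add: info_rate_def rate_def)

lemma borel_measurable_info_rate [measurable]: "info_rate \<nu> k \<in> borel_measurable borel"
  unfolding info_rate_eq[abs_def] by (rule borel_measurable_cube_at)

text \<open>\<open>X_k\<close> takes finitely many values almost surely, and the sum of their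
  absolute values is a convenient bound. It depends on \<open>k\<close>; uniform control comes only
  from the spectrum.\<close>

lemma AE_info_rate_bounds:
  "AE x in \<nu>. 0 \<le> info_rate \<nu> k x \<and> info_rate \<nu> k x \<le> (\<Sum>Q\<in>dyadic_cubes k. \<bar>rate k Q\<bar>)"
  using AE_cube_at[of k]
proof eventually_elim
  case (elim x)
  then have "\<bar>rate k (dyadic_cube_at k x)\<bar> \<le> (\<Sum>Q\<in>dyadic_cubes k. \<bar>rate k Q\<bar>)"
    by (intro member_le_sum) auto
  moreover have "0 \<le> rate k (dyadic_cube_at k x)"
    unfolding rate_def using elim by (auto simp: divide_nonpos_nonneg)
  ultimately show ?case by (simp add: info_rate_eq)
qed

lemma bounded_rv_info_rate: "bounded_rv \<nu> (info_rate \<nu> k) (\<Sum>Q\<in>dyadic_cubes k. \<bar>rate k Q\<bar>)"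
proof
  show "AE x in \<nu>. \<bar>info_rate \<nu> k x\<bar> \<le> (\<Sum>Q\<in>dyadic_cubes k. \<bar>rate k Q\<bar>)"
    using AE_info_rate_bounds[of k] by eventually_elim auto
qed measurable

sublocale info_rate: bounded_rv \<nu> "info_rate \<nu> k" "\<Sum>Q\<in>dyadic_cubes k. \<bar>rate k Q\<bar>" for k
  by (rule bounded_rv_info_rate)

lemma real_distribution_info_law: "real_distribution (info_law \<nu> k)"
  unfolding info_law_def by (intro real_distribution_distr) auto

lemma integral_info_law:
  assumes "(f :: real \<Rightarrow> real) \<in> borel_measurable borel"
  shows "(\<integral>y. f y \<partial>info_law \<nu> k) = (\<integral>x. f (info_rate \<nu> k x) \<partial>\<nu>)"
  unfolding info_law_def by (rule integral_distr) (use assms in auto)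

lemma integrable_info_law:
  assumes "(f :: real \<Rightarrow> real) \<in> borel_measurable borel"
  shows "integrable (info_law \<nu> k) f \<longleftrightarrow> integrable \<nu> (\<lambda>x. f (info_rate \<nu> k x))"
  unfolding info_law_def by (rule integrable_distr_eq) (use assms in auto)

text \<open>The mass of the cube contributes the exponent 1, the tilt contributes \<theta> / (k ln
  2). Division by zero makes both sides agree at \<open>k = 0\<close> as well.\<close>

lemma integral_exp_info_rate:
  "(\<integral>x. exp (- \<theta> * info_rate \<nu> k x) \<partial>\<nu>) =
     (\<Sum>Q\<in>{Q \<in> dyadic_cubes k. measure \<nu> Q > 0}. measure \<nu> Q powr (1 + \<theta> / (real k * ln 2)))"
proof -
  have "(\<integral>x. exp (- \<theta> * info_rate \<nu> k x) \<partial>\<nu>) =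
      (\<Sum>Q\<in>dyadic_cubes k. measure \<nu> Q * exp (- \<theta> * rate k Q))"
    unfolding info_rate_eq by (rule integral_cube_at)
  also have "\<dots> = (\<Sum>Q\<in>{Q \<in> dyadic_cubes k. measure \<nu> Q > 0}. measure \<nu> Q * exp (- \<theta> * rate k Q))"
    using measure_nonneg[of \<nu>] by (intro sum.mono_neutral_right) (auto simp: less_le)
  also have "\<dots> = (\<Sum>Q\<in>{Q \<in> dyadic_cubes k. measure \<nu> Q > 0}. measure \<nu> Q powr (1 + \<theta> / (real k * ln 2)))"
  proof (intro sum.cong refl)
    fix Q assume "Q \<in> {Q \<in> dyadic_cubes k. measure \<nu> Q > 0}"
    then have "measure \<nu> Q > 0" by simp
    then show "measure \<nu> Q * exp (- \<theta> * rate k Q) = measure \<nu> Q powr (1 + \<theta> / (real k * ln 2))"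
      by (simp add: powr_def rate_def log_def ring_distribs exp_add mult.commute)
  qed
  finally show ?thesis .
qed

lemma Psi_eq_cgf: "Psi \<nu> k \<theta> = cgf \<nu> (info_rate \<nu> k) (- \<theta>)"
proof (cases "k = 0")
  case True
  then have "info_rate \<nu> k = (\<lambda>_. 0)" by (auto simp: info_rate_def)
  then show ?thesis using True by (simp add: Psi_def cgf_def prob_space)
next
  case False
  then have "Psi \<nu> k \<theta> = ln (\<integral>x. exp (- \<theta> * info_rate \<nu> k x) \<partial>\<nu>)"
    unfolding integral_exp_info_rate by (simp add: Psi_def spectrum_def log_def)
  then show ?thesis by (simp add: cgf_def)
qed

text \<open>Order \<open>q\<close> corresponds to the tilt k ln 2 (1 - q): orders below 1 favour
  high information rates, orders above 1 low ones.\<close>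

lemma spectrum_eq_cgf:
  assumes "k \<ge> 1"
  shows "spectrum \<nu> k q = cgf \<nu> (info_rate \<nu> k) (real k * ln 2 * (1 - q)) / (real k * ln 2)"
proof -
  have "Psi \<nu> k (real k * ln 2 * (q - 1)) = real k * ln 2 * spectrum \<nu> k q"
    using assms by (simp add: Psi_def)
  then have "spectrum \<nu> k q = Psi \<nu> k (real k * ln 2 * (q - 1)) / (real k * ln 2)"
    using assms by (simp add: field_simps)
  then show ?thesis by (simp add: Psi_eq_cgf algebra_simps)
qed

lemma spectrum_eq_affine:
  assumes "k \<ge> 1"
  shows "spectrum \<nu> k = (\<lambda>q. 1 / (real k * ln 2) *
     cgf \<nu> (info_rate \<nu> k) (- (real k * ln 2) * q + real k * ln 2))"
  using assms by (auto simp: spectrum_eq_cgf algebra_simps)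

text \<open>The factors 1 and the summand 0 are there to match the pattern of
  \<open>smooth_affine\<close> and \<open>funpow_deriv_affine\<close>.\<close>

lemma Psi_eq_affine: "Psi \<nu> k = (\<lambda>\<theta>. 1 * cgf \<nu> (info_rate \<nu> k) (- 1 * \<theta> + 0))"
  by (auto simp: Psi_eq_cgf)

lemma smooth_Psi: "smooth (Psi \<nu> k)"
  unfolding Psi_eq_affine by (rule smooth_affine) (rule info_rate.smooth_cgf)

lemma smooth_spectrum: "k \<ge> 1 \<Longrightarrow> smooth (spectrum \<nu> k)"
  by (subst spectrum_eq_affine, assumption) (rule smooth_affine, rule info_rate.smooth_cgf)

lemma funpow_deriv_Psi_0: "(deriv ^^ n) (Psi \<nu> k) 0 = (- 1) ^ n * cumulant \<nu> (info_rate \<nu> k) n"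
  unfolding Psi_eq_affine funpow_deriv_affine[OF info_rate.smooth_cgf] by (simp add: cumulant_def)

text \<open>Each derivative contributes a factor - k ln 2, and the prefactor 1 / (k ln 2) cancels
  one of them.\<close>

lemma funpow_deriv_spectrum_1:
  assumes "k \<ge> 1" "n \<ge> 1"
  shows "(deriv ^^ n) (spectrum \<nu> k) 1 =
     (real k * ln 2) ^ (n - 1) * ((- 1) ^ n * cumulant \<nu> (info_rate \<nu> k) n)"
proof -
  obtain m where n: "n = Suc m" using assms(2) by (cases n) auto
  have "(- (real k * ln 2)) ^ n = (- 1) ^ n * (real k * ln 2) ^ n"
    by (subst power_mult_distrib[symmetric]) simp
  then show ?thesis
    unfolding spectrum_eq_affine[OF assms(1)] funpow_deriv_affine[OF info_rate.smooth_cgf]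
    using assms(1) by (simp add: cumulant_def n)
qed

lemma convex_Psi: "convex_on UNIV (Psi \<nu> k)"
proof (rule convex_onI)
  fix t x y :: real assume t: "0 < t" "t < 1"
  have "- ((1 - t) * x + t * y) = (1 - t) * (- x) + t * (- y)" by (simp add: algebra_simps)
  then show "Psi \<nu> k ((1 - t) *\<^sub>R x + t *\<^sub>R y) \<le> (1 - t) * Psi \<nu> k x + t * Psi \<nu> k y"
    using convex_onD[OF info_rate.convex_cgf[of k], of t "- x" "- y"] t by (simp add: Psi_eq_cgf)
qed simp

lemma integral_info_rate: "(\<integral>x. info_rate \<nu> k x \<partial>\<nu>) = level_entropy \<nu> k"
  using integral_cube_at(2)[of "rate k" k]
  by (simp add: info_rate_eq level_entropy_def rate_def sum_distrib_left sum_negf mult_ac)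

lemma deriv_Psi_0: "deriv (Psi \<nu> k) 0 = - level_entropy \<nu> k"
  using funpow_deriv_Psi_0[of 1 k] info_rate.deriv_cgf_0[of k]
  by (simp add: cumulant_def integral_info_rate)

lemma cumulant_2: "cumulant \<nu> (info_rate \<nu> k) 2 = variance_of \<nu> (info_rate \<nu> k)"
  unfolding cumulant_def by (rule info_rate.deriv2_cgf_0)

lemma Psi_k_properties:
  assumes "k \<ge> 1"
  shows "(\<forall>\<theta>. integrable \<nu> (\<lambda>x. exp (- \<theta> * info_rate \<nu> k x)) \<and>
             (\<integral>x. exp (- \<theta> * info_rate \<nu> k x) \<partial>\<nu>) > 0 \<and>
             Psi \<nu> k \<theta> = ln (\<integral>x. exp (- \<theta> * info_rate \<nu> k x) \<partial>\<nu>) \<and>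
             Psi \<nu> k \<theta> = cgf \<nu> (\<lambda>x. - info_rate \<nu> k x) \<theta>) \<and>
        convex_on UNIV (Psi \<nu> k) \<and>
        smooth (Psi \<nu> k) \<and> smooth (spectrum \<nu> k) \<and> smooth (cgf \<nu> (info_rate \<nu> k)) \<and>
        (\<forall>n\<ge>1.
           (deriv ^^ n) (Psi \<nu> k) 0 = (deriv ^^ n) (spectrum \<nu> k) 1 / (real k * ln 2) ^ (n - 1) \<and>
           (deriv ^^ n) (Psi \<nu> k) 0 = (- 1) ^ n * cumulant \<nu> (info_rate \<nu> k) n) \<and>
        deriv (Psi \<nu> k) 0 = - level_entropy \<nu> k \<and>
        (deriv ^^ 2) (Psi \<nu> k) 0 = variance_of \<nu> (info_rate \<nu> k) \<and>
        variance_of \<nu> (info_rate \<nu> k) = (deriv ^^ 2) (spectrum \<nu> k) 1 / (real k * ln 2)"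
proof (intro conjI allI impI)
  fix \<theta> :: real
  show "integrable \<nu> (\<lambda>x. exp (- \<theta> * info_rate \<nu> k x))" by (rule info_rate.integrable_exp)
  show "(\<integral>x. exp (- \<theta> * info_rate \<nu> k x) \<partial>\<nu>) > 0"
    using info_rate.mom_pos[of k "- \<theta>"] by (simp add: exp_moment_def)
  show "Psi \<nu> k \<theta> = ln (\<integral>x. exp (- \<theta> * info_rate \<nu> k x) \<partial>\<nu>)"
    "Psi \<nu> k \<theta> = cgf \<nu> (\<lambda>x. - info_rate \<nu> k x) \<theta>"
    by (simp_all add: Psi_eq_cgf cgf_def)
next
  fix n :: nat assume "n \<ge> 1"
  then show "(deriv ^^ n) (Psi \<nu> k) 0 = (deriv ^^ n) (spectrum \<nu> k) 1 / (real k * ln 2) ^ (n - 1)"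
    using assms by (simp add: funpow_deriv_Psi_0 funpow_deriv_spectrum_1)
next
  show "(deriv ^^ 2) (Psi \<nu> k) 0 = variance_of \<nu> (info_rate \<nu> k)"
    by (simp add: funpow_deriv_Psi_0 cumulant_2)
  show "variance_of \<nu> (info_rate \<nu> k) = (deriv ^^ 2) (spectrum \<nu> k) 1 / (real k * ln 2)"
    using assms by (simp add: funpow_deriv_spectrum_1 cumulant_2)
qed (use assms in \<open>simp_all add: convex_Psi smooth_Psi smooth_spectrum info_rate.smooth_cgf
       funpow_deriv_Psi_0 deriv_Psi_0\<close>)

section \<open>Linear bounds on the spectrum from convexity\<close>

lemma spectrum_1: "spectrum \<nu> k 1 = 0"
proof (cases "k = 0")
  case False
  then show ?thesis by (simp add: spectrum_eq_cgf cgf_def prob_space)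
qed (simp add: spectrum_def)

text \<open>At order 0 the sum counts the cubes of positive mass, of which there are at most 2 to
  the power k d.\<close>

lemma spectrum_0_le: "spectrum \<nu> k 0 \<le> CARD('d)"
proof (cases "k = 0")
  case False
  have fin: "finite {Q \<in> dyadic_cubes k. measure \<nu> Q > 0}" by simp
  have sum: "(\<Sum>Q\<in>{Q \<in> dyadic_cubes k. measure \<nu> Q > 0}. measure \<nu> Q powr 0)
      = real (card {Q \<in> dyadic_cubes k. measure \<nu> Q > 0})"
    by simp
  have ne: "{Q \<in> dyadic_cubes k. measure \<nu> Q > 0} \<noteq> {}"
  proof
    assume "{Q \<in> dyadic_cubes k. measure \<nu> Q > 0} = {}"
    with AE_cube_at[of k] have "AE x in \<nu>. False" by (elim eventually_mono) blast
    then show False by simp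
  qed
  define N where "N = card {Q \<in> dyadic_cubes k. measure \<nu> Q > 0}"
  have "N \<le> card (dyadic_cubes k :: (real ^ 'd) set set)"
    unfolding N_def by (intro card_mono) auto
  also note card_dyadic_cubes_le
  also have "(2 ^ k) ^ CARD('d) = (2::nat) ^ (k * CARD('d))" by (simp add: power_mult)
  finally have "real N \<le> real (2 ^ (k * CARD('d)))" by (rule of_nat_mono)
  moreover have "N > 0" unfolding N_def using ne fin by (subst card_gt_0_iff) simp
  ultimately have "log 2 (real N) \<le> log 2 (2 ^ (k * CARD('d)))" by (subst log_le_cancel_iff) auto
  also have "\<dots> = real k * CARD('d)" by (simp add: log_nat_power)
  finally show ?thesis using False unfolding spectrum_def sum N_def by (simp add: field_simps)
qed (simp add: spectrum_def)

lemma convex_spectrum: "convex_on UNIV (spectrum \<nu> k)"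
proof (cases "k = 0")
  case True
  then have "spectrum \<nu> k = (\<lambda>_. 0)" by (auto simp: spectrum_def)
  then show ?thesis by (simp add: convex_on_def)
next
  case False
  show ?thesis
  proof (rule convex_onI)
    fix t x y :: real assume t: "0 < t" "t < 1"
    have *: "real k * ln 2 * (1 - ((1 - t) * x + t * y)) =
        (1 - t) * (real k * ln 2 * (1 - x)) + t * (real k * ln 2 * (1 - y))" by (simp add: algebra_simps)
    show "spectrum \<nu> k ((1 - t) *\<^sub>R x + t *\<^sub>R y) \<le> (1 - t) * spectrum \<nu> k x + t * spectrum \<nu> k y"
      using convex_onD[OF info_rate.convex_cgf[of k], of t "real k * ln 2 * (1 - x)" "real k * ln 2 * (1 - y)"]
        t False by (simp add: spectrum_eq_cgf * divide_right_mono add_divide_distrib[symmetric])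
  qed simp
qed

lemma spectrum_nonneg: "q \<le> 1 \<Longrightarrow> 0 \<le> spectrum \<nu> k q"
  and spectrum_nonpos: "q \<ge> 1 \<Longrightarrow> spectrum \<nu> k q \<le> 0"
proof -
  have E: "q \<le> 1 \<Longrightarrow> AE x in \<nu>. 1 \<le> exp (real k * ln 2 * (1 - q) * info_rate \<nu> k x)"
    "q \<ge> 1 \<Longrightarrow> AE x in \<nu>. exp (real k * ln 2 * (1 - q) * info_rate \<nu> k x) \<le> 1"
    using AE_info_rate_bounds[of k] by (auto elim!: eventually_mono simp: mult_nonneg_nonpos mult_nonpos_nonneg)
  have k: "k = 0 \<or> k \<ge> 1" by auto
  show "0 \<le> spectrum \<nu> k q" if "q \<le> 1"
    using k integral_ge_const[OF info_rate.integrable_exp E(1)[OF that]]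
    by (auto simp: spectrum_eq_cgf cgf_def spectrum_def[of _ 0])
  show "spectrum \<nu> k q \<le> 0" if "q \<ge> 1"
    using k integral_le_const[OF info_rate.integrable_exp E(2)[OF that]] info_rate.mom_pos[of k]
    by (auto simp: spectrum_eq_cgf cgf_def spectrum_def[of _ 0] exp_moment_def divide_le_0_iff)
qed

text \<open>The convex graph lies below its chord from order 0 to order 1, where it
  vanishes.\<close>

lemma spectrum_le:
  fixes q :: real
  assumes "0 \<le> q" "q \<le> 1"
  shows "spectrum \<nu> k q \<le> CARD('d) * (1 - q)"
proof -
  have "spectrum \<nu> k q \<le> (1 - q) * spectrum \<nu> k 0"
    using convex_onD[OF convex_spectrum[of k], of q 0 1] assms by (simp add: spectrum_1)
  also have "\<dots> \<le> (1 - q) * CARD('d)" using spectrum_0_le assms by (intro mult_left_mono) auto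
  finally show ?thesis by (simp add: mult.commute)
qed

text \<open>To the right of order 1 a convex graph lies above the extension of that chord; the proof
  writes 1 as a convex combination of 0 and \<open>q\<close>.\<close>

lemma spectrum_ge:
  fixes q :: real
  assumes "q \<ge> 1"
  shows "CARD('d) * (1 - q) \<le> spectrum \<nu> k q"
proof -
  have "(1 - 1 / q) *\<^sub>R 0 + (1 / q) *\<^sub>R q = 1" using assms by simp
  with convex_onD[OF convex_spectrum[of k], of "1 / q" 0 q] assms
  have "0 \<le> (1 - 1 / q) * spectrum \<nu> k 0 + 1 / q * spectrum \<nu> k q" by (metis UNIV_I spectrum_1
      divide_le_eq_1_pos less_le_trans zero_le_divide_1_iff zero_less_one order.strict_implies_order)
  then have "0 \<le> q * ((1 - 1 / q) * spectrum \<nu> k 0 + 1 / q * spectrum \<nu> k q)"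
    using assms by simp
  also have "\<dots> = (q - 1) * spectrum \<nu> k 0 + spectrum \<nu> k q"
    using assms by (simp add: field_simps)
  also have "\<dots> \<le> (q - 1) * CARD('d) + spectrum \<nu> k q"
    using spectrum_0_le assms by (intro add_right_mono mult_left_mono) auto
  finally show ?thesis by (simp add: algebra_simps)
qed

lemma exp_cgf: "exp (cgf \<nu> (info_rate \<nu> k) \<theta>) = (\<integral>x. exp (\<theta> * info_rate \<nu> k x) \<partial>\<nu>)"
  using info_rate.mom_pos[of k \<theta>] by (simp add: cgf_def exp_moment_def)

text \<open>The admissible tilts are exactly those of orders \<open>q\<close> between 0 and 1, so
  each fixed \<theta> >= 0 becomes admissible for large \<open>k\<close>.\<close>

lemma exp_moment_info_rate_le:
  fixes \<theta> :: real
  assumes "0 \<le> \<theta>" "\<theta> \<le> real k * ln 2" "k \<ge> 1"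
  shows "(\<integral>x. exp (\<theta> * info_rate \<nu> k x) \<partial>\<nu>) \<le> exp (CARD('d) * \<theta>)"
proof -
  define q where "q = 1 - \<theta> / (real k * ln 2)"
  have q: "0 \<le> q" "q \<le> 1" "real k * ln 2 * (1 - q) = \<theta>"
    using assms by (auto simp: q_def field_simps)
  have "cgf \<nu> (info_rate \<nu> k) \<theta> = spectrum \<nu> k q * (real k * ln 2)"
    using assms q by (simp add: spectrum_eq_cgf)
  also have "\<dots> \<le> CARD('d) * (1 - q) * (real k * ln 2)"
    using spectrum_le[OF q(1,2)] assms by (intro mult_right_mono) auto
  also have "\<dots> = CARD('d) * (real k * ln 2 * (1 - q))" by (simp only: mult_ac)
  finally have "cgf \<nu> (info_rate \<nu> k) \<theta> \<le> CARD('d) * \<theta>" unfolding q(3) .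
  then show ?thesis by (simp only: exp_cgf[symmetric] exp_le_cancel_iff)
qed

text \<open>One bound for both tails: the factor \<open>1 - q\<close> keeps the inequality for q < 1
  and reverses it for q > 1.\<close>

lemma Chernoff_info_rate:
  fixes q t :: real
  assumes "k \<ge> 1"
  shows "measure \<nu> {x. (1 - q) * t \<le> (1 - q) * info_rate \<nu> k x}
    \<le> exp (real k * ln 2 * (spectrum \<nu> k q - t * (1 - q)))"
proof -
  define \<theta> where "\<theta> = real k * ln 2 * (1 - q)"
  have "measure \<nu> {x. (1 - q) * t \<le> (1 - q) * info_rate \<nu> k x} = 
      measure \<nu> {x. exp (\<theta> * t) \<le> exp (\<theta> * info_rate \<nu> k x)}"
    using assms by (intro arg_cong[where f = "measure \<nu>"] Collect_cong)
      (simp only: exp_le_cancel_iff \<theta>_def mult.assoc[of "real k * ln 2"] mult_le_cancel_left_pos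
        zero_less_mult_iff of_nat_0_less_iff, simp)
  also have "\<dots> \<le> (\<integral>x. exp (\<theta> * info_rate \<nu> k x) \<partial>\<nu>) / exp (\<theta> * t)"
    using integral_Markov_inequality_measure[OF info_rate.integrable_exp[of \<theta> k], of UNIV "exp (\<theta> * t)"]
    by simp
  also have "(\<integral>x. exp (\<theta> * info_rate \<nu> k x) \<partial>\<nu>) = exp (cgf \<nu> (info_rate \<nu> k) \<theta>)"
    by (rule exp_cgf[symmetric])
  also have "cgf \<nu> (info_rate \<nu> k) \<theta> = real k * ln 2 * spectrum \<nu> k q"
    using assms by (simp add: spectrum_eq_cgf \<theta>_def)
  finally show ?thesis by (simp add: \<theta>_def exp_diff[symmetric] algebra_simps)
qed

end

section \<open>One-sided derivatives of the upper spectrum at 1\<close>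

lemma mono_bounded_imp_tendsto_at_left:
  fixes g :: "real \<Rightarrow> real"
  assumes "l < x" and mono: "\<And>y z. l \<le> y \<Longrightarrow> y \<le> z \<Longrightarrow> z < x \<Longrightarrow> g y \<le> g z"
    and bound: "\<And>y. l \<le> y \<Longrightarrow> y < x \<Longrightarrow> g y \<le> K"
  shows "(g \<longlongrightarrow> Sup (g ` {l..<x})) (at_left x)"
proof (rule order_tendstoI)
  have bdd: "bdd_above (g ` {l..<x})" using bound by (intro bdd_aboveI2) auto
  have ev: "\<forall>\<^sub>F y in at_left x. y \<in> {l'..<x}" if "l' < x" for l'
    unfolding eventually_at_left_field using that by (intro exI[of _ l']) auto
  fix a assume "a < Sup (g ` {l..<x})"
  then obtain y0 where y0: "y0 \<in> {l..<x}" "a < g y0"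
    using less_cSup_iff[OF _ bdd] assms(1) by auto
  with ev[of y0] show "\<forall>\<^sub>F y in at_left x. a < g y"
    by (auto elim!: eventually_mono intro: less_le_trans[OF _ mono])
next
  have bdd: "bdd_above (g ` {l..<x})" using bound by (intro bdd_aboveI2) auto
  fix a assume a: "Sup (g ` {l..<x}) < a"
  have "\<forall>\<^sub>F y in at_left x. y \<in> {l..<x}"
    unfolding eventually_at_left_field using assms(1) by (intro exI[of _ l]) auto
  then show "\<forall>\<^sub>F y in at_left x. g y < a"
  proof eventually_elim
    case (elim y)
    then have "g y \<le> Sup (g ` {l..<x})" using bdd by (intro cSup_upper) auto
    with a show ?case by simp
  qed
qed

lemma mono_bounded_imp_tendsto_at_right:
  fixes g :: "real \<Rightarrow> real"
  assumes "x < u" and mono: "\<And>y z. x < y \<Longrightarrow> y \<le> z \<Longrightarrow> z \<le> u \<Longrightarrow> g y \<le> g z"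
    and bound: "\<And>y. x < y \<Longrightarrow> y \<le> u \<Longrightarrow> K \<le> g y"
  shows "(g \<longlongrightarrow> Inf (g ` {x<..u})) (at_right x)"
proof (rule order_tendstoI)
  have bdd: "bdd_below (g ` {x<..u})" using bound by (intro bdd_belowI2) auto
  have ev: "\<forall>\<^sub>F y in at_right x. y \<in> {x<..u'}" if "x < u'" for u'
    unfolding eventually_at_right_field using that by (intro exI[of _ u']) auto
  fix a assume "Inf (g ` {x<..u}) < a"
  then obtain y0 where y0: "y0 \<in> {x<..u}" "g y0 < a"
    using cInf_less_iff[OF _ bdd] assms(1) by auto
  with ev[of y0] show "\<forall>\<^sub>F y in at_right x. g y < a"
    by (auto elim!: eventually_mono intro: le_less_trans[OF mono])
next
  have bdd: "bdd_below (g ` {x<..u})" using bound by (intro bdd_belowI2) auto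
  fix a assume a: "a < Inf (g ` {x<..u})"
  have "\<forall>\<^sub>F y in at_right x. y \<in> {x<..u}"
    unfolding eventually_at_right_field using assms(1) by (intro exI[of _ u]) auto
  then show "\<forall>\<^sub>F y in at_right x. a < g y"
  proof eventually_elim
    case (elim y)
    then have "Inf (g ` {x<..u}) \<le> g y" using bdd by (intro cInf_lower) auto
    with a show ?case by simp
  qed
qed

text \<open>The one-sided filter is nontrivial, so limits are unique and exhibiting one derivative
  determines the definite description.\<close>

lemma right_deriv_eqI: "(f has_real_derivative D) (at_right x) \<Longrightarrow> right_deriv f x = D"
  unfolding right_deriv_def has_field_derivative_iff
  by (rule the_equality) (auto intro: tendsto_unique[rotated])

lemma left_deriv_eqI: "(f has_real_derivative D) (at_left x) \<Longrightarrow> left_deriv f x = D"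
  unfolding left_deriv_def has_field_derivative_iff
  by (rule the_equality) (auto intro: tendsto_unique[rotated])

context dyadic_prob
begin

text \<open>The linear bounds on both sides of order 1 keep the sequence bounded in
  \<open>k\<close>, so the upper limit is a real number.\<close>

lemma limsup_spectrum:
  assumes "q \<ge> 0"
  shows "limsup (\<lambda>k. ereal (spectrum \<nu> k q)) = ereal (upper_spectrum \<nu> q)"
proof -
  define K where "K = CARD('d) * (1 + \<bar>q\<bar>)"
  have b: "\<bar>spectrum \<nu> k q\<bar> \<le> K" for k
  proof (cases "q \<le> 1")
    case True
    have "CARD('d) * (1 - q) \<le> K" unfolding K_def using assms by (intro mult_left_mono) auto
    then show ?thesis using spectrum_le[of q k] spectrum_nonneg[of q k] assms True by linarith
  next
    case False
    have "- (CARD('d) * (1 - q)) \<le> K"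
      unfolding K_def mult_minus_right[symmetric] using assms by (intro mult_left_mono) auto
    then show ?thesis using spectrum_ge[of q k] spectrum_nonpos[of q k] assms False by linarith
  qed
  have "limsup (\<lambda>k. ereal (spectrum \<nu> k q)) \<le> ereal K"
    by (intro Limsup_bounded always_eventually allI) (use b in \<open>auto simp: abs_le_iff\<close>)
  moreover have "ereal (- K) \<le> limsup (\<lambda>k. ereal (spectrum \<nu> k q))"
    by (rule order_trans[OF Liminf_bounded Liminf_le_Limsup])
      (use b in \<open>auto simp: abs_le_iff minus_le_iff simp del: uminus_ereal.simps\<close>)
  ultimately have "\<bar>limsup (\<lambda>k. ereal (spectrum \<nu> k q))\<bar> \<noteq> \<infinity>" by auto
  then show ?thesis unfolding upper_spectrum_def by (simp add: ereal_real)
qed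

lemma upper_spectrum_le:
  assumes "q \<ge> 0" "\<forall>\<^sub>F k in sequentially. spectrum \<nu> k q \<le> c"
  shows "upper_spectrum \<nu> q \<le> c"
proof -
  have "limsup (\<lambda>k. ereal (spectrum \<nu> k q)) \<le> ereal c"
    using assms(2) by (intro Limsup_bounded) auto
  then show ?thesis by (simp add: limsup_spectrum[OF assms(1)])
qed

lemma upper_spectrum_ge:
  assumes "q \<ge> 0" "\<forall>\<^sub>F k in sequentially. c \<le> spectrum \<nu> k q"
  shows "c \<le> upper_spectrum \<nu> q"
proof -
  have "ereal c \<le> limsup (\<lambda>k. ereal (spectrum \<nu> k q))"
    using assms(2) by (intro order_trans[OF Liminf_bounded Liminf_le_Limsup]) auto
  then show ?thesis by (simp add: limsup_spectrum[OF assms(1)])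
qed

lemma eventually_spectrum_less:
  assumes "q \<ge> 0" "upper_spectrum \<nu> q < c"
  shows "\<forall>\<^sub>F k in sequentially. spectrum \<nu> k q < c"
proof -
  have "limsup (\<lambda>k. ereal (spectrum \<nu> k q)) < ereal c"
    using assms(2) by (simp add: limsup_spectrum[OF assms(1)])
  then show ?thesis using Limsup_lessD by fastforce
qed

lemma upper_spectrum_1: "upper_spectrum \<nu> 1 = 0"
  by (intro antisym upper_spectrum_le upper_spectrum_ge) (auto simp: spectrum_1)

text \<open>With \<open>spectrum_chord\<close> this carries the convexity inequality through the
  point 1 over to the upper limit.\<close>

lemma upper_spectrum_scale:
  assumes "q \<ge> 0" "q' \<ge> 0" "c > 0" "\<And>k. spectrum \<nu> k q \<le> c * spectrum \<nu> k q'"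
  shows "upper_spectrum \<nu> q \<le> c * upper_spectrum \<nu> q'"
proof (rule field_le_epsilon)
  fix e :: real assume "e > 0"
  then have "\<forall>\<^sub>F k in sequentially. spectrum \<nu> k q' < upper_spectrum \<nu> q' + e / c"
    using assms by (intro eventually_spectrum_less) auto
  then have "\<forall>\<^sub>F k in sequentially. spectrum \<nu> k q \<le> c * upper_spectrum \<nu> q' + e"
  proof eventually_elim
    case (elim k)
    have "c * spectrum \<nu> k q' \<le> c * (upper_spectrum \<nu> q' + e / c)"
      using elim assms by (intro mult_left_mono) auto
    also have "\<dots> = c * upper_spectrum \<nu> q' + e" using assms by (simp add: algebra_simps)
    finally show ?case using assms(4)[of k] by linarith
  qed
  then show "upper_spectrum \<nu> q \<le> c * upper_spectrum \<nu> q' + e"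
    using assms by (intro upper_spectrum_le) auto
qed

lemma spectrum_chord:
  assumes "0 \<le> t" "t \<le> 1"
  shows "spectrum \<nu> k ((1 - t) + t * q) \<le> t * spectrum \<nu> k q"
  using convex_onD[OF convex_spectrum[of k], of t 1 q] assms by (simp add: spectrum_1)

text \<open>The difference quotient at 1, where the upper spectrum vanishes. Monotone and bounded on
  each side, it yields the one-sided derivatives - \<open>sigma_plus\<close> and -
  \<open>sigma_minus\<close>.\<close>

definition chord :: "real \<Rightarrow> real" where
  "chord q = upper_spectrum \<nu> q / (q - 1)"

lemma chord_mono_left:
  assumes "0 \<le> y" "y \<le> z" "z < 1"
  shows "chord y \<le> chord z"
proof -
  \<comment> \<open>\<open>z\<close> is the convex combination of 1 and \<open>y\<close> that gives
    \<open>y\<close> the weight \<open>t\<close>.\<close>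
  define t where "t = (1 - z) / (1 - y)"
  have t: "0 < t" "t \<le> 1" using assms by (auto simp: t_def)
  have "t * (1 - y) = 1 - z" using assms by (simp add: t_def)
  then have z: "(1 - t) + t * y = z" by (simp add: algebra_simps)
  have "upper_spectrum \<nu> z \<le> t * upper_spectrum \<nu> y"
    using spectrum_chord[of t _ y] t assms by (intro upper_spectrum_scale) (auto simp: z)
  then have "upper_spectrum \<nu> z / (1 - z) \<le> t * upper_spectrum \<nu> y / (1 - z)"
    using assms by (intro divide_right_mono) auto
  also have "\<dots> = upper_spectrum \<nu> y / (1 - y)"
    using assms by (simp add: t_def)
  finally show ?thesis
    unfolding chord_def minus_diff_eq[of 1, symmetric] by (simp add: divide_minus_right del: minus_diff_eq)
qed

lemma chord_mono_right:
  assumes "1 < y" "y \<le> z"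
  shows "chord y \<le> chord z"
proof -
  define t where "t = (y - 1) / (z - 1)"
  have t: "0 < t" "t \<le> 1" using assms by (auto simp: t_def)
  have "t * (z - 1) = y - 1" using assms by (simp add: t_def)
  then have z: "(1 - t) + t * z = y" by (simp add: algebra_simps)
  have "upper_spectrum \<nu> y \<le> t * upper_spectrum \<nu> z"
    using spectrum_chord[of t _ z] t assms by (intro upper_spectrum_scale) (auto simp: z)
  then have "upper_spectrum \<nu> y / (y - 1) \<le> t * upper_spectrum \<nu> z / (y - 1)"
    using assms by (intro divide_right_mono) auto
  also have "\<dots> = upper_spectrum \<nu> z / (z - 1)"
    using assms by (simp add: t_def)
  finally show ?thesis by (simp add: chord_def)
qed

lemma chord_left_nonpos: "0 \<le> y \<Longrightarrow> y < 1 \<Longrightarrow> chord y \<le> 0"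
  unfolding chord_def using upper_spectrum_ge[of y 0] spectrum_nonneg[of y]
  by (auto simp: divide_nonneg_neg)

lemma chord_right_ge:
  assumes "1 < y"
  shows "- real CARD('d) \<le> chord y"
proof -
  have "CARD('d) * (1 - y) \<le> upper_spectrum \<nu> y"
    using assms spectrum_ge[of y] by (intro upper_spectrum_ge) auto
  then show ?thesis using assms by (simp add: chord_def pos_le_divide_eq algebra_simps)
qed

lemma tendsto_chord_left: "(chord \<longlongrightarrow> - sigma_plus \<nu>) (at_left 1)"
proof -
  have lim: "(chord \<longlongrightarrow> Sup (chord ` {0..<1})) (at_left 1)"
    by (rule mono_bounded_imp_tendsto_at_left[where K = 0])
      (auto intro: chord_mono_left chord_left_nonpos)
  then have "left_deriv (upper_spectrum \<nu>) 1 = Sup (chord ` {0..<1})"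
    by (intro left_deriv_eqI) (simp add: has_field_derivative_iff upper_spectrum_1 chord_def[abs_def])
  then show ?thesis using lim by (simp add: sigma_plus_def)
qed

lemma tendsto_chord_right: "(chord \<longlongrightarrow> - sigma_minus \<nu>) (at_right 1)"
proof -
  have lim: "(chord \<longlongrightarrow> Inf (chord ` {1<..2})) (at_right 1)"
    by (rule mono_bounded_imp_tendsto_at_right[where K = "- real CARD('d)"])
      (auto intro: chord_mono_right chord_right_ge)
  then have "right_deriv (upper_spectrum \<nu>) 1 = Inf (chord ` {1<..2})"
    by (intro right_deriv_eqI) (simp add: has_field_derivative_iff upper_spectrum_1 chord_def[abs_def])
  then show ?thesis using lim by (simp add: sigma_minus_def)
qed

section \<open>Vanishing tails of the information rates\<close>

lemma tendsto_prob_Chernoff: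
  assumes "q \<ge> 0" "upper_spectrum \<nu> q < t * (1 - q)"
  shows "(\<lambda>k. measure \<nu> {x. (1 - q) * t \<le> (1 - q) * info_rate \<nu> k x}) \<longlonglongrightarrow> 0"
proof -
  \<comment> \<open>\<open>c\<close> lies halfway between the upper spectrum and the threshold; the
    other half of the gap, times ln 2, is the decay rate \<open>b\<close> per level.\<close>
  define c where "c = (upper_spectrum \<nu> q + t * (1 - q)) / 2"
  define b where "b = ln 2 * (t * (1 - q) - c)"
  have c: "upper_spectrum \<nu> q < c" and b: "b > 0" using assms by (auto simp: c_def b_def)
  have lim: "(\<lambda>k. exp (- b) ^ k) \<longlonglongrightarrow> 0" using b by (intro LIMSEQ_realpow_zero) auto
  have "\<forall>\<^sub>F k in sequentially. measure \<nu> {x. (1 - q) * t \<le> (1 - q) * info_rate \<nu> k x} \<le> exp (- b) ^ k"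
    using eventually_spectrum_less[OF assms(1) c] eventually_ge_at_top[of 1]
  proof eventually_elim
    case (elim k)
    have "real k * ln 2 * (spectrum \<nu> k q - t * (1 - q)) \<le> real k * ln 2 * (c - t * (1 - q))"
      using elim by (intro mult_left_mono) auto
    also have "\<dots> = real k * (- b)" by (simp add: b_def algebra_simps)
    finally show ?case
      using Chernoff_info_rate[OF elim(2), of q t]
      by (simp only: exp_of_nat_mult[symmetric]) (meson exp_le_cancel_iff order_trans)
  qed
  then show ?thesis by (intro Lim_null_comparison[OF _ lim]) simp
qed

lemma measure_info_law:
  assumes "A \<in> sets borel"
  shows "measure (info_law \<nu> k) A = measure \<nu> {x. info_rate \<nu> k x \<in> A}"
  unfolding info_law_def using assms by (subst measure_distr) (auto simp: vimage_def)

lemma tendsto_prob_upper: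
  assumes "q \<ge> 0" "q < 1" "upper_spectrum \<nu> q < t * (1 - q)"
  shows "(\<lambda>k. measure (info_law \<nu> k) {t<..}) \<longlonglongrightarrow> 0"
proof (rule Lim_null_comparison[OF always_eventually tendsto_prob_Chernoff[OF assms(1,3)]], rule allI)
  fix k
  have "measure (info_law \<nu> k) {t<..} = measure \<nu> {x. info_rate \<nu> k x \<in> {t<..}}"
    by (rule measure_info_law) simp
  also have "\<dots> \<le> measure \<nu> {x. (1 - q) * t \<le> (1 - q) * info_rate \<nu> k x}"
    using assms(2) by (intro finite_measure_mono) auto
  finally show "norm (measure (info_law \<nu> k) {t<..}) \<le> measure \<nu> {x. (1 - q) * t \<le> (1 - q) * info_rate \<nu> k x}"
    by simp
qed

lemma tendsto_prob_lower:
  assumes "q > 1" "upper_spectrum \<nu> q < t * (1 - q)"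
  shows "(\<lambda>k. measure (info_law \<nu> k) {..t}) \<longlonglongrightarrow> 0"
proof (rule Lim_null_comparison[OF always_eventually tendsto_prob_Chernoff], rule allI)
  fix k
  have "measure (info_law \<nu> k) {..t} = measure \<nu> {x. info_rate \<nu> k x \<in> {..t}}"
    by (rule measure_info_law) simp
  also have "\<dots> \<le> measure \<nu> {x. (1 - q) * t \<le> (1 - q) * info_rate \<nu> k x}"
    using assms(1) by (intro finite_measure_mono) auto
  finally show "norm (measure (info_law \<nu> k) {..t}) \<le> measure \<nu> {x. (1 - q) * t \<le> (1 - q) * info_rate \<nu> k x}"
    by simp
qed (use assms in auto)

text \<open>\<open>- t\<close> lies below the left limit of the difference quotients, so some
  \<open>q < 1\<close> has \<open>chord q > - t\<close>; multiplied by \<open>q - 1 < 0\<close> this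
  is the condition of the Chernoff bound.\<close>

lemma tendsto_prob_above_sigma_plus:
  assumes "t > sigma_plus \<nu>"
  shows "(\<lambda>k. measure (info_law \<nu> k) {t<..}) \<longlonglongrightarrow> 0"
proof -
  have "\<forall>\<^sub>F q in at_left 1. - t < chord q"
    using assms by (intro order_tendstoD(1)[OF tendsto_chord_left]) simp
  moreover have "\<forall>\<^sub>F q in at_left 1. q \<in> {0<..<1::real}"
    unfolding eventually_at_left_field by (intro exI[of _ 0]) auto
  ultimately have "\<forall>\<^sub>F q in at_left 1. - t < chord q \<and> q \<in> {0<..<1}" by eventually_elim auto
  then obtain q where "- t < chord q" "0 < q" "q < 1"
    using eventually_happens'[OF trivial_limit_at_left_real] by fastforce
  then show ?thesis
    by (intro tendsto_prob_upper[of q]) (auto simp: chord_def neg_less_divide_eq algebra_simps)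
qed

lemma tendsto_prob_below_sigma_minus:
  assumes "t < sigma_minus \<nu>"
  shows "(\<lambda>k. measure (info_law \<nu> k) {..t}) \<longlonglongrightarrow> 0"
proof -
  have "\<forall>\<^sub>F q in at_right 1. chord q < - t"
    using assms by (intro order_tendstoD(2)[OF tendsto_chord_right]) simp
  moreover have "\<forall>\<^sub>F q in at_right 1. q \<in> {1<..<2::real}"
    unfolding eventually_at_right_field by (intro exI[of _ 2]) auto
  ultimately have "\<forall>\<^sub>F q in at_right 1. chord q < - t \<and> q \<in> {1<..<2}" by eventually_elim auto
  then obtain q where "chord q < - t" "1 < q"
    using eventually_happens'[OF trivial_limit_at_right_real] by fastforce
  then show ?thesis
    by (intro tendsto_prob_lower[of q]) (auto simp: chord_def pos_divide_less_eq algebra_simps)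
qed

lemma tendsto_prob_above_dim:
  fixes t :: real
  assumes "t > CARD('d)"
  shows "(\<lambda>k. measure (info_law \<nu> k) {t<..}) \<longlonglongrightarrow> 0"
proof (rule tendsto_prob_upper[of 0])
  have "upper_spectrum \<nu> 0 \<le> CARD('d)"
    using spectrum_0_le by (intro upper_spectrum_le) auto
  then show "upper_spectrum \<nu> 0 < t * (1 - 0)" using assms by simp
qed simp_all

end

section \<open>Limits of the information rates\<close>

context dyadic_prob
begin

lemma AE_info_law_nonneg: "AE y in info_law \<nu> k. 0 \<le> y"
  unfolding info_law_def using AE_info_rate_bounds[of k]
  by (subst AE_distr_iff) auto

text \<open>Stated along a subsequence because recovering weak convergence from \<open>Psi\<close>
  requires identifying subsequential limits.\<close>

lemma weak_conv_info_law_bounds: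
  assumes "real_distribution \<rho>" "strict_mono s" "weak_conv_m (\<lambda>k. info_law \<nu> (s k)) \<rho>"
  shows "AE y in \<rho>. 0 \<le> y \<and> y \<le> CARD('d)"
proof (rule weak_conv_carrier[OF _ assms(1,3)])
  show "real_distribution (info_law \<nu> (s k))" for k by (rule real_distribution_info_law)
  show "(\<lambda>k. measure (info_law \<nu> (s k)) {t<..}) \<longlonglongrightarrow> 0" if "t > CARD('d)" for t :: real
    using LIMSEQ_subseq_LIMSEQ[OF tendsto_prob_above_dim[OF that] assms(2)] by (simp add: o_def)
  show "(\<lambda>k. measure (info_law \<nu> (s k)) {..t}) \<longlonglongrightarrow> 0" if "t < 0" for t :: real
  proof -
    have "measure (info_law \<nu> k) {..t} = 0" for k
    proof -
      interpret L: real_distribution "info_law \<nu> k" by (rule real_distribution_info_law)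
      have "AE y in info_law \<nu> k. y \<notin> {..t}"
        using AE_info_law_nonneg[of k] by eventually_elim (use that in auto)
      then show ?thesis by (subst L.prob_eq_0) auto
    qed
    then show ?thesis by simp
  qed
qed

lemma weak_conv_info_law_bounded_rv:
  assumes "real_distribution \<rho>" "strict_mono s" "weak_conv_m (\<lambda>k. info_law \<nu> (s k)) \<rho>"
  shows "bounded_rv \<rho> (\<lambda>y. y) (CARD('d))"
proof -
  interpret \<rho>: real_distribution \<rho> by fact
  show ?thesis
  proof
    show "AE y in \<rho>. \<bar>y\<bar> \<le> CARD('d)"
      using weak_conv_info_law_bounds[OF assms] by eventually_elim auto
  qed simp
qed

lemma weak_conv_exp_moment:
  assumes "real_distribution \<rho>" "strict_mono s" "weak_conv_m (\<lambda>k. info_law \<nu> (s k)) \<rho>"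
  shows "(\<lambda>k. exp_moment \<nu> (info_rate \<nu> (s k)) n t) \<longlonglongrightarrow> exp_moment \<rho> (\<lambda>y. y) n t"
proof -
  define \<theta> where "\<theta> = \<bar>t\<bar> + 1"
  have "(\<lambda>k. \<integral>y. y ^ n * exp (t * y) \<partial>info_law \<nu> (s k)) \<longlonglongrightarrow> (\<integral>y. y ^ n * exp (t * y) \<partial>\<rho>)"
  proof (rule weak_conv_integral_exp_bound[OF _ assms(1,3), where A = "fact n" and \<theta> = \<theta>
        and B = "exp (CARD('d) * (\<theta> + 1))"])
    show "AE y in \<rho>. 0 \<le> y \<and> y \<le> CARD('d)" by (rule weak_conv_info_law_bounds[OF assms])
    \<comment> \<open>From some level on, \<theta> + 1 is at most k ln 2, the range of the uniform
      moment bound; a strictly increasing \<open>s\<close> satisfies s k >= k.\<close>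
    obtain N where N: "(\<theta> + 1) / ln 2 \<le> real N" using real_arch_simple by blast
    have "\<forall>\<^sub>F k in sequentially. (\<theta> + 1) / ln 2 \<le> real (s k) \<and> 1 \<le> s k"
      using eventually_ge_at_top[of "max N 1"]
    proof eventually_elim
      case (elim k)
      then have "N \<le> s k" "1 \<le> s k" using seq_suble[OF assms(2), of k] by auto
      with N show ?case by linarith
    qed
    then show "\<forall>\<^sub>F k in sequentially. integrable (info_law \<nu> (s k)) (\<lambda>y. exp ((\<theta> + 1) * y)) \<and>
        (\<integral>y. exp ((\<theta> + 1) * y) \<partial>info_law \<nu> (s k)) \<le> exp (CARD('d) * (\<theta> + 1))"
    proof eventually_elim
      case (elim k)
      then have "\<theta> + 1 \<le> real (s k) * ln 2" by (simp add: field_simps)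
      then show ?case
        using exp_moment_info_rate_le[of "\<theta> + 1" "s k"] elim info_rate.integrable_exp
        by (simp add: integral_info_law integrable_info_law \<theta>_def)
    qed
    show "\<bar>y ^ n * exp (t * y)\<bar> \<le> fact n * exp (\<theta> * y)" if "0 \<le> y" for y
      unfolding \<theta>_def by (rule pow_exp_le[OF that])
  qed (auto intro!: continuous_intros real_distribution_info_law AE_info_law_nonneg simp: \<theta>_def)
  then show ?thesis by (simp add: exp_moment_def integral_info_law)
qed

lemma weak_conv_Psi:
  assumes "real_distribution \<rho>" "strict_mono s" "weak_conv_m (\<lambda>k. info_law \<nu> (s k)) \<rho>"
  shows "(\<lambda>k. Psi \<nu> (s k) \<theta>) \<longlonglongrightarrow> cgf \<rho> (\<lambda>y. y) (- \<theta>)"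
proof -
  interpret \<rho>: bounded_rv \<rho> "\<lambda>y. y" "CARD('d)" by (rule weak_conv_info_law_bounded_rv[OF assms])
  show ?thesis
    unfolding Psi_eq_cgf info_rate.cgf_eq \<rho>.cgf_eq
    using \<rho>.mom_pos[of "- \<theta>"] by (intro tendsto_ln weak_conv_exp_moment[OF assms]) simp
qed

text \<open>From some level on the mass above d + 1 is small; the finitely many earlier levels are
  almost surely bounded, and \<open>b\<close> dominates all their bounds.\<close>

lemma tight_info_law: "tight (info_law \<nu>)"
  unfolding tight_def
proof (intro conjI allI impI)
  show "real_distribution (info_law \<nu> k)" for k by (rule real_distribution_info_law)
  fix e :: real assume e: "e > 0"
  define d where "d = real CARD('d) + 1"
  have "\<forall>\<^sub>F k in sequentially. measure (info_law \<nu> k) {d<..} < e"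
    using e by (intro order_tendstoD(2)[OF tendsto_prob_above_dim]) (simp add: d_def)
  then obtain N where N: "\<And>k. k \<ge> N \<Longrightarrow> measure (info_law \<nu> k) {d<..} < e"
    by (auto simp: eventually_sequentially)
  define R where "R k = (\<Sum>Q\<in>dyadic_cubes k. \<bar>rate k Q\<bar>)" for k
  define b where "b = d + (\<Sum>k<N. R k)"
  have R: "R k \<ge> 0" for k unfolding R_def by (intro sum_nonneg) auto
  have d: "d \<ge> 1" by (simp add: d_def)
  have b: "d \<le> b" unfolding b_def using R by (simp add: sum_nonneg)
  \<comment> \<open>The left endpoint is -1 because \<open>tight\<close> uses intervals open on the
    left, while \<open>X_k\<close> may take the value 0.\<close>
  have "1 - e < measure (info_law \<nu> k) {- 1<..b}" for k
  proof -
    interpret L: real_distribution "info_law \<nu> k" by (rule real_distribution_info_law)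
    have "measure (info_law \<nu> k) {b<..} < e"
    proof (cases "k < N")
      case True
      then have "R k \<le> (\<Sum>k<N. R k)" using R by (intro member_le_sum) auto
      then have Rb: "R k \<le> b" unfolding b_def using d by linarith
      have "AE y in info_law \<nu> k. y \<notin> {b<..}"
        unfolding info_law_def using AE_info_rate_bounds[of k] Rb
        by (subst AE_distr_iff) (auto simp: R_def)
      then have "measure (info_law \<nu> k) {b<..} = 0" by (subst L.prob_eq_0) auto
      with e show ?thesis by simp
    next
      case False
      have "measure (info_law \<nu> k) {b<..} \<le> measure (info_law \<nu> k) {d<..}"
        using b by (intro L.finite_measure_mono) auto
      then show ?thesis using N[of k] False by simp
    qed
    moreover have "measure (info_law \<nu> k) {- 1<..b} = measure (info_law \<nu> k) (space (info_law \<nu> k) - {b<..})"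
      using AE_info_law_nonneg[of k] by (intro L.finite_measure_eq_AE) (auto elim!: eventually_mono)
    ultimately show ?thesis by (simp add: L.prob_compl del: L.space_eq_univ)
  qed
  moreover have "- 1 < b" using d b by linarith
  ultimately show "\<exists>a b. a < b \<and> (\<forall>k. 1 - e < measure (info_law \<nu> k) {a<..b})" by blast
qed

text \<open>For the converse, tightness provides subsequential limits. Their exponential moments are
  all given by the limits of \<open>Psi\<close>, so they coincide, and a tight sequence with a
  single subsequential limit converges.\<close>

lemma weak_conv_iff_Psi_convergent:
  "(\<exists>\<rho>. real_distribution \<rho> \<and> weak_conv_m (info_law \<nu>) \<rho>) \<longleftrightarrow>
     (\<forall>\<theta>. convergent (\<lambda>k. Psi \<nu> k \<theta>))"
proof safe
  fix \<rho> \<theta> assume "real_distribution \<rho>" "weak_conv_m (info_law \<nu>) \<rho>"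
  then show "convergent (\<lambda>k. Psi \<nu> k \<theta>)"
    using weak_conv_Psi[of \<rho> "\<lambda>k. k"] by (auto simp: convergent_def strict_mono_def)
next
  assume conv: "\<forall>\<theta>. convergent (\<lambda>k. Psi \<nu> k \<theta>)"
  have lim: "(\<integral>y. exp (t * y) \<partial>M) = exp (lim (\<lambda>k. Psi \<nu> k (- t)))"
    if M: "real_distribution M" "strict_mono s" "weak_conv_m (\<lambda>k. info_law \<nu> (s k)) M" for M s t
  proof -
    have "(\<lambda>k. Psi \<nu> k (- t)) \<longlonglongrightarrow> lim (\<lambda>k. Psi \<nu> k (- t))"
      using conv by (simp add: convergent_LIMSEQ_iff)
    from LIMSEQ_subseq_LIMSEQ[OF this M(2)]
    have "(\<lambda>k. Psi \<nu> (s k) (- t)) \<longlonglongrightarrow> lim (\<lambda>k. Psi \<nu> k (- t))" by (simp add: o_def)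
    moreover have "(\<lambda>k. Psi \<nu> (s k) (- t)) \<longlonglongrightarrow> cgf M (\<lambda>y. y) t"
      using weak_conv_Psi[OF M, of "- t"] by simp
    ultimately have "lim (\<lambda>k. Psi \<nu> k (- t)) = cgf M (\<lambda>y. y) t" by (rule LIMSEQ_unique)
    then show ?thesis
      using bounded_rv.mom_pos[OF weak_conv_info_law_bounded_rv[OF M], of t]
      by (simp add: cgf_def exp_moment_def)
  qed
  obtain r M where r: "strict_mono r" "real_distribution M" "weak_conv_m (\<lambda>k. info_law \<nu> (r k)) M"
    using tight_imp_convergent_subsubsequence[OF tight_info_law, of id] by (auto simp: o_def strict_mono_def)
  have "weak_conv_m (info_law \<nu>) M"
  proof (rule tight_subseq_weak_converge[OF real_distribution_info_law r(2) tight_info_law])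
    fix s N assume N: "strict_mono s" "real_distribution N" "weak_conv_m (info_law \<nu> \<circ> s) N"
    then have N': "weak_conv_m (\<lambda>k. info_law \<nu> (s k)) N" by (simp add: o_def)
    have "N = M"
      using lim[OF N(2,1) N'] lim[OF r(2,1,3)]
      by (intro real_distribution_eqI_exp_moments[OF N(2) r(2)
            weak_conv_info_law_bounded_rv[OF N(2,1) N'] weak_conv_info_law_bounded_rv[OF r(2,1,3)]]) simp
    with N(3) show "weak_conv_m (info_law \<nu> \<circ> s) M" by simp
  qed
  with r(2) show "\<exists>\<rho>. real_distribution \<rho> \<and> weak_conv_m (info_law \<nu>) \<rho>" by blast
qed

section \<open>The limit law and its cumulants\<close>

context
  fixes \<rho> :: "real measure"
  assumes \<rho>: "real_distribution \<rho>" and conv: "weak_conv_m (info_law \<nu>) \<rho>"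
begin

interpretation \<rho>: real_distribution \<rho> by (rule \<rho>)

lemma strict_mono_ident: "strict_mono (\<lambda>k::nat. k)"
  by (simp add: strict_mono_def)

lemma limit_bounded_rv: "bounded_rv \<rho> (\<lambda>y. y) (CARD('d))"
  by (rule weak_conv_info_law_bounded_rv[OF \<rho> strict_mono_ident conv])

interpretation \<rho>: bounded_rv \<rho> "\<lambda>y. y" "CARD('d)"
  by (rule limit_bounded_rv)

lemma limit_carrier: "measure \<rho> {sigma_minus \<nu>..sigma_plus \<nu>} = 1"
proof -
  have "AE y in \<rho>. sigma_minus \<nu> \<le> y \<and> y \<le> sigma_plus \<nu>"
    using weak_conv_carrier[OF real_distribution_info_law \<rho> conv
        tendsto_prob_above_sigma_plus tendsto_prob_below_sigma_minus] by blast
  then have "AE y in \<rho>. y \<in> {sigma_minus \<nu>..sigma_plus \<nu>}" by simp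
  then show ?thesis by (subst \<rho>.prob_eq_1) auto
qed

lemma Psi_tendsto: "(\<lambda>k. Psi \<nu> k \<theta>) \<longlonglongrightarrow> cgf \<rho> (\<lambda>y. y) (- \<theta>)"
  by (rule weak_conv_Psi[OF \<rho> strict_mono_ident conv])

lemma Psi_lim_eq: "Psi_lim \<nu> = (\<lambda>\<theta>. 1 * cgf \<rho> (\<lambda>y. y) (- 1 * \<theta> + 0))"
  using limI[OF Psi_tendsto] by (auto simp: Psi_lim_def)

lemma smooth_Psi_lim: "smooth (Psi_lim \<nu>)"
  unfolding Psi_lim_eq by (rule smooth_affine) (rule \<rho>.smooth_cgf)

lemma funpow_deriv_Psi_lim_0: "(deriv ^^ n) (Psi_lim \<nu>) 0 = (- 1) ^ n * cumulant \<rho> (\<lambda>y. y) n"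
  unfolding Psi_lim_eq funpow_deriv_affine[OF \<rho>.smooth_cgf] by (simp add: cumulant_def)

text \<open>Cumulants are derivatives of \<open>cgf\<close> at 0, and convergence of all tilted
  moments gives \<open>deriv_conv\<close> of every order.\<close>

lemma cumulant_tendsto:
  "(\<lambda>k. cumulant \<nu> (info_rate \<nu> k) n) \<longlonglongrightarrow> cumulant \<rho> (\<lambda>y. y) n"
  unfolding cumulant_def
  by (rule deriv_conv_tendsto, rule deriv_conv_cgf[OF bounded_rv_info_rate limit_bounded_rv])
    (rule weak_conv_exp_moment[OF \<rho> strict_mono_ident conv])

lemma level_entropy_tendsto: "level_entropy \<nu> \<longlonglongrightarrow> (\<integral>y. y \<partial>\<rho>)"
  using cumulant_tendsto[of 1]
  by (simp add: cumulant_def info_rate.deriv_cgf_0 \<rho>.deriv_cgf_0 integral_info_rate)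

lemma variance_tendsto:
  "(\<lambda>k. (deriv ^^ 2) (spectrum \<nu> k) 1 / (real k * ln 2)) \<longlonglongrightarrow> variance_of \<rho> (\<lambda>y. y)"
proof -
  \<comment> \<open>The identity with the spectrum is available from level 1 on; level 0 carries
    default values.\<close>
  have "\<forall>\<^sub>F k in sequentially. cumulant \<nu> (info_rate \<nu> k) 2 = (deriv ^^ 2) (spectrum \<nu> k) 1 / (real k * ln 2)"
    using eventually_ge_at_top[of 1] by eventually_elim (simp add: funpow_deriv_spectrum_1)
  moreover have "cumulant \<rho> (\<lambda>y. y) 2 = variance_of \<rho> (\<lambda>y. y)"
    unfolding cumulant_def by (rule \<rho>.deriv2_cgf_0)
  ultimately show ?thesis using cumulant_tendsto[of 2] by (simp add: tendsto_cong)
qed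

lemma limit_properties:
  "measure \<rho> {sigma_minus \<nu>..sigma_plus \<nu>} = 1 \<and>
        (\<forall>\<theta>. convergent (\<lambda>k. Psi \<nu> k \<theta>) \<and>
             integrable \<rho> (\<lambda>y. exp (- \<theta> * y)) \<and>
             Psi_lim \<nu> \<theta> = ln (\<integral>y. exp (- \<theta> * y) \<partial>\<rho>)) \<and>
        smooth (cgf \<rho> (\<lambda>y. y)) \<and> smooth (Psi_lim \<nu>) \<and>
        (\<forall>n\<ge>1. (\<lambda>k. cumulant \<nu> (info_rate \<nu> k) n) \<longlonglongrightarrow> cumulant \<rho> (\<lambda>y. y) n) \<and>
        convergent (level_entropy \<nu>) \<and>
        integrable \<rho> (\<lambda>y. y) \<and>
        entropy_dim \<nu> = (\<integral>y. y \<partial>\<rho>) \<and>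
        entropy_dim \<nu> = - deriv (Psi_lim \<nu>) 0 \<and>
        integrable \<rho> (\<lambda>y. y\<^sup>2) \<and>
        (\<lambda>k. (deriv ^^ 2) (spectrum \<nu> k) 1 / (real k * ln 2)) \<longlonglongrightarrow> variance_of \<rho> (\<lambda>y. y) \<and>
        variance_of \<rho> (\<lambda>y. y) = (deriv ^^ 2) (Psi_lim \<nu>) 0"
proof (intro conjI allI impI)
  fix \<theta>
  show "convergent (\<lambda>k. Psi \<nu> k \<theta>)" using Psi_tendsto by (auto simp: convergent_def)
  show "integrable \<rho> (\<lambda>y. exp (- \<theta> * y))" by (rule \<rho>.integrable_exp)
  show "Psi_lim \<nu> \<theta> = ln (\<integral>y. exp (- \<theta> * y) \<partial>\<rho>)" by (simp add: Psi_lim_eq cgf_def)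
next
  show "integrable \<rho> (\<lambda>y. y)" using \<rho>.integrable_pow[of 1] by simp
  show "integrable \<rho> (\<lambda>y. y\<^sup>2)" by (rule \<rho>.integrable_pow)
  show "convergent (level_entropy \<nu>)" using level_entropy_tendsto by (auto simp: convergent_def)
  show E: "entropy_dim \<nu> = (\<integral>y. y \<partial>\<rho>)"
    using limI[OF level_entropy_tendsto] by (simp add: entropy_dim_def)
  show "entropy_dim \<nu> = - deriv (Psi_lim \<nu>) 0"
    using funpow_deriv_Psi_lim_0[of 1] \<rho>.deriv_cgf_0 by (simp add: E cumulant_def)
  show "variance_of \<rho> (\<lambda>y. y) = (deriv ^^ 2) (Psi_lim \<nu>) 0"
    using \<rho>.deriv2_cgf_0 by (simp add: funpow_deriv_Psi_lim_0) (simp add: cumulant_def)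
qed (intro limit_carrier \<rho>.smooth_cgf smooth_Psi_lim cumulant_tendsto variance_tendsto)+

end

end

section \<open>Quantization\<close>

text \<open>\<open>ennreal\<close> cuts negative values to 0, so the nonnegative integral controls
  only the positive part; the lower bound on \<open>f\<close> controls the rest.\<close>

lemma (in finite_measure) integral_le_of_nn_integral_le:
  fixes f :: "'a \<Rightarrow> real"
  assumes [measurable]: "f \<in> borel_measurable M" and low: "AE x in M. - b \<le> f x"
    and U: "(\<integral>\<^sup>+x. ennreal (f x) \<partial>M) \<le> ennreal U" "U \<ge> 0"
  shows "integrable M f \<and> integral\<^sup>L M f \<le> U"
proof -
  have pos: "(\<integral>\<^sup>+x. ennreal (max 0 (f x)) \<partial>M) = (\<integral>\<^sup>+x. ennreal (f x) \<partial>M)"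
    by (intro nn_integral_cong) (auto simp: max_def ennreal_neg)
  have int: "integrable M (\<lambda>x. max 0 (f x))"
    by (intro integrableI_nonneg) (use U pos in \<open>auto intro: le_less_trans\<close>)
  have "integrable M f"
  proof (rule Bochner_Integration.integrable_bound)
    show "integrable M (\<lambda>x. max 0 (f x) + \<bar>b\<bar>)" using int by simp
    show "AE x in M. norm (f x) \<le> norm (max 0 (f x) + \<bar>b\<bar>)"
      using low by eventually_elim auto
  qed simp
  moreover have "integral\<^sup>L M f \<le> (\<integral>x. max 0 (f x) \<partial>M)"
    using calculation int by (intro integral_mono) auto
  moreover have "(\<integral>x. max 0 (f x) \<partial>M) \<le> U"
    using U by (subst integral_eq_nn_integral) (auto simp: pos enn2real_leI)
  ultimately show ?thesis by linarith
qed

lemma infnorm_borel [measurable]: "(\<lambda>x :: real ^ 'd. infnorm (x - y)) \<in> borel_measurable borel"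
  by (intro borel_measurable_continuous_onI continuous_on_infnorm continuous_intros)

lemma max_dist_eq_Min:
  assumes "finite A" "A \<noteq> {}"
  shows "max_dist x A = Min ((\<lambda>y. infnorm (x - y)) ` A)"
  unfolding max_dist_def using assms by (intro cInf_eq_Min) auto

lemma borel_measurable_max_dist:
  assumes "finite A" "A \<noteq> {}"
  shows "(\<lambda>x :: real ^ 'd. max_dist x A) \<in> borel_measurable borel"
  unfolding max_dist_eq_Min[OF assms] using assms by measurable

lemma max_dist_nonneg: "finite A \<Longrightarrow> A \<noteq> {} \<Longrightarrow> 0 \<le> max_dist x A"
  by (simp add: max_dist_eq_Min infnorm_pos_le)

lemma max_dist_le: "finite A \<Longrightarrow> y \<in> A \<Longrightarrow> max_dist x A \<le> infnorm (x - y)"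
  by (subst max_dist_eq_Min) auto

lemma max_dist_attained:
  assumes "finite A" "A \<noteq> {}"
  shows "\<exists>y\<in>A. max_dist x A = infnorm (x - y)"
  unfolding max_dist_eq_Min[OF assms] image_iff[symmetric] using assms by (intro Min_in) auto

text \<open>A layer-cake bound: - log \<delta> is at most the number of levels k >= 0 with \<delta>
  < 1 / 2^k. At \<delta> = 0 the default value of \<open>log\<close> makes the left side 0.\<close>

lemma neg_log_le_suminf:
  fixes \<delta> :: real
  assumes "0 \<le> \<delta>"
  shows "ennreal (- log 2 \<delta>) \<le> (\<Sum>k. indicator {d. d < 1 / 2 ^ k} \<delta>)"
proof (cases "0 < \<delta> \<and> \<delta> < 1")
  case False
  then have "- log 2 \<delta> \<le> 0" using assms by (cases "\<delta> = 0") (auto simp: log_def)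
  then show ?thesis by (simp add: ennreal_neg)
next
  case True
  define m where "m = nat \<lceil>- log 2 \<delta>\<rceil>"
  have less: "\<delta> < 1 / 2 ^ k" if "k < m" for k
  proof -
    have "real k < - log 2 \<delta>" using that unfolding m_def by linarith
    then have "log 2 \<delta> < - real k" by simp
    then have "\<delta> < 2 powr (- real k)" using True by (subst (asm) log_less_iff) auto
    then show ?thesis by (simp add: powr_minus powr_realpow divide_inverse)
  qed
  have "ennreal (- log 2 \<delta>) \<le> ennreal (real m)"
    unfolding m_def by (intro ennreal_leI) linarith
  also have "\<dots> = (\<Sum>k<m. indicator {d. d < 1 / 2 ^ k} \<delta>)"
    using less by (simp add: indicator_def ennreal_of_nat_eq_real_of_nat)
  also have "\<dots> \<le> (\<Sum>k. indicator {d. d < 1 / 2 ^ k} \<delta>)"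
    by (intro sum_le_suminf) auto
  finally show ?thesis .
qed

locale dyadic_decay = dyadic_prob \<nu> for \<nu> :: "(real ^ 'd) measure" +
  fixes a C :: real
  assumes a: "a > 0" and C: "C \<ge> 1"
    and decay: "\<And>k Q. Q \<in> dyadic_cubes k \<Longrightarrow> measure \<nu> Q \<le> C * 2 powr (- a * real k)"
begin

section \<open>Consequences of the decay hypothesis\<close>

definition F :: "nat \<Rightarrow> real \<Rightarrow> real" where
  "F k t = measure \<nu> {x. info_rate \<nu> k x \<le> t}"

lemma F_eq_cdf: "F k t = cdf (info_law \<nu> k) t"
  by (simp add: F_def cdf_def measure_info_law)

lemma F_bounds: "0 \<le> F k t" "F k t \<le> 1"
  by (auto simp: F_def)

lemma log_C_nonneg: "log 2 C \<ge> 0"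
  using C by simp

lemma AE_info_rate_ge: "AE x in \<nu>. a * real k - log 2 C \<le> real k * info_rate \<nu> k x"
proof (cases "k = 0")
  case True
  then show ?thesis using log_C_nonneg by simp
next
  case False
  show ?thesis
    using AE_cube_at[of k]
  proof eventually_elim
    case (elim x)
    define p where "p = measure \<nu> (dyadic_cube_at k x)"
    have p: "0 < p" "p \<le> C * 2 powr (- a * real k)" using elim decay by (auto simp: p_def)
    then have "log 2 p \<le> log 2 (C * 2 powr (- a * real k))" using C by (subst log_le_cancel_iff) auto
    also have "\<dots> = log 2 C - a * real k" using C by (subst log_mult) auto
    finally show ?case using False by (simp add: info_rate_def p_def)
  qed
qed

text \<open>Only levels up to \<open>(r + log 2 C) / a\<close> can contribute to a count with budget
  \<open>r\<close>.\<close>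

lemma F_eq_0:
  assumes "k \<ge> 1" "r < a * real k - log 2 C"
  shows "F k (r / real k) = 0"
proof -
  have "AE x in \<nu>. x \<notin> {x. info_rate \<nu> k x \<le> r / real k}"
    using AE_info_rate_ge[of k] by eventually_elim (use assms in \<open>auto simp: field_simps\<close>)
  then show ?thesis unfolding F_def by (subst prob_eq_0) auto
qed

text \<open>The cubes around the point have masses below a geometric sequence tending to 0. This
  makes distances to a finite set positive almost everywhere.\<close>

lemma measure_singleton: "measure \<nu> {x} = 0"
proof (cases "x \<in> cbox 0 1")
  case True
  have "measure \<nu> {x} \<le> C * (2 powr - a) ^ k" for k
  proof -
    obtain Q where Q: "Q \<in> dyadic_cubes k" "x \<in> Q" using dyadic_cubes_cover[OF True] by blast
    then have "measure \<nu> {x} \<le> measure \<nu> Q" by (intro finite_measure_mono) (auto intro: dyadic_cubes_borel)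
    also note decay[OF Q(1)]
    also have "2 powr (- a * real k) = (2 powr - a) ^ k" by (simp add: powr_power mult.commute)
    finally show ?thesis .
  qed
  moreover have "(\<lambda>k. C * (2 powr - a) ^ k) \<longlonglongrightarrow> 0"
    using a by (intro tendsto_mult_right_zero LIMSEQ_realpow_zero) (auto simp: powr_less_one)
  ultimately have "measure \<nu> {x} \<le> 0" by (intro LIMSEQ_le_const) auto
  then show ?thesis by (simp add: measure_le_0_iff)
next
  case False
  have "AE y in \<nu>. y \<notin> {x}" using AE_unit_cube by eventually_elim (use False in auto)
  then show ?thesis by (subst prob_eq_0) auto
qed

lemma AE_not_in_finite: "finite A \<Longrightarrow> AE x in \<nu>. x \<notin> A"
proof -
  assume "finite A"
  then have "AE x in \<nu>. \<forall>y\<in>A. x \<noteq> y"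
  proof (rule AE_finite_allI)
    fix y :: "real ^ 'd"
    have "{y} \<in> null_sets \<nu>" by (simp add: null_sets_def emeasure_eq_measure measure_singleton)
    from AE_not_in[OF this] show "AE x in \<nu>. x \<noteq> y" by simp
  qed
  then show ?thesis by eventually_elim auto
qed

text \<open>The rescaled sum is the integral of the step function \<open>\<phi> N\<close>, whose
  limit at \<open>s > 0\<close> is \<open>cdf \<rho> (1 / s)\<close>. Terms past
  \<open>(r + log 2 C) / a\<close> vanish, so any larger cutoff \<open>K\<close> gives the same
  sum.\<close>

lemma Riemann_sum_tendsto:
  fixes r :: "nat \<Rightarrow> real" and K :: "nat \<Rightarrow> nat"
  assumes \<rho>: "real_distribution \<rho>" and conv: "weak_conv_m (info_law \<nu>) \<rho>"
    and pos: "AE y in \<rho>. 0 < y"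
    and r: "filterlim r at_top sequentially" "\<And>N. r N \<ge> 1"
    and K: "\<And>N. (r N + log 2 C) / a \<le> real (K N)"
  shows "(\<lambda>N. (\<Sum>k=1..K N. F k (r N / real k)) / r N) \<longlonglongrightarrow> (\<integral>y. 1 / y \<partial>\<rho>)"
proof -
  interpret \<rho>: real_distribution \<rho> by fact
  define \<phi> where "\<phi> N s = indicator {0<..} s * F (nat \<lceil>r N * s\<rceil>) (r N / real (nat \<lceil>r N * s\<rceil>))" for N and s :: real
  \<comment> \<open>A support bound common to all \<open>N\<close>: since
    \<open>r N \<ge> 1\<close>, the number \<open>(r N + log 2 C) / a\<close> is at most
    \<open>r N * S\<close>.\<close>
  define S where "S = (1 + log 2 C) / a"
  have \<phi>_supp: "s \<le> S \<and> s \<le> real (K N) / r N" if "\<phi> N s \<noteq> 0" for N s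
  proof -
    define k where "k = nat \<lceil>r N * s\<rceil>"
    have s: "s > 0" using that by (auto simp: \<phi>_def indicator_def split: if_splits)
    then have "r N * s > 0" using r(2)[of N] by simp
    then have k: "k \<ge> 1" "r N * s \<le> real k" unfolding k_def by linarith+
    have "F k (r N / real k) \<noteq> 0" using that by (simp add: \<phi>_def k_def)
    then have "a * real k \<le> r N + log 2 C" using F_eq_0[OF k(1), of "r N"] by force
    then have "real k \<le> (r N + log 2 C) / a" using a by (simp add: field_simps)
    with k(2) K[of N] have 1: "r N * s \<le> (r N + log 2 C) / a" "r N * s \<le> real (K N)" by linarith+
    have "log 2 C * 1 \<le> log 2 C * r N" using r(2)[of N] log_C_nonneg by (intro mult_left_mono) auto
    then have "(r N + log 2 C) / a \<le> (r N + log 2 C * r N) / a"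
      using a by (intro divide_right_mono) auto
    also have "\<dots> = r N * S" by (simp add: S_def algebra_simps)
    finally have "r N * s \<le> r N * S" using 1 by linarith
    then show ?thesis using 1(2) r(2)[of N] by (simp add: field_simps mult_le_cancel_left)
  qed
  have sum_eq: "(\<Sum>k=1..K N. F k (r N / real k)) / r N = (\<integral>s. \<phi> N s \<partial>lborel)" for N
  proof -
    have "indicator {0<..real (K N) / r N} s * F (nat \<lceil>r N * s\<rceil>) (r N / real (nat \<lceil>r N * s\<rceil>)) = \<phi> N s" for s
      using \<phi>_supp[of N s] by (cases "\<phi> N s = 0") (auto simp: \<phi>_def indicator_def split: if_splits)
    then show ?thesis
      using has_bochner_integral_integral_eq[OF has_bochner_integral_ceiling_sum[of "r N" "K N" "\<lambda>k. F k (r N / real k)"]]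
        r(2)[of N] by simp
  qed
  have "(\<lambda>N. \<integral>s. \<phi> N s \<partial>lborel) \<longlonglongrightarrow> (\<integral>s. indicator {0<..} s * cdf \<rho> (1 / s) \<partial>lborel)"
  proof (rule integral_dominated_convergence[where w = "indicator {0..S}"])
    have cdf_meas [measurable]: "cdf \<rho> \<in> borel_measurable borel"
      using \<rho>.cdf_nondecreasing by (intro borel_measurable_mono) (auto simp: mono_def)
    show "(\<lambda>s. indicator {0<..} s * cdf \<rho> (1 / s)) \<in> borel_measurable lborel" by measurable
    show "\<phi> N \<in> borel_measurable lborel" for N
    proof -
      have "(\<lambda>s. (\<lambda>k. F k (r N / real k)) (nat \<lceil>r N * s\<rceil>)) \<in> borel_measurable lborel"
        by measurable
      then show ?thesis unfolding \<phi>_def by simp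
    qed
    show "integrable lborel (indicator {0..S} :: real \<Rightarrow> real)"
      by (intro integrable_real_indicator) (auto simp: emeasure_lborel_Icc_eq)
    show "AE s in lborel. norm (\<phi> N s) \<le> indicator {0..S} s" for N
    proof (rule AE_I2)
      fix s
      show "norm (\<phi> N s) \<le> indicator {0..S} s"
      proof (cases "\<phi> N s = 0")
        case False
        then have "s > 0" by (auto simp: \<phi>_def indicator_def split: if_splits)
        then have "norm (\<phi> N s) \<le> 1" using F_bounds by (simp add: \<phi>_def)
        with \<phi>_supp[OF False] \<open>s > 0\<close> show ?thesis by simp
      qed simp
    qed
    have "countable {t. \<not> isCont (cdf \<rho>) t}"
      using \<rho>.cdf_nondecreasing by (intro mono_ctble_discont) (auto simp: mono_def)
    \<comment> \<open>Convergence can fail only at reciprocals of jumps of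
      \<open>cdf \<rho>\<close>.\<close>
    then have "countable (inverse ` {t. \<not> isCont (cdf \<rho>) t})" by simp
    from AE_not_in[OF countable_imp_null_set_lborel[OF this]]
    show "AE s in lborel. (\<lambda>N. \<phi> N s) \<longlonglongrightarrow> indicator {0<..} s * cdf \<rho> (1 / s)"
    proof eventually_elim
      case (elim s)
      show ?case
      proof (cases "s > 0")
        case True
        have cont: "isCont (cdf \<rho>) (1 / s)"
          using elim by (force simp: inverse_eq_divide image_iff)
        \<comment> \<open>\<open>\<kappa> N\<close> is the level in whose cell \<open>s\<close>
          falls, so \<open>r N / \<kappa> N\<close> tends to \<open>1 / s\<close>.\<close>
        define \<kappa> where "\<kappa> N = nat \<lceil>r N * s\<rceil>" for N
        have rs: "filterlim (\<lambda>N. s * r N) at_top sequentially"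
          by (rule filterlim_tendsto_pos_mult_at_top[OF tendsto_const True r(1)])
        have \<kappa>b: "r N * s \<le> real (\<kappa> N)" "real (\<kappa> N) \<le> r N * s + 1" for N
          using True r(2)[of N] mult_pos_pos[of "r N" s] unfolding \<kappa>_def by linarith+
        have "filterlim (\<lambda>N. real (\<kappa> N)) at_top sequentially"
          by (rule filterlim_at_top_mono[OF rs]) (use \<kappa>b in \<open>auto simp: mult.commute\<close>)
        then have \<kappa>: "filterlim \<kappa> at_top sequentially"
          by (simp add: filterlim_sequentially_iff_filterlim_real)
        have inv0: "(\<lambda>N. inverse (r N)) \<longlonglongrightarrow> 0" by (rule tendsto_inverse_0_at_top[OF r(1)])
        have "(\<lambda>N. real (\<kappa> N) / r N) \<longlonglongrightarrow> s"
        proof (rule tendsto_sandwich[OF always_eventually always_eventually tendsto_const])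
          show "\<forall>N. s \<le> real (\<kappa> N) / r N"
          proof
            fix N show "s \<le> real (\<kappa> N) / r N"
              using \<kappa>b(1)[of N] r(2)[of N] by (subst pos_le_divide_eq) (auto simp: mult.commute)
          qed
          show "\<forall>N. real (\<kappa> N) / r N \<le> s + inverse (r N)"
          proof
            fix N show "real (\<kappa> N) / r N \<le> s + inverse (r N)"
              using \<kappa>b(2)[of N] r(2)[of N] by (subst pos_divide_le_eq) (auto simp: algebra_simps)
          qed
          show "(\<lambda>N. s + inverse (r N)) \<longlonglongrightarrow> s"
            using tendsto_add[OF tendsto_const inv0, of s] by simp
        qed
        from tendsto_inverse[OF this] have "(\<lambda>N. r N / real (\<kappa> N)) \<longlonglongrightarrow> 1 / s"
          using True by (simp add: inverse_eq_divide)
        from weak_conv_cdf_moving[OF real_distribution_info_law \<rho> conv cont \<kappa> this]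
        show ?thesis using True by (simp add: \<phi>_def F_eq_cdf \<kappa>_def)
      qed (simp add: \<phi>_def)
    qed
  qed
  also have "(\<integral>s. indicator {0<..} s * cdf \<rho> (1 / s) \<partial>lborel) = (\<integral>y. 1 / y \<partial>\<rho>)"
  proof (rule integral_eq_of_nn_integral_eq[OF _ _ _ _ \<rho>.nn_integral_inverse_eq_cdf[OF pos]])
    have [measurable]: "cdf \<rho> \<in> borel_measurable borel"
      using \<rho>.cdf_nondecreasing by (intro borel_measurable_mono) (auto simp: mono_def)
    show "(\<lambda>s. indicator {0<..} s * cdf \<rho> (1 / s)) \<in> borel_measurable lborel" by measurable
    show "AE y in \<rho>. 0 \<le> 1 / y" using pos by eventually_elim simp
  qed (auto simp: \<rho>.cdf_nonneg)
  finally show ?thesis unfolding sum_eq .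
qed

lemma sum_measure_cubes: "(\<Sum>Q\<in>dyadic_cubes k. measure \<nu> Q) = 1"
  using integral_cube_at(2)[of "\<lambda>_. 1" k] by simp

lemma sets_cube_at_in [measurable]:
  fixes B :: "(real ^ 'd) set set"
  shows "{x. dyadic_cube_at k x \<in> B} \<in> sets borel"
proof -
  have "(\<lambda>x. indicator B (dyadic_cube_at k x) :: real) -` {1} \<inter> space borel \<in> sets borel"
    using borel_measurable_cube_at[of "indicator B" k] by (rule measurable_sets) simp
  moreover have "(\<lambda>x. indicator B (dyadic_cube_at k x) :: real) -` {1} \<inter> space borel = {x. dyadic_cube_at k x \<in> B}"
    by (auto simp: indicator_def)
  ultimately show ?thesis by simp
qed

lemma prob_cube_at_in:
  assumes "B \<subseteq> dyadic_cubes k"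
  shows "measure \<nu> {x. dyadic_cube_at k x \<in> B} = (\<Sum>Q\<in>B. measure \<nu> Q)"
proof -
  have "measure \<nu> {x. dyadic_cube_at k x \<in> B} = (\<integral>x. indicator {x. dyadic_cube_at k x \<in> B} x \<partial>\<nu>)"
    by simp
  also have "\<dots> = (\<integral>x. indicator B (dyadic_cube_at k x) \<partial>\<nu>)"
    by (intro Bochner_Integration.integral_cong) (auto simp: indicator_def)
  also have "\<dots> = (\<Sum>Q\<in>dyadic_cubes k. measure \<nu> Q * indicator B Q)" by (rule integral_cube_at(2))
  also have "\<dots> = (\<Sum>Q\<in>B. measure \<nu> Q)"
    using assms by (intro sum.mono_neutral_cong_right) auto
  finally show ?thesis .
qed

section \<open>Cubes near finitely many points\<close>

definition nearby :: "nat \<Rightarrow> (real ^ 'd) set \<Rightarrow> (real ^ 'd) set set" where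
  "nearby k A = (\<Union>y\<in>A. cubes_near k y)"

lemma nearby_subset: "nearby k A \<subseteq> dyadic_cubes k"
  by (auto simp: nearby_def cubes_near_def)

lemma card_nearby_le:
  assumes "finite A"
  shows "card (nearby k A) \<le> card A * 3 ^ CARD('d)"
proof -
  have "card (nearby k A) \<le> (\<Sum>y\<in>A. card (cubes_near k y))"
    unfolding nearby_def using assms by (rule card_UN_le)
  also have "\<dots> \<le> card A * 3 ^ CARD('d)"
    using sum_bounded_above[of A "\<lambda>y. card (cubes_near k y)" "3 ^ CARD('d)"] card_cubes_near_le by auto
  finally show ?thesis .
qed

lemma prob_max_dist_less:
  assumes "finite A" "A \<noteq> {}"
  shows "measure \<nu> {x. max_dist x A < 1 / 2 ^ k} \<le> measure \<nu> {x. dyadic_cube_at k x \<in> nearby k A}"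
proof (rule finite_measure_mono_AE)
  show "AE x in \<nu>. x \<in> {x. max_dist x A < 1 / 2 ^ k} \<longrightarrow> x \<in> {x. dyadic_cube_at k x \<in> nearby k A}"
    using AE_cube_at[of k]
  proof eventually_elim
    case (elim x)
    show ?case
    proof
      assume "x \<in> {x. max_dist x A < 1 / 2 ^ k}"
      then obtain y where "y \<in> A" "infnorm (x - y) < 1 / 2 ^ k"
        using max_dist_attained[OF assms, of x] by auto
      then have "dyadic_cube_at k x \<in> cubes_near k y" using elim by (auto simp: cubes_near_def)
      with \<open>y \<in> A\<close> show "x \<in> {x. dyadic_cube_at k x \<in> nearby k A}" by (auto simp: nearby_def)
    qed
  qed
qed simp

lemma prob_nearby_le_decay:
  assumes "finite A" "card A \<le> N"
  shows "measure \<nu> {x. dyadic_cube_at k x \<in> nearby k A} \<le> real N * 3 ^ CARD('d) * C * 2 powr (- a * real k)"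
proof -
  have "measure \<nu> {x. dyadic_cube_at k x \<in> nearby k A} = (\<Sum>Q\<in>nearby k A. measure \<nu> Q)"
    by (rule prob_cube_at_in[OF nearby_subset])
  also have "\<dots> \<le> real (card (nearby k A)) * (C * 2 powr (- a * real k))"
    using nearby_subset decay by (intro sum_bounded_above) blast
  also have "\<dots> \<le> real (N * 3 ^ CARD('d)) * (C * 2 powr (- a * real k))"
  proof (rule mult_right_mono)
    have "card (nearby k A) \<le> card A * 3 ^ CARD('d)" by (rule card_nearby_le[OF assms(1)])
    also have "\<dots> \<le> N * 3 ^ CARD('d)" using assms(2) by simp
    finally show "real (card (nearby k A)) \<le> real (N * 3 ^ CARD('d))" by (rule of_nat_mono)
  qed (use C in auto)
  finally show ?thesis by (simp add: mult_ac)
qed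

text \<open>A cube of mass at least \<open>2 powr - r\<close> lies in the event X_k <= r / k. Each
  lighter one has mass below \<open>2 powr - r\<close>, and their number is controlled by
  \<open>card_nearby_le\<close>.\<close>

lemma prob_nearby_le_F:
  assumes "finite A" "card A \<le> N" "k \<ge> 1"
  shows "measure \<nu> {x. dyadic_cube_at k x \<in> nearby k A}
    \<le> F k (r / real k) + real N * 3 ^ CARD('d) * 2 powr (- r)"
proof -
  define B where "B = {Q \<in> nearby k A. measure \<nu> Q < 2 powr (- r)}"
  have B: "B \<subseteq> dyadic_cubes k" "B \<subseteq> nearby k A" using nearby_subset by (auto simp: B_def)
  have fin: "finite (nearby k A)" using nearby_subset finite_dyadic_cubes by (rule finite_subset)
  have "measure \<nu> {x. dyadic_cube_at k x \<in> nearby k A}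
      \<le> measure \<nu> ({x. info_rate \<nu> k x \<le> r / real k} \<union> {x. dyadic_cube_at k x \<in> B})"
  proof (intro finite_measure_mono subsetI)
    fix x assume x: "x \<in> {x. dyadic_cube_at k x \<in> nearby k A}"
    show "x \<in> {x. info_rate \<nu> k x \<le> r / real k} \<union> {x. dyadic_cube_at k x \<in> B}"
    proof (cases "dyadic_cube_at k x \<in> B")
      case False
      define p where "p = measure \<nu> (dyadic_cube_at k x)"
      have p: "2 powr (- r) \<le> p" using x False by (auto simp: B_def p_def)
      have "0 < p" using p powr_gt_zero[of 2 "- r"] by linarith
      with p have "- r \<le> log 2 p" by (simp add: le_log_iff)
      then have "info_rate \<nu> k x \<le> r / real k"
        using assms(3) by (simp add: info_rate_def p_def[symmetric] divide_right_mono field_simps)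
      then show ?thesis by simp
    qed simp
  qed simp
  also have "\<dots> \<le> F k (r / real k) + measure \<nu> {x. dyadic_cube_at k x \<in> B}"
    unfolding F_def by (intro measure_Un_le) auto
  also have "measure \<nu> {x. dyadic_cube_at k x \<in> B} = (\<Sum>Q\<in>B. measure \<nu> Q)"
    by (rule prob_cube_at_in[OF B(1)])
  also have "\<dots> \<le> real (card B) * 2 powr (- r)"
    by (intro sum_bounded_above) (simp add: B_def less_imp_le)
  also have "\<dots> \<le> real (N * 3 ^ CARD('d)) * 2 powr (- r)"
  proof (rule mult_right_mono)
    have "card B \<le> card (nearby k A)" using fin B(2) by (rule card_mono)
    also have "\<dots> \<le> card A * 3 ^ CARD('d)" by (rule card_nearby_le[OF assms(1)])
    also have "\<dots> \<le> N * 3 ^ CARD('d)" using assms(2) by simp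
    finally show "real (card B) \<le> real (N * 3 ^ CARD('d))" by (rule of_nat_mono)
  qed simp
  finally show ?thesis by simp
qed

definition tail_const :: real where
  "tail_const = 3 ^ CARD('d) * C / (1 - 2 powr - a)"

text \<open>\<open>2 powr \<psi> n = 3\<^sup>d N (n / a + 2)\<close> for \<open>n = log N\<close>: of the at most \<open>3\<^sup>d N\<close> cubes near \<open>N\<close> points, those of
  mass below \<open>2 powr - \<psi> n\<close> carry total mass at most 1 over the first \<open>n / a + 1\<close> levels; deeper levels
  contribute at most \<open>tail_const\<close> by the decay hypothesis.\<close>

definition \<psi> :: "real \<Rightarrow> real" where
  "\<psi> x = x + CARD('d) * log 2 3 + log 2 (x / a + 2)"

lemma powr_a: "0 < 2 powr - a" "2 powr - a < 1"
  using a by (auto simp: powr_less_one)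

text \<open>The constant 2 collects level 0, whose probability is bounded by 1, and the light cubes
  of levels 1 to \<open>K\<close>; deeper levels account for \<open>tail_const\<close>.\<close>

lemma quant_upper:
  assumes A: "finite A" "A \<noteq> {}" "card A \<le> N" and N: "N \<ge> 1"
    and K: "log 2 N / a \<le> real K" "real K \<le> log 2 N / a + 1"
  shows "integrable \<nu> (\<lambda>x. - log 2 (max_dist x A)) \<and>
    (\<integral>x. - log 2 (max_dist x A) \<partial>\<nu>) \<le> (\<Sum>k=1..K. F k (\<psi> (log 2 N) / real k)) + (2 + tail_const)"
proof -
  obtain y where y: "y \<in> A" using A(2) by blast
  show ?thesis
  proof (rule integral_le_of_nn_integral_le[where b = "log 2 (1 + infnorm y)"])
    define p where "p k = measure \<nu> {x. max_dist x A < 1 / 2 ^ k}" for k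
    define r where "r = \<psi> (log 2 N)"
    have p0: "0 \<le> p k" "p k \<le> 1" for k by (auto simp: p_def)
    have [measurable]: "(\<lambda>x. max_dist x A) \<in> borel_measurable borel"
      by (rule borel_measurable_max_dist[OF A(1,2)])
    show "(\<lambda>x. - log 2 (max_dist x A)) \<in> borel_measurable \<nu>" by measurable
    have p_decay: "p k \<le> real N * 3 ^ CARD('d) * C * (2 powr - a) ^ k" for k
      using prob_max_dist_less[OF A(1,2), of k] prob_nearby_le_decay[OF A(1,3), of k]
      by (simp add: p_def powr_power mult.commute)
    have summ_geo: "summable (\<lambda>k. real N * 3 ^ CARD('d) * C * (2 powr - a) ^ k)"
      using powr_a by (intro summable_mult summable_geometric) auto
    have summ: "summable p"
      by (rule summable_comparison_test_ev[OF _ summ_geo]) (use p0 p_decay in auto)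
    have "(\<Sum>k. p (k + Suc K)) \<le> (\<Sum>k. real N * 3 ^ CARD('d) * C * (2 powr - a) ^ (k + Suc K))"
      using summ summ_geo p_decay by (intro suminf_le summable_ignore_initial_segment) 
    also have "\<dots> = (\<Sum>k. real N * 3 ^ CARD('d) * C * (2 powr - a) ^ Suc K * (2 powr - a) ^ k)"
      by (simp add: power_add mult_ac)
    also have "\<dots> = real N * 3 ^ CARD('d) * C * (2 powr - a) ^ Suc K * (1 / (1 - 2 powr - a))"
      using powr_a by (subst suminf_mult) (auto simp: suminf_geometric intro: summable_geometric)
    also have "\<dots> = (real N * (2 powr - a) ^ Suc K) * tail_const"
      by (simp add: tail_const_def)
    also have "\<dots> \<le> 1 * tail_const"
    \<comment> \<open>The cutoff \<open>K \<ge> log 2 N / a\<close> makes N times 2 to the power - a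
      K at most 1, so the tail bound is free of \<open>N\<close>.\<close>
    proof (rule mult_right_mono)
      have "(2 powr - a) ^ Suc K \<le> (2 powr - a) ^ K" using powr_a by (intro power_decreasing) auto
      also have "\<dots> = 2 powr (- (a * real K))" by (simp add: powr_power mult.commute)
      also have "\<dots> \<le> 2 powr (- log 2 N)" using K(1) a by (simp add: field_simps)
      also have "\<dots> = 1 / real N" using N by (simp add: powr_minus divide_inverse)
      finally show "real N * (2 powr - a) ^ Suc K \<le> 1" using N by (simp add: field_simps)
      show "0 \<le> tail_const" unfolding tail_const_def using C powr_a by (intro divide_nonneg_pos) auto
    qed
    finally have tail: "(\<Sum>k. p (k + Suc K)) \<le> tail_const" by simp
    \<comment> \<open>Here \<open>\<psi>\<close> does its work: light cubes cost at most 1 / (K + 1)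
      per level, hence at most 1 over the \<open>K\<close> levels.\<close>
    have small: "real N * 3 ^ CARD('d) * 2 powr (- r) \<le> 1 / (real K + 1)"
    proof -
      have lN: "0 \<le> log 2 N" using N by simp
      have x: "log 2 N / a + 2 > 0" using lN a by (simp add: add_nonneg_pos)
      have 3: "2 powr (CARD('d) * log 2 3) = 3 ^ CARD('d)"
        using powr_powr[of 2 "log 2 3" "CARD('d)"] by (simp add: mult.commute powr_realpow)
      have r: "2 powr r = real N * 3 ^ CARD('d) * (log 2 N / a + 2)"
        unfolding r_def \<psi>_def powr_add 3 using N x by simp
      have inv: "w * inverse (w * z) = 1 / z" if "w \<noteq> 0" for w z :: real
        using that by (simp add: divide_inverse)
      have "real N * 3 ^ CARD('d) * 2 powr (- r) = 1 / (log 2 N / a + 2)"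
        unfolding powr_minus r using N by (intro inv) simp
      also have "\<dots> \<le> 1 / (real K + 1)" using K(2) x by (intro divide_left_mono) auto
      finally show ?thesis .
    qed
    have "(\<Sum>k<Suc K. p k) = p 0 + (\<Sum>k=1..K. p k)"
      by (subst sum.lessThan_Suc_shift) (simp add: sum.atLeast1_atMost_eq)
    also have "\<dots> \<le> 1 + (\<Sum>k=1..K. F k (r / real k) + 1 / (real K + 1))"
    proof (intro add_mono p0(2) sum_mono)
      fix k assume "k \<in> {1..K}"
      then show "p k \<le> F k (r / real k) + 1 / (real K + 1)"
        using prob_max_dist_less[OF A(1,2), of k] prob_nearby_le_F[OF A(1,3), of k r] small
        by (auto simp: p_def)
    qed
    also have "\<dots> \<le> 1 + (\<Sum>k=1..K. F k (r / real k)) + 1"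
      by (simp add: sum.distrib)
    finally have "(\<Sum>k. p k) \<le> (\<Sum>k=1..K. F k (r / real k)) + (2 + tail_const)"
      using suminf_split_initial_segment[OF summ, of "Suc K"] tail by linarith
    then have U: "suminf p \<le> (\<Sum>k=1..K. F k (\<psi> (log 2 N) / real k)) + (2 + tail_const)"
      by (simp add: r_def)
    show "0 \<le> (\<Sum>k=1..K. F k (\<psi> (log 2 N) / real k)) + (2 + tail_const)"
      using suminf_nonneg[OF summ p0(1)] U by linarith
    have "(\<integral>\<^sup>+x. ennreal (- log 2 (max_dist x A)) \<partial>\<nu>) \<le>
        (\<integral>\<^sup>+x. (\<Sum>k. indicator {d. d < 1 / 2 ^ k} (max_dist x A)) \<partial>\<nu>)"
      using max_dist_nonneg[OF A(1,2)] by (intro nn_integral_mono neg_log_le_suminf)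
    also have "\<dots> = (\<integral>\<^sup>+x. (\<Sum>k. indicator {x. max_dist x A < 1 / 2 ^ k} x) \<partial>\<nu>)"
      by (intro nn_integral_cong arg_cong[where f = suminf] ext) (simp add: indicator_def)
    also have "\<dots> = (\<Sum>k. \<integral>\<^sup>+x. indicator {x. max_dist x A < 1 / 2 ^ k} x \<partial>\<nu>)"
      by (rule nn_integral_suminf) simp
    also have "\<dots> = (\<Sum>k. ennreal (p k))"
      by (simp add: p_def emeasure_eq_measure)
    also have "\<dots> = ennreal (suminf p)" by (rule suminf_ennreal2[OF p0(1) summ])
    also have "\<dots> \<le> ennreal ((\<Sum>k=1..K. F k (\<psi> (log 2 N) / real k)) + (2 + tail_const))"
      using U by (rule ennreal_leI)
    finally show "(\<integral>\<^sup>+x. ennreal (- log 2 (max_dist x A)) \<partial>\<nu>) \<le>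
        ennreal ((\<Sum>k=1..K. F k (\<psi> (log 2 N) / real k)) + (2 + tail_const))" .
    \<comment> \<open>Points of the unit cube stay within \<open>1 + infnorm y\<close> of
      \<open>A\<close>, which bounds the negative part of the integrand.\<close>
    show "AE x in \<nu>. - log 2 (1 + infnorm y) \<le> - log 2 (max_dist x A)"
      using AE_unit_cube
    proof eventually_elim
      case (elim x)
      have "infnorm x \<le> 1" using elim by (auto simp: infnorm_le_iff_cart mem_box_cart abs_le_iff intro: order_trans[of _ 0])
      then have "infnorm (x - y) \<le> 1 + infnorm y"
        using infnorm_triangle[of x "- y"] by (simp add: infnorm_neg)
      then have d: "max_dist x A \<le> 1 + infnorm y" using max_dist_le[OF A(1) y, of x] by linarith
      show ?case
      proof (cases "max_dist x A = 0")
        case True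
        then show ?thesis using infnorm_pos_le[of y] by (simp add: log_def)
      next
        case False
        then have "0 < max_dist x A" using max_dist_nonneg[OF A(1,2), of x] by simp
        with d show ?thesis by simp
      qed
    qed
  qed
qed

section \<open>A configuration with one point in each heavy cube\<close>

lemma card_heavy_cubes:
  assumes "\<tau> > 0"
  shows "real (card {Q \<in> dyadic_cubes k. \<tau> \<le> measure \<nu> Q}) * \<tau> \<le> 1"
proof -
  have "real (card {Q \<in> dyadic_cubes k. \<tau> \<le> measure \<nu> Q}) * \<tau> \<le> (\<Sum>Q\<in>{Q \<in> dyadic_cubes k. \<tau> \<le> measure \<nu> Q}. measure \<nu> Q)"
    by (intro sum_bounded_below) simp
  also have "\<dots> \<le> (\<Sum>Q\<in>dyadic_cubes k. measure \<nu> Q)" by (intro sum_mono2) auto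
  finally show ?thesis by (simp add: sum_measure_cubes)
qed

text \<open>Each of the K + 1 levels has at most \<open>2 powr m\<close> cubes of mass at least
  \<open>2 powr - m\<close>. The integral bound is conditional because \<open>quant_upper\<close>
  supplies integrability later.\<close>

lemma quant_lower:
  assumes m: "m \<ge> 0" and N: "(real K + 1) * 2 powr m \<le> real N"
  shows "\<exists>A. finite A \<and> A \<noteq> {} \<and> card A \<le> N \<and>
    (integrable \<nu> (\<lambda>x. - log 2 (max_dist x A)) \<longrightarrow>
      (\<Sum>k=1..K. F k (m / real k)) \<le> (\<integral>x. - log 2 (max_dist x A) \<partial>\<nu>))"
proof -
  define \<tau> where "\<tau> = 2 powr (- m)"
  have \<tau>: "0 < \<tau>" "\<tau> \<le> 1"
    using m powr_mono[of "- m" 0 2] by (auto simp: \<tau>_def)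
  define H where "H k = {Q \<in> dyadic_cubes k. \<tau> \<le> measure \<nu> Q}" for k
  define c :: "(real ^ 'd) set \<Rightarrow> real ^ 'd" where "c Q = (SOME x. x \<in> Q)" for Q
  have c: "c Q \<in> Q" if "Q \<in> H k" for Q k
  proof -
    have "Q \<noteq> {}" using that \<tau> by (auto simp: H_def)
    then show ?thesis unfolding c_def by (simp add: some_in_eq)
  qed
  define A where "A = (\<Union>k\<le>K. c ` H k)"
  have finH: "finite (H k)" for k by (simp add: H_def)
  have finA: "finite A" by (simp add: A_def finH)
  \<comment> \<open>The unit cube has mass 1 and is heavy because \<open>m \<ge> 0\<close>; it keeps
    \<open>A\<close>, and below the set \<open>T\<close> of heavy levels, nonempty.\<close>
  have unit: "measure \<nu> Q = 1" if "Q \<in> dyadic_cubes 0" for Q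
  proof -
    have "AE x in \<nu>. x \<in> Q"
      using AE_cube_at[of 0]
    proof eventually_elim
      case (elim x)
      have "{m :: 'd \<Rightarrow> nat. \<forall>i. m i < 2 ^ 0} = {\<lambda>_. 0}" by (auto simp: fun_eq_iff)
      then have "dyadic_cubes 0 = {dyadic_cube 0 (\<lambda>_. 0) :: (real ^ 'd) set}"
        by (simp add: dyadic_cubes_eq)
      then have "dyadic_cube_at 0 x = Q" using elim that by simp
      with elim show ?case by simp
    qed
    then show ?thesis using that by (subst prob_eq_1) (auto intro: dyadic_cubes_borel)
  qed
  have neA: "A \<noteq> {}"
  proof -
    have x: "0 \<in> cbox 0 (1 :: real ^ 'd)" by (simp add: mem_box_cart)
    obtain Q :: "(real ^ 'd) set" where Q: "Q \<in> dyadic_cubes 0"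
      using x by (rule dyadic_cubes_cover)
    have "Q \<in> H 0" unfolding H_def using Q unit[OF Q] \<tau>(2) by simp
    then have "c Q \<in> A" unfolding A_def by blast
    then show ?thesis by blast
  qed
  have "real (card A) \<le> real (\<Sum>k\<le>K. card (c ` H k))"
    unfolding A_def by (intro of_nat_mono card_UN_le) simp
  also have "\<dots> \<le> (\<Sum>k\<le>K. 2 powr m)"
    unfolding of_nat_sum
  proof (rule sum_mono)
    fix k
    have "real (card (c ` H k)) \<le> real (card (H k))" by (intro of_nat_mono card_image_le finH)
    also have "\<dots> \<le> 1 / \<tau>" using card_heavy_cubes[OF \<tau>(1), of k] \<tau>(1) by (simp add: H_def field_simps)
    also have "\<dots> = 2 powr m" by (simp add: \<tau>_def powr_minus divide_inverse)
    finally show "real (card (c ` H k)) \<le> 2 powr m" .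
  qed
  also have "\<dots> = (real K + 1) * 2 powr m" by simp
  also note N
  finally have cardA: "card A \<le> N" by simp
  have AE: "AE x in \<nu>. (\<Sum>k=1..K. indicator {x. info_rate \<nu> k x \<le> m / real k} x) \<le> - log 2 (max_dist x A)"
  proof -
    have "AE x in \<nu>. \<forall>k. dyadic_cube_at k x \<in> dyadic_cubes k \<and> x \<in> dyadic_cube_at k x
        \<and> measure \<nu> (dyadic_cube_at k x) > 0"
      unfolding AE_all_countable using AE_cube_at by blast
    with AE_not_in_finite[OF finA] show ?thesis
    proof eventually_elim
      case (elim x)
      define T where "T = {k \<in> {0..K}. \<tau> \<le> measure \<nu> (dyadic_cube_at k x)}"
      have T: "finite T" "0 \<in> T" using elim(2) unit \<tau> by (auto simp: T_def)
      \<comment> \<open>\<open>j\<close> is the deepest heavy level of \<open>x\<close>. The point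
        chosen in that cube is within 1 / 2^j, and each level counted on the left is heavy, hence at
        most \<open>j\<close>.\<close>
      define j where "j = Max T"
      have j: "j \<in> T" unfolding j_def using T by (intro Max_in) auto
      have "dyadic_cube_at j x \<in> H j" "j \<le> K" using j elim(2) by (auto simp: T_def H_def)
      then have "c (dyadic_cube_at j x) \<in> A" "c (dyadic_cube_at j x) \<in> dyadic_cube_at j x"
        using c by (auto simp: A_def)
      then have "max_dist x A \<le> 1 / 2 ^ j"
        using max_dist_le[OF finA] elim(2) dyadic_cube_diameter order_trans by blast
      moreover have d0: "0 < max_dist x A"
        using max_dist_attained[OF finA neA, of x] elim(1) by (auto simp: infnorm_pos_lt)
      ultimately have "log 2 (max_dist x A) \<le> log 2 (1 / 2 ^ j)" by (subst log_le_cancel_iff) auto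
      then have jd: "real j \<le> - log 2 (max_dist x A)"
        by (simp add: log_divide log_nat_power)
      have "(\<Sum>k=1..K. indicator {x. info_rate \<nu> k x \<le> m / real k} x) \<le> (\<Sum>k=1..K. indicator {1..j} k :: real)"
      proof (rule sum_mono)
        fix k assume k: "k \<in> {1..K}"
        show "indicator {x. info_rate \<nu> k x \<le> m / real k} x \<le> (indicator {1..j} k :: real)"
        proof (cases "info_rate \<nu> k x \<le> m / real k")
          case True
          define p where "p = measure \<nu> (dyadic_cube_at k x)"
          have p: "p > 0" using elim(2) by (simp add: p_def)
          have "- m \<le> log 2 p" using True k by (simp add: info_rate_def p_def[symmetric] field_simps)
          then have "\<tau> \<le> p" using p by (simp add: \<tau>_def le_log_iff)
          then have "k \<in> T" using k by (simp add: T_def p_def)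
          then have "k \<le> j" unfolding j_def using T by (intro Max_ge) auto
          then show ?thesis using k by simp
        qed simp
      qed
      also have "\<dots> = (\<Sum>k\<in>{1..K} \<inter> {1..j}. 1)"
        by (simp only: sum.inter_restrict[OF finite_atLeastAtMost] indicator_def of_bool_def)
      also have "\<dots> = real (card ({1..K} \<inter> {1..j}))" by simp
      also have "\<dots> \<le> real (card {1..j})" by (intro of_nat_mono card_mono) auto
      also have "\<dots> \<le> - log 2 (max_dist x A)" using jd by simp
      finally show ?case .
    qed
  qed
  have int_ind: "integrable \<nu> (indicator {x. info_rate \<nu> k x \<le> m / real k} :: _ \<Rightarrow> real)" for k
    by (intro integrable_real_indicator) (auto simp: emeasure_eq_measure)
  have "(\<Sum>k=1..K. F k (m / real k)) \<le> (\<integral>x. - log 2 (max_dist x A) \<partial>\<nu>)"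
    if "integrable \<nu> (\<lambda>x. - log 2 (max_dist x A))"
  proof -
    have "(\<Sum>k=1..K. F k (m / real k)) = (\<integral>x. (\<Sum>k=1..K. indicator {x. info_rate \<nu> k x \<le> m / real k} x) \<partial>\<nu>)"
      using int_ind by (subst Bochner_Integration.integral_sum) (auto simp: F_def)
    also have "\<dots> \<le> (\<integral>x. - log 2 (max_dist x A) \<partial>\<nu>)"
      using AE that int_ind by (intro integral_mono_AE Bochner_Integration.integrable_sum) auto
    finally show ?thesis .
  qed
  then show ?thesis using finA neA cardA by blast
qed

end

section \<open>Logarithmic corrections and the quantization dimension\<close>

lemma log_correction_upper:
  fixes a c :: real
  assumes "a > 0"
  shows "((\<lambda>x. (x + c + log 2 (x / a + 2)) / x) \<longlongrightarrow> 1) at_top"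
  unfolding log_def using assms by real_asymp

text \<open>With c = log C the argument of the logarithm dominates the number of levels used by the
  configuration of heavy cubes.\<close>

lemma log_correction_lower:
  fixes a c :: real
  assumes "a > 0"
  shows "((\<lambda>x. (x - log 2 ((x + c) / a + 2)) / x) \<longlongrightarrow> 1) at_top"
    and "filterlim (\<lambda>x. x - log 2 ((x + c) / a + 2)) at_top at_top"
  unfolding log_def using assms by real_asymp+

lemma log_nat_at_top: "filterlim (\<lambda>N::nat. log 2 (real N)) at_top sequentially"
  unfolding log_def by real_asymp

context dyadic_decay
begin

text \<open>A change to base 2; constant factors leave the Bochner integral whether or not the
  integrand is integrable.\<close>

lemma quant_error0_eq:
  "quant_error0 \<nu> N = (INF A\<in>{A. finite A \<and> 1 \<le> card A \<and> card A \<le> N}.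
     2 powr (- (\<integral>x. - log 2 (max_dist x A) \<partial>\<nu>)))"
proof -
  have "exp (\<integral>x. ln (max_dist x A) \<partial>\<nu>) = 2 powr (- (\<integral>x. - log 2 (max_dist x A) \<partial>\<nu>))" for A :: "(real ^ 'd) set"
  proof -
    have "(\<integral>x. ln (max_dist x A) \<partial>\<nu>) = (\<integral>x. - ln 2 * (- log 2 (max_dist x A)) \<partial>\<nu>)"
      by (simp add: log_def)
    also have "\<dots> = - ln 2 * (\<integral>x. - log 2 (max_dist x A) \<partial>\<nu>)"
      by (rule integral_mult_right_zero)
    finally show ?thesis by (simp only: powr_def) (simp add: mult.commute)
  qed
  then show ?thesis by (simp add: quant_error0_def)
qed

text \<open>Positivity is part of the conclusion because \<open>log\<close> at 0 would be a default
  value.\<close>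

lemma quant_error0_upper:
  assumes "N \<ge> 1"
    and U: "\<And>A. finite A \<Longrightarrow> A \<noteq> {} \<Longrightarrow> card A \<le> N \<Longrightarrow> (\<integral>x. - log 2 (max_dist x A) \<partial>\<nu>) \<le> U"
  shows "quant_error0 \<nu> N > 0 \<and> - log 2 (quant_error0 \<nu> N) \<le> U"
proof -
  have "{0 :: real ^ 'd} \<in> {A. finite A \<and> 1 \<le> card A \<and> card A \<le> N}" using assms by simp
  moreover have "2 powr (- U) \<le> 2 powr (- (\<integral>x. - log 2 (max_dist x A) \<partial>\<nu>))"
    if "A \<in> {A. finite A \<and> 1 \<le> card A \<and> card A \<le> N}" for A
  proof -
    have "A \<noteq> {}" using that by auto
    with that have "(\<integral>x. - log 2 (max_dist x A) \<partial>\<nu>) \<le> U" by (intro U) auto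
    then show ?thesis by (intro powr_mono) linarith+
  qed
  ultimately have "2 powr (- U) \<le> quant_error0 \<nu> N"
    unfolding quant_error0_eq by (intro cINF_greatest) blast+
  moreover from this have "0 < quant_error0 \<nu> N" by (rule less_le_trans[rotated]) simp
  ultimately have "0 < quant_error0 \<nu> N" "log 2 (2 powr (- U)) \<le> log 2 (quant_error0 \<nu> N)"
    by (simp, subst log_le_cancel_iff) auto
  then show ?thesis by simp
qed

lemma quant_error0_lower:
  assumes "finite A" "A \<noteq> {}" "card A \<le> N" "G \<le> (\<integral>x. - log 2 (max_dist x A) \<partial>\<nu>)"
    and "quant_error0 \<nu> N > 0"
  shows "G \<le> - log 2 (quant_error0 \<nu> N)"
proof -
  have "quant_error0 \<nu> N \<le> 2 powr (- (\<integral>x. - log 2 (max_dist x A) \<partial>\<nu>))"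
    unfolding quant_error0_eq using assms
    by (intro cINF_lower bdd_belowI2[where m = 0]) (auto simp: card_gt_0_iff Suc_le_eq)
  also have "\<dots> \<le> 2 powr (- G)" using assms(4) by simp
  finally have "log 2 (quant_error0 \<nu> N) \<le> log 2 (2 powr (- G))" using assms(5) by (subst log_le_cancel_iff) auto
  then show ?thesis by simp
qed

lemma quant_error0_le_sum:
  assumes "N \<ge> 1" "log 2 N / a \<le> real K" "real K \<le> log 2 N / a + 1"
  shows "quant_error0 \<nu> N > 0 \<and>
    - log 2 (quant_error0 \<nu> N) \<le> (\<Sum>k=1..K. F k (\<psi> (log 2 N) / real k)) + (2 + tail_const)"
  by (rule quant_error0_upper[OF assms(1)]) (use quant_upper[OF _ _ _ assms] in blast)

lemma nat_ceiling_bounds: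
  fixes x :: real assumes "x \<ge> 0"
  shows "x \<le> real (nat \<lceil>x\<rceil>)" "real (nat \<lceil>x\<rceil>) \<le> x + 1"
  using assms by linarith+

text \<open>\<open>quant_upper\<close>, with its own cutoff \<open>K'\<close>, discharges the
  integrability condition in \<open>quant_lower\<close>.\<close>

lemma quant_error0_ge_sum:
  assumes "N \<ge> 1" "m \<ge> 0" "(real K + 1) * 2 powr m \<le> real N"
  shows "(\<Sum>k=1..K. F k (m / real k)) \<le> - log 2 (quant_error0 \<nu> N)"
proof -
  define K' where "K' = nat \<lceil>log 2 N / a\<rceil>"
  have K': "log 2 N / a \<le> real K'" "real K' \<le> log 2 N / a + 1"
    using assms(1) a nat_ceiling_bounds[of "log 2 N / a"] by (auto simp: K'_def)
  obtain A where A: "finite A" "A \<noteq> {}" "card A \<le> N"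
    "integrable \<nu> (\<lambda>x. - log 2 (max_dist x A)) \<longrightarrow>
      (\<Sum>k=1..K. F k (m / real k)) \<le> (\<integral>x. - log 2 (max_dist x A) \<partial>\<nu>)"
    using quant_lower[OF assms(2,3)] by blast
  have "integrable \<nu> (\<lambda>x. - log 2 (max_dist x A))"
    using quant_upper[OF A(1-3) assms(1) K'] by blast
  then show ?thesis
    using A quant_error0_le_sum[OF assms(1) K'] by (intro quant_error0_lower[OF A(1-3)]) auto
qed

context
  fixes \<rho> :: "real measure"
  assumes \<rho>: "real_distribution \<rho>" and conv: "weak_conv_m (info_law \<nu>) \<rho>"
begin

interpretation \<rho>: real_distribution \<rho> by (rule \<rho>)

text \<open>For \<open>t < a\<close> the decay bound gives \<open>{..t}\<close> mass 0 at all levels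
  beyond \<open>log 2 C / (a - t)\<close>.\<close>

lemma limit_bounds: "AE y in \<rho>. a \<le> y \<and> y \<le> CARD('d)"
proof (rule weak_conv_carrier[OF real_distribution_info_law \<rho> conv tendsto_prob_above_dim])
  fix t :: real assume t: "t < a"
  obtain M where M: "log 2 C / (a - t) < real M" using reals_Archimedean2 by blast
  have "\<forall>\<^sub>F k in sequentially. measure (info_law \<nu> k) {..t} = 0"
    using eventually_ge_at_top[of "max M 1"]
  proof eventually_elim
    case (elim k)
    then have "log 2 C / (a - t) < real k" using M by linarith
    then have "t * real k < a * real k - log 2 C" using t by (simp add: field_simps)
    from F_eq_0[OF _ this] have "F k t = 0" using elim by simp
    then show ?case by (simp add: F_eq_cdf cdf_def)
  qed
  then show "(\<lambda>k. measure (info_law \<nu> k) {..t}) \<longlonglongrightarrow> 0" by (rule tendsto_eventually)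
qed

lemma limit_pos: "AE y in \<rho>. 0 < y"
  using limit_bounds by eventually_elim (use a in auto)

lemma integrable_inverse: "integrable \<rho> (\<lambda>y. 1 / y)"
proof (rule \<rho>.integrable_const_bound[of _ "1 / a"])
  show "AE y in \<rho>. norm (1 / y) \<le> 1 / a"
    using limit_bounds by eventually_elim (use a in \<open>auto intro: divide_left_mono\<close>)
qed simp

lemma integral_inverse_pos: "(\<integral>y. 1 / y \<partial>\<rho>) > 0"
proof -
  have "1 / CARD('d) \<le> (\<integral>y. 1 / y \<partial>\<rho>)"
  proof (rule \<rho>.integral_ge_const[OF integrable_inverse])
    show "AE y in \<rho>. 1 / CARD('d) \<le> 1 / y"
      using limit_bounds by eventually_elim (use a in \<open>auto intro!: divide_left_mono\<close>)
  qed
  moreover have "0 < 1 / real CARD('d)" by simp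
  ultimately show ?thesis by linarith
qed

lemma quant_error0_tendsto:
  "(\<lambda>N. - log 2 (quant_error0 \<nu> N) / log 2 (real N)) \<longlonglongrightarrow> (\<integral>y. 1 / y \<partial>\<rho>)"
proof -
  define n where "n N = log 2 (real N)" for N :: nat
  \<comment> \<open>The subtracted logarithm pays for the number of levels: it makes
    \<open>(K3 N + 1) * 2 powr \<eta> (n N) \<le> N\<close>, as \<open>quant_error0_ge_sum\<close>
    requires.\<close>
  define \<eta> where "\<eta> x = x - log 2 ((x + log 2 C) / a + 2)" for x
  \<comment> \<open>The maximum with 1 secures the bound \<open>r N \<ge> 1\<close> of
    \<open>Riemann_sum_tendsto\<close> for every \<open>N\<close>; it is inactive for large
    \<open>N\<close>.\<close>
  define r1 where "r1 N = max 1 (\<psi> (n N))" for N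
  define r2 where "r2 N = max 1 (\<eta> (n N))" for N
  define K1 where "K1 N = nat \<lceil>n N / a\<rceil>" for N
  \<comment> \<open>\<open>K1\<close> is the cutoff of \<open>quant_upper\<close>; the added term
    carries it past the cutoff of \<open>Riemann_sum_tendsto\<close>, at the price of further
    nonnegative terms.\<close>
  define K2 where "K2 N = K1 N + nat \<lceil>(r1 N + log 2 C) / a\<rceil>" for N
  define K3 where "K3 N = nat \<lceil>(r2 N + log 2 C) / a\<rceil>" for N
  define S1 where "S1 N = (\<Sum>k=1..K2 N. F k (r1 N / real k)) / r1 N" for N
  define S2 where "S2 N = (\<Sum>k=1..K3 N. F k (r2 N / real k)) / r2 N" for N
  have n: "filterlim n at_top sequentially" unfolding n_def by (rule log_nat_at_top)
  have \<psi>_eq: "\<psi> x = x + CARD('d) * log 2 3 + log 2 (x / a + 2)" for x by (simp add: \<psi>_def)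
  have \<psi>n: "(\<lambda>N. \<psi> (n N) / n N) \<longlonglongrightarrow> 1"
    unfolding \<psi>_eq by (rule filterlim_compose[OF log_correction_upper[OF a] n])
  have \<eta>n: "(\<lambda>N. \<eta> (n N) / n N) \<longlonglongrightarrow> 1" "filterlim (\<lambda>N. \<eta> (n N)) at_top sequentially"
    unfolding \<eta>_def by (rule filterlim_compose[OF log_correction_lower(1)[OF a] n],
      rule filterlim_compose[OF log_correction_lower(2)[OF a] n])
  have \<psi>_ge: "x \<le> \<psi> x" "1 \<le> \<psi> x" if "x \<ge> 0" for x
  proof -
    have "1 = log 2 (2 :: real)" by simp
    also have "\<dots> \<le> log 2 (x / a + 2)" using that a by (subst log_le_cancel_iff) (auto simp: add_nonneg_pos)
    finally have "1 \<le> log 2 (x / a + 2)" .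
    moreover have "0 \<le> CARD('d) * log 2 (3 :: real)" by simp
    ultimately show "x \<le> \<psi> x" "1 \<le> \<psi> x" using that unfolding \<psi>_def by linarith+
  qed
  have r1_eq: "r1 N = \<psi> (n N)" if "N \<ge> 1" for N
    using \<psi>_ge(2)[of "n N"] that by (simp add: r1_def n_def)
  have r_top: "filterlim r1 at_top sequentially" "filterlim r2 at_top sequentially"
  proof -
    have "\<forall>\<^sub>F N in sequentially. n N \<le> r1 N"
      using eventually_ge_at_top[of 1]
      by eventually_elim (use \<psi>_ge(1) in \<open>simp add: r1_eq n_def\<close>)
    then show "filterlim r1 at_top sequentially" by (rule filterlim_at_top_mono[OF n])
    show "filterlim r2 at_top sequentially"
      by (rule filterlim_at_top_mono[OF \<eta>n(2)]) (simp add: r2_def)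
  qed
  have r_ge: "1 \<le> r1 N" "1 \<le> r2 N" for N by (auto simp: r1_def r2_def)
  have S1: "S1 \<longlonglongrightarrow> (\<integral>y. 1 / y \<partial>\<rho>)"
    unfolding S1_def
  proof (rule Riemann_sum_tendsto[OF \<rho> conv limit_pos r_top(1) r_ge(1)])
    fix N
    have "(r1 N + log 2 C) / a \<le> real (nat \<lceil>(r1 N + log 2 C) / a\<rceil>)" by linarith
    then show "(r1 N + log 2 C) / a \<le> real (K2 N)" by (simp add: K2_def)
  qed
  have S2: "S2 \<longlonglongrightarrow> (\<integral>y. 1 / y \<partial>\<rho>)"
    unfolding S2_def
  proof (rule Riemann_sum_tendsto[OF \<rho> conv limit_pos r_top(2) r_ge(2)])
    fix N show "(r2 N + log 2 C) / a \<le> real (K3 N)" unfolding K3_def by linarith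
  qed
  have upper: "- log 2 (quant_error0 \<nu> N) \<le> r1 N * S1 N + (2 + tail_const)" if "N \<ge> 1" for N
  proof -
    have "0 \<le> n N / a" using that a by (simp add: n_def)
    from nat_ceiling_bounds[OF this]
    have "- log 2 (quant_error0 \<nu> N) \<le> (\<Sum>k=1..K1 N. F k (\<psi> (n N) / real k)) + (2 + tail_const)"
      using quant_error0_le_sum[OF that, of "K1 N"] by (simp add: K1_def n_def)
    also have "(\<Sum>k=1..K1 N. F k (\<psi> (n N) / real k)) \<le> (\<Sum>k=1..K2 N. F k (\<psi> (n N) / real k))"
      by (intro sum_mono2) (auto simp: K2_def F_bounds)
    also have "\<dots> = r1 N * S1 N" using r_ge(1)[of N] by (simp add: S1_def r1_eq[OF that])
    finally show ?thesis by simp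
  qed
  have lower: "r2 N * S2 N \<le> - log 2 (quant_error0 \<nu> N)" if N: "N \<ge> 1" "\<eta> (n N) \<ge> 1" for N
  proof -
    define z where "z = (n N + log 2 C) / a + 2"
    have n0: "n N \<ge> 0" using N by (simp add: n_def)
    have z: "z \<ge> 2" using n0 log_C_nonneg a by (simp add: z_def)
    then have "0 \<le> log 2 z" by simp
    then have \<eta>_le: "\<eta> (n N) \<le> n N" by (simp add: \<eta>_def z_def)
    have r2: "r2 N = \<eta> (n N)" using N by (simp add: r2_def)
    have "0 \<le> (r2 N + log 2 C) / a" using r_ge(2)[of N] log_C_nonneg a by simp
    from nat_ceiling_bounds(2)[OF this]
    have "real (K3 N) + 1 \<le> (r2 N + log 2 C) / a + 2" by (simp add: K3_def)
    also have "\<dots> \<le> z" unfolding z_def using \<eta>_le a by (simp add: r2 divide_right_mono)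
    finally have K3z: "real (K3 N) + 1 \<le> z" .
    have "2 powr r2 N = 2 powr n N / 2 powr log 2 z"
      unfolding r2 \<eta>_def z_def[symmetric] by (rule powr_diff)
    also have "\<dots> = real N / z" using N(1) z by (simp add: n_def)
    finally have "(real (K3 N) + 1) * 2 powr r2 N = (real (K3 N) + 1) * (real N / z)" by simp
    also have "\<dots> \<le> z * (real N / z)" using K3z z by (intro mult_right_mono) auto
    also have "\<dots> = real N" using z by simp
    finally have K3N: "(real (K3 N) + 1) * 2 powr r2 N \<le> real N" .
    have "(\<Sum>k=1..K3 N. F k (r2 N / real k)) \<le> - log 2 (quant_error0 \<nu> N)"
      using r_ge(2)[of N] by (intro quant_error0_ge_sum[OF N(1) _ K3N]) simp
    then show ?thesis using r_ge(2)[of N] by (simp add: S2_def)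
  qed
  show ?thesis
    unfolding n_def[symmetric]
  proof (rule tendsto_sandwich)
    have n_pos: "\<forall>\<^sub>F N in sequentially. 0 < n N"
      using n unfolding filterlim_at_top_dense by blast
    have \<eta>_ge: "\<forall>\<^sub>F N in sequentially. 1 \<le> \<eta> (n N)"
      using \<eta>n(2) unfolding filterlim_at_top by blast
    show "\<forall>\<^sub>F N in sequentially. \<eta> (n N) / n N * S2 N \<le> - log 2 (quant_error0 \<nu> N) / n N"
      using n_pos \<eta>_ge eventually_ge_at_top[of 1]
    proof eventually_elim
      case (elim N)
      have "r2 N * S2 N / n N \<le> - log 2 (quant_error0 \<nu> N) / n N"
        using lower[OF elim(3,2)] elim(1) by (intro divide_right_mono) auto
      then show ?case using elim(2) by (simp add: r2_def)
    qed
    show "\<forall>\<^sub>F N in sequentially. - log 2 (quant_error0 \<nu> N) / n N \<le> \<psi> (n N) / n N * S1 N + (2 + tail_const) / n N"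
      using n_pos eventually_ge_at_top[of 1]
    proof eventually_elim
      case (elim N)
      have "- log 2 (quant_error0 \<nu> N) / n N \<le> (r1 N * S1 N + (2 + tail_const)) / n N"
        using upper[OF elim(2)] elim(1) by (intro divide_right_mono) auto
      then show ?case by (simp add: r1_eq[OF elim(2)] add_divide_distrib)
    qed
    show "(\<lambda>N. \<eta> (n N) / n N * S2 N) \<longlonglongrightarrow> (\<integral>y. 1 / y \<partial>\<rho>)"
      using tendsto_mult[OF \<eta>n(1) S2] by simp
    have "(\<lambda>N. (2 + tail_const) / n N) \<longlonglongrightarrow> 0"
      using n by (intro tendsto_divide_0[OF tendsto_const]) (rule filterlim_at_top_imp_at_infinity)
    from tendsto_add[OF tendsto_mult[OF \<psi>n S1] this]
    show "(\<lambda>N. \<psi> (n N) / n N * S1 N + (2 + tail_const) / n N) \<longlonglongrightarrow> (\<integral>y. 1 / y \<partial>\<rho>)" by simp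
  qed
qed

lemma quant_dim0_seq_tendsto: "quant_dim0_seq \<nu> \<longlonglongrightarrow> inverse (\<integral>y. 1 / y \<partial>\<rho>)"
proof -
  have "(\<lambda>N. inverse (- log 2 (quant_error0 \<nu> N) / log 2 (real N))) \<longlonglongrightarrow> inverse (\<integral>y. 1 / y \<partial>\<rho>)"
    using integral_inverse_pos by (intro tendsto_inverse[OF quant_error0_tendsto]) simp
  moreover have "(\<lambda>N. inverse (- log 2 (quant_error0 \<nu> N) / log 2 (real N))) = quant_dim0_seq \<nu>"
    by (auto simp: quant_dim0_seq_def)
  ultimately show ?thesis by simp
qed

lemma exp_Psi_lim: "exp (Psi_lim \<nu> \<theta>) = (\<integral>y. exp (- \<theta> * y) \<partial>\<rho>)"
  using bounded_rv.mom_pos[OF limit_bounded_rv[OF \<rho> conv], of "- \<theta>"]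
  by (simp add: Psi_lim_eq[OF \<rho> conv] cgf_def exp_moment_def)

text \<open>\<open>nn_integral_Laplace\<close> identifies the nonnegative integrals; the bound 1 / a
  on 1 / y then makes them finite.\<close>

lemma exp_Psi_lim_integral:
  "set_integrable lborel {0..} (\<lambda>\<theta>. exp (Psi_lim \<nu> \<theta>))"
  "(LBINT \<theta>:{0..}. exp (Psi_lim \<nu> \<theta>)) = (\<integral>y. 1 / y \<partial>\<rho>)"
proof -
  have "Psi_lim \<nu> differentiable (at \<theta>)" for \<theta>
    using smooth_iff_deriv[THEN iffD1, OF smooth_Psi_lim[OF \<rho> conv]] by blast
  then have "continuous_on UNIV (Psi_lim \<nu>)"
    by (intro continuous_at_imp_continuous_on ballI differentiable_imp_continuous_within)
  then have [measurable]: "Psi_lim \<nu> \<in> borel_measurable borel"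
    by (rule borel_measurable_continuous_onI)
  have int: "integrable \<rho> (\<lambda>y. exp (- \<theta> * y))" for \<theta>
    by (rule bounded_rv.integrable_exp[OF limit_bounded_rv[OF \<rho> conv]])
  have "ennreal (exp (Psi_lim \<nu> \<theta>)) = (\<integral>\<^sup>+y. ennreal (exp (- \<theta> * y)) \<partial>\<rho>)" for \<theta>
    unfolding exp_Psi_lim using int by (subst nn_integral_eq_integral) auto
  then have nn: "(\<integral>\<^sup>+\<theta>. ennreal (indicator {0..} \<theta> *\<^sub>R exp (Psi_lim \<nu> \<theta>)) \<partial>lborel) = (\<integral>\<^sup>+y. ennreal (1 / y) \<partial>\<rho>)"
    unfolding \<rho>.nn_integral_Laplace[OF limit_pos, symmetric]
    by (intro nn_integral_cong) (simp add: indicator_def)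
  have pos: "AE y in \<rho>. 0 \<le> 1 / y" using limit_pos by eventually_elim simp
  have "(\<integral>\<^sup>+y. ennreal (1 / y) \<partial>\<rho>) < \<infinity>"
    using nn_integral_eq_integral[OF integrable_inverse pos] by simp
  then show "set_integrable lborel {0..} (\<lambda>\<theta>. exp (Psi_lim \<nu> \<theta>))"
    unfolding set_integrable_def by (intro integrableI_nonneg) (auto simp: nn[unfolded real_scaleR_def])
  show "(LBINT \<theta>:{0..}. exp (Psi_lim \<nu> \<theta>)) = (\<integral>y. 1 / y \<partial>\<rho>)"
    unfolding set_lebesgue_integral_def
    by (rule integral_eq_of_nn_integral_eq[OF _ _ _ pos nn]) auto
qed

end

end

theorem proposition5p1:
  fixes \<nu> :: "(real ^ 'd) measure" and a C :: real
  assumes prob: "prob_space \<nu>"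
    and borel: "sets \<nu> = sets borel"
    and supp: "topological_support \<nu> \<subseteq> interior (cbox 0 1)"
    and a: "a > 0" and C: "C \<ge> 1"
    and decay: "\<And>k Q. Q \<in> dyadic_cubes k \<Longrightarrow> measure \<nu> Q \<le> C * 2 powr (- a * real k)"
  shows
    "(\<forall>k\<ge>1.
        (\<forall>\<theta>. integrable \<nu> (\<lambda>x. exp (- \<theta> * info_rate \<nu> k x)) \<and>
             (\<integral>x. exp (- \<theta> * info_rate \<nu> k x) \<partial>\<nu>) > 0 \<and>
             Psi \<nu> k \<theta> = ln (\<integral>x. exp (- \<theta> * info_rate \<nu> k x) \<partial>\<nu>) \<and>
             Psi \<nu> k \<theta> = cgf \<nu> (\<lambda>x. - info_rate \<nu> k x) \<theta>) \<and>
        convex_on UNIV (Psi \<nu> k) \<and>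
        smooth (Psi \<nu> k) \<and> smooth (spectrum \<nu> k) \<and> smooth (cgf \<nu> (info_rate \<nu> k)) \<and>
        (\<forall>n\<ge>1.
           (deriv ^^ n) (Psi \<nu> k) 0 = (deriv ^^ n) (spectrum \<nu> k) 1 / (real k * ln 2) ^ (n - 1) \<and>
           (deriv ^^ n) (Psi \<nu> k) 0 = (- 1) ^ n * cumulant \<nu> (info_rate \<nu> k) n) \<and>
        deriv (Psi \<nu> k) 0 = - level_entropy \<nu> k \<and>
        (deriv ^^ 2) (Psi \<nu> k) 0 = variance_of \<nu> (info_rate \<nu> k) \<and>
        variance_of \<nu> (info_rate \<nu> k) = (deriv ^^ 2) (spectrum \<nu> k) 1 / (real k * ln 2))
     \<and>
     ((\<exists>\<rho>. real_distribution \<rho> \<and> weak_conv_m (info_law \<nu>) \<rho>) \<longleftrightarrow>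
        (\<forall>\<theta>. convergent (\<lambda>k. Psi \<nu> k \<theta>)))
     \<and>
     (\<forall>\<rho>. real_distribution \<rho> \<and> weak_conv_m (info_law \<nu>) \<rho> \<longrightarrow>
        measure \<rho> {sigma_minus \<nu>..sigma_plus \<nu>} = 1 \<and>
        (\<forall>\<theta>. convergent (\<lambda>k. Psi \<nu> k \<theta>) \<and>
             integrable \<rho> (\<lambda>y. exp (- \<theta> * y)) \<and>
             Psi_lim \<nu> \<theta> = ln (\<integral>y. exp (- \<theta> * y) \<partial>\<rho>)) \<and>
        smooth (cgf \<rho> (\<lambda>y. y)) \<and> smooth (Psi_lim \<nu>) \<and>
        (\<forall>n\<ge>1. (\<lambda>k. cumulant \<nu> (info_rate \<nu> k) n) \<longlonglongrightarrow> cumulant \<rho> (\<lambda>y. y) n) \<and>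
        convergent (level_entropy \<nu>) \<and>
        integrable \<rho> (\<lambda>y. y) \<and>
        entropy_dim \<nu> = (\<integral>y. y \<partial>\<rho>) \<and>
        entropy_dim \<nu> = - deriv (Psi_lim \<nu>) 0 \<and>
        convergent (quant_dim0_seq \<nu>) \<and>
        integrable \<rho> (\<lambda>y. 1 / y) \<and>
        quant_dim0 \<nu> = inverse (\<integral>y. 1 / y \<partial>\<rho>) \<and>
        set_integrable lborel {0..} (\<lambda>\<theta>. exp (Psi_lim \<nu> \<theta>)) \<and>
        quant_dim0 \<nu> = inverse (LBINT \<theta>:{0..}. exp (Psi_lim \<nu> \<theta>)) \<and>
        integrable \<rho> (\<lambda>y. y\<^sup>2) \<and>
        (\<lambda>k. (deriv ^^ 2) (spectrum \<nu> k) 1 / (real k * ln 2)) \<longlonglongrightarrow> variance_of \<rho> (\<lambda>y. y) \<and>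
        variance_of \<rho> (\<lambda>y. y) = (deriv ^^ 2) (Psi_lim \<nu>) 0)"
proof -
  interpret prob_space \<nu> by (rule prob)
  interpret dyadic_decay \<nu> a C
  proof
    show "AE x in \<nu>. x \<in> cbox 0 1"
      using AE_topological_support[OF prob borel]
      by eventually_elim (use supp interior_subset in blast)
  qed (use assms in auto)
  show ?thesis
  proof ((rule conjI[OF _ conjI[OF weak_conv_iff_Psi_convergent]]; intro allI impI), goal_cases)
    case (1 k)
    then show ?case by (rule Psi_k_properties)
  next
    case (2 \<rho>)
    then have \<rho>: "real_distribution \<rho>" "weak_conv_m (info_law \<nu>) \<rho>" by auto
    have conv: "convergent (quant_dim0_seq \<nu>)"
      using quant_dim0_seq_tendsto[OF \<rho>] by (auto simp: convergent_def)
    have dim: "quant_dim0 \<nu> = inverse (\<integral>y. 1 / y \<partial>\<rho>)"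
      unfolding quant_dim0_def by (rule limI[OF quant_dim0_seq_tendsto[OF \<rho>]])
    then have dim': "quant_dim0 \<nu> = inverse (LBINT \<theta>:{0..}. exp (Psi_lim \<nu> \<theta>))"
      by (simp only: exp_Psi_lim_integral(2)[OF \<rho>])
    show ?case
      using limit_properties[OF \<rho>] integrable_inverse[OF \<rho>] conv dim dim'
        exp_Psi_lim_integral(1)[OF \<rho>]
      by (elim conjE) (intro conjI; assumption)
  qed
qed

end
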